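(* Let $\mathcal S$ be a monoidal admissible class of spans in a monoidal category $\mathsf C$ such that every cospan in $\mathsf C$ whose legs are in $\mathcal S$ has an $\mathcal S$-relative pullback. Then the following two categories are equivalent. $\bullet$ The category $\mathsf{ReflGraphMon}_{\mathcal S}(\mathsf C)$. An object is a reflexive graph of monoids in $\mathsf C$, i.e. monoids $A,B$ and monoid morphisms $i:B\to A$, $s,t:A\to B$ with $s\circ i=1_B=t\circ i$, subject to: (a) the span $A\xleftarrow{1}A\xrightarrow{s}B$ belongs to $\mathcal S$ (hence the $\mathcal S$-relative pullback $A\Box_BI$ of $A\xrightarrow{s}B\xleftarrow{u}I$ exists); (b) the morphism $q:=m\circ(p_A\otimes i):(A\Box_BI)\otimes B\to A$ is invertible. A morphism $(B,A,i,s,t)\to(B',A',i',s',t')$ is a pair of monoid morphisms $(b:B\to B',\ a:A\to A')$ such that $s'\circ a=b\circ s$, $t'\circ a=b\circ t$ and $i'\circ b=a\circ i$. $\bullet$ The category $\mathsf{PreX}_{\mathcal S}(\mathsf C)$. An object consists of monoids $B$ and $Y$ in $\mathsf C$, monoid morphisms $e:Y\to I$ and $k:Y\to B$ and a distributive law $x:B\otimes Y\to Y\otimes B$, subject to: (a') the spans $Y\xleftarrow{1}Y\xrightarrow{e}I$ and $B\xleftarrow{1}B\xrightarrow{1}B$ belong to $\mathcal S$; (b') $(e\otimes1)\circ x=1\otimes e$ and $m\circ(k\otimes1)\circ x=m\circ(1\otimes k)$ (as morphisms $B\otimes Y\to B$); (c') the unique morphism $f:Y\to(Y\otimes B)\Box_BI$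 with $p_{Y\otimes B}\circ f=1\otimes u$ and $p_I\circ f=e$ is invertible, where $(Y\otimes B)\Box_BI$ is the $\mathcal S$-relative pullback of $Y\otimes B\xrightarrow{e\otimes1}B\xleftarrow{u}I$ (which exists by (a')). A morphism $(B,Y,e,k,x)\to(B',Y',e',k',x')$ is a pair of monoid morphisms $(b:B\to B',\ y:Y\to Y')$ such that $e'\circ y=e$, $k'\circ y=b\circ k$ and $x'\circ(b\otimes y)=(y\otimes b)\circ x$.
   Context: Notation. $\mathsf C$ is a monoidal category with product $\otimes$ and unit $I$; its coherence isomorphisms are suppressed. Identity morphisms are written $1$. The multiplication and unit of any monoid are denoted $m$ and $u$; $I$ is regarded as a monoid in the trivial way. Admissible class. A class $\mathcal S$ of spans in a category is admissible if: (POST) if $X\xleftarrow{f}A\xrightarrow{g}Y$ is in $\mathcal S$ then so is $X'\xleftarrow{f'\circ f}A\xrightarrow{g'\circ g}Y'$ for all morphisms $f':X\to X'$, $g':Y\to Y'$; (PRE) if $X\xleftarrow{f}A\xrightarrow{g}Y$ is in $\mathcal S$ then so is $X\xleftarrow{f\circ h}D\xrightarrow{g\circ h}Y$ for every $h:D\to A$. Monoidal class. A class $\mathcal S$ of spans in $\mathsf C$ is monoidal if it is unital, i.e. $I\xleftarrow{1}I\xrightarrow{1}I$ is in $\mathcal S$, and multiplicative, i.e. whenever $X\xleftarrow{f}A\xrightarrow{g}Y$ and $X'\xleftarrow{f'}A'\xrightarrow{g'}Y'$ are in $\mathcal S$, so is $X\otimes X'\xleftarrow{f\otimes f'}A\otimes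 A'\xrightarrow{g\otimes g'}Y\otimes Y'$. Legs. A cospan $A\xrightarrow{f}B\xleftarrow{g}C$ has its legs in $\mathcal S$ if the spans $A\xleftarrow{1}A\xrightarrow{f}B$ and $B\xleftarrow{g}C\xrightarrow{1}C$ are in $\mathcal S$. Relative pullback. An $\mathcal S$-relative pullback of a cospan $A\xrightarrow{f}B\xleftarrow{g}C$ is a span $A\xleftarrow{p_A}A\Box_BC\xrightarrow{p_C}C$ in $\mathcal S$ with $f\circ p_A=g\circ p_C$ such that: (universality) for every span $A\xleftarrow{a}D\xrightarrow{c}C$ in $\mathcal S$ with $f\circ a=g\circ c$ there is a unique $h:D\to A\Box_BC$ with $p_A\circ h=a$, $p_C\circ h=c$; (reflection) if for some $d:D\to A\Box_BC$, $e:D\to E$ both spans $A\xleftarrow{p_A\circ d}D\xrightarrow{e}E$ and $C\xleftarrow{p_C\circ d}D\xrightarrow{e}E$ are in $\mathcal S$, then so is $A\Box_BC\xleftarrow{d}D\xrightarrow{e}E$, and symmetrically, if both $E\xleftarrow{e}D\xrightarrow{p_A\circ d}A$ and $E\xleftarrow{e}D\xrightarrow{p_C\circ d}C$ are in $\mathcal S$, then so is $E\xleftarrow{e}D\xrightarrow{d}A\Box_BC$. If $f,g$ are monoid morphisms (and $\mathcal S$ is monoidal admissible), $A\Box_BC$ carries the unique monoid structure making $p_A,p_C$ monoid morphisms. Distributive law. For monoids $B,Y$, a distributive law is a morphism $x:B\otimes Y\to Y\otimes B$ with $x\circ(u\otimes1)=1\otimes u$, $x\circ(1\otimes u)=u\otimes1$,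 $x\circ(m\otimes1)=(1\otimes m)\circ(x\otimes1)\circ(1\otimes x)$ and $x\circ(1\otimes m)=(m\otimes1)\circ(1\otimes x)\circ(x\otimes1)$. *)

theory Defs
  imports Main
begin

section \<open>Categories, functors, equivalences\<close>

text \<open>
  Objects and arrows are carved out of arbitrary types by the carrier sets \<open>Ob\<close> and \<open>Ar\<close>.
  Composition is written in applicative order: \<open>g \<cdot> f\<close> is ``\<open>g\<close> after \<open>f\<close>''.
\<close>

record ('o, 'a) cat =
  Ob  :: "'o set"
  Ar  :: "'a set"
  Dom :: "'a \<Rightarrow> 'o"
  Cod :: "'a \<Rightarrow> 'o"
  Idt :: "'o \<Rightarrow> 'a"
  Cmp :: "'a \<Rightarrow> 'a \<Rightarrow> 'a"  (infixr "\<cdot>\<index>" 65)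

definition Hom :: "('o, 'a, 'z) cat_scheme \<Rightarrow> 'o \<Rightarrow> 'o \<Rightarrow> 'a set" where
  "Hom C X Y = {f \<in> Ar C. Dom C f = X \<and> Cod C f = Y}"

locale category =
  fixes C :: "('o, 'a, 'z) cat_scheme" (structure)
  assumes Dom_in: "f \<in> Ar C \<Longrightarrow> Dom C f \<in> Ob C"
    and Cod_in: "f \<in> Ar C \<Longrightarrow> Cod C f \<in> Ob C"
    and Idt_in: "X \<in> Ob C \<Longrightarrow> Idt C X \<in> Hom C X X"
    and Cmp_in: "\<lbrakk>f \<in> Hom C X Y; g \<in> Hom C Y Z\<rbrakk> \<Longrightarrow> g \<cdot> f \<in> Hom C X Z"
    and Cmp_Idt_left: "f \<in> Hom C X Y \<Longrightarrow> Idt C Y \<cdot> f = f"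
    and Cmp_Idt_right: "f \<in> Hom C X Y \<Longrightarrow> f \<cdot> Idt C X = f"
    and Cmp_assoc: "\<lbrakk>f \<in> Hom C W X; g \<in> Hom C X Y; h \<in> Hom C Y Z\<rbrakk>
      \<Longrightarrow> (h \<cdot> g) \<cdot> f = h \<cdot> (g \<cdot> f)"

definition inverse_arrows :: "('o, 'a, 'z) cat_scheme \<Rightarrow> 'a \<Rightarrow> 'a \<Rightarrow> bool" where
  "inverse_arrows C f g \<longleftrightarrow>
     f \<in> Ar C \<and> g \<in> Hom C (Cod C f) (Dom C f) \<and>
     g \<cdot> f = Idt C (Dom C f) \<and> f \<cdot> g = Idt C (Cod C f)" for C (structure)

definition invertible :: "('o, 'a, 'z) cat_scheme \<Rightarrow> 'a \<Rightarrow> bool" where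
  "invertible C f \<longleftrightarrow> (\<exists>g. inverse_arrows C f g)"

definition inv_arrow :: "('o, 'a, 'z) cat_scheme \<Rightarrow> 'a \<Rightarrow> 'a" where
  "inv_arrow C f = (THE g. inverse_arrows C f g)"

locale cat_functor = C: category C + D: category D
  for C :: "('o1, 'a1, 'z1) cat_scheme" and D :: "('o2, 'a2, 'z2) cat_scheme" +
  fixes Fo :: "'o1 \<Rightarrow> 'o2" and Fa :: "'a1 \<Rightarrow> 'a2"
  assumes obj: "X \<in> Ob C \<Longrightarrow> Fo X \<in> Ob D"
    and arr: "f \<in> Hom C X Y \<Longrightarrow> Fa f \<in> Hom D (Fo X) (Fo Y)"
    and idt: "X \<in> Ob C \<Longrightarrow> Fa (Idt C X) = Idt D (Fo X)"
    and cmp: "\<lbrakk>f \<in> Hom C X Y; g \<in> Hom C Y Z\<rbrakk> \<Longrightarrow> Fa (Cmp C g f) = Cmp D (Fa g) (Fa f)"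

locale natural_isomorphism =
  F: cat_functor C D Fo Fa + G: cat_functor C D Go Ga
  for C :: "('o1, 'a1, 'z1) cat_scheme" and D :: "('o2, 'a2, 'z2) cat_scheme"
    and Fo Fa Go Ga +
  fixes \<eta> :: "'o1 \<Rightarrow> 'a2"
  assumes component: "X \<in> Ob C \<Longrightarrow> \<eta> X \<in> Hom D (Fo X) (Go X)"
    and component_iso: "X \<in> Ob C \<Longrightarrow> invertible D (\<eta> X)"
    and naturality: "f \<in> Hom C X Y \<Longrightarrow> Cmp D (\<eta> Y) (Fa f) = Cmp D (Ga f) (\<eta> X)"

definition equivalent_categories ::
    "('o1, 'a1, 'z1) cat_scheme \<Rightarrow> ('o2, 'a2, 'z2) cat_scheme \<Rightarrow> bool" where
  "equivalent_categories C D \<longleftrightarrow>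
     (\<exists>Fo Fa Go Ga \<eta> \<epsilon>.
        cat_functor C D Fo Fa \<and> cat_functor D C Go Ga \<and>
        natural_isomorphism C C id id (Go \<circ> Fo) (Ga \<circ> Fa) \<eta> \<and>
        natural_isomorphism D D (Fo \<circ> Go) (Fa \<circ> Ga) id id \<epsilon>)"


section \<open>Monoidal categories\<close>

text \<open>
  Monoidal categories are not assumed strict.  The structure isomorphisms are oriented as
  \<open>Assoc X Y Z : (X \<otimes> Y) \<otimes> Z \<rightarrow> X \<otimes> (Y \<otimes> Z)\<close>, \<open>Lunit X : I \<otimes> X \<rightarrow> X\<close> and
  \<open>Runit X : X \<otimes> I \<rightarrow> X\<close>; they are inserted explicitly below wherever the usual notation
  suppresses them.
\<close>

record ('o, 'a) mcat = "('o, 'a) cat" +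
  TenO  :: "'o \<Rightarrow> 'o \<Rightarrow> 'o"  (infixr "\<odot>\<index>" 70)
  TenA  :: "'a \<Rightarrow> 'a \<Rightarrow> 'a"  (infixr "\<otimes>\<index>" 70)
  UnitO :: "'o"
  Assoc :: "'o \<Rightarrow> 'o \<Rightarrow> 'o \<Rightarrow> 'a"
  Lunit :: "'o \<Rightarrow> 'a"
  Runit :: "'o \<Rightarrow> 'a"

locale monoidal_category = category C
  for C :: "('o, 'a) mcat" (structure) +
  assumes UnitO_in: "UnitO C \<in> Ob C"
    and TenO_in: "\<lbrakk>X \<in> Ob C; Y \<in> Ob C\<rbrakk> \<Longrightarrow> X \<odot> Y \<in> Ob C"
    and TenA_in: "\<lbrakk>f \<in> Hom C X X'; g \<in> Hom C Y Y'\<rbrakk> \<Longrightarrow> f \<otimes> g \<in> Hom C (X \<odot> Y) (X' \<odot> Y')"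
    and TenA_Idt: "\<lbrakk>X \<in> Ob C; Y \<in> Ob C\<rbrakk> \<Longrightarrow> Idt C X \<otimes> Idt C Y = Idt C (X \<odot> Y)"
    and TenA_Cmp: "\<lbrakk>f \<in> Hom C X X'; f' \<in> Hom C X' X''; g \<in> Hom C Y Y'; g' \<in> Hom C Y' Y''\<rbrakk>
      \<Longrightarrow> (f' \<cdot> f) \<otimes> (g' \<cdot> g) = (f' \<otimes> g') \<cdot> (f \<otimes> g)"
    and Assoc_in: "\<lbrakk>X \<in> Ob C; Y \<in> Ob C; Z \<in> Ob C\<rbrakk>
      \<Longrightarrow> Assoc C X Y Z \<in> Hom C ((X \<odot> Y) \<odot> Z) (X \<odot> (Y \<odot> Z))"
    and Lunit_in: "X \<in> Ob C \<Longrightarrow> Lunit C X \<in> Hom C (UnitO C \<odot> X) X"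
    and Runit_in: "X \<in> Ob C \<Longrightarrow> Runit C X \<in> Hom C (X \<odot> UnitO C) X"
    and Assoc_iso: "\<lbrakk>X \<in> Ob C; Y \<in> Ob C; Z \<in> Ob C\<rbrakk> \<Longrightarrow> invertible C (Assoc C X Y Z)"
    and Lunit_iso: "X \<in> Ob C \<Longrightarrow> invertible C (Lunit C X)"
    and Runit_iso: "X \<in> Ob C \<Longrightarrow> invertible C (Runit C X)"
    and Assoc_nat: "\<lbrakk>f \<in> Hom C X X'; g \<in> Hom C Y Y'; h \<in> Hom C Z Z'\<rbrakk>
      \<Longrightarrow> Assoc C X' Y' Z' \<cdot> ((f \<otimes> g) \<otimes> h) = (f \<otimes> (g \<otimes> h)) \<cdot> Assoc C X Y Z"
    and Lunit_nat: "f \<in> Hom C X X'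
      \<Longrightarrow> Lunit C X' \<cdot> (Idt C (UnitO C) \<otimes> f) = f \<cdot> Lunit C X"
    and Runit_nat: "f \<in> Hom C X X'
      \<Longrightarrow> Runit C X' \<cdot> (f \<otimes> Idt C (UnitO C)) = f \<cdot> Runit C X"
    and pentagon: "\<lbrakk>W \<in> Ob C; X \<in> Ob C; Y \<in> Ob C; Z \<in> Ob C\<rbrakk>
      \<Longrightarrow> Assoc C W X (Y \<odot> Z) \<cdot> Assoc C (W \<odot> X) Y Z =
          (Idt C W \<otimes> Assoc C X Y Z) \<cdot> Assoc C W (X \<odot> Y) Z \<cdot> (Assoc C W X Y \<otimes> Idt C Z)"
    and triangle: "\<lbrakk>X \<in> Ob C; Y \<in> Ob C\<rbrakk>
      \<Longrightarrow> (Idt C X \<otimes> Lunit C Y) \<cdot> Assoc C X (UnitO C) Y = Runit C X \<otimes> Idt C Y"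


section \<open>Classes of spans and relative pullbacks\<close>

text \<open>
  A span \<open>X \<leftarrow> A \<rightarrow> Y\<close> is the pair \<open>(f, g)\<close> of its legs \<open>f : A \<rightarrow> X\<close> and \<open>g : A \<rightarrow> Y\<close>.
  A cospan \<open>A \<rightarrow> B \<leftarrow> D\<close> is given by its legs \<open>f : A \<rightarrow> B\<close> and \<open>g : D \<rightarrow> B\<close>.
\<close>

definition spans :: "('o, 'a, 'z) cat_scheme \<Rightarrow> ('a \<times> 'a) set" where
  "spans C = {(f, g). f \<in> Ar C \<and> g \<in> Ar C \<and> Dom C f = Dom C g}"

definition is_cospan :: "('o, 'a, 'z) cat_scheme \<Rightarrow> 'a \<Rightarrow> 'a \<Rightarrow> bool" where
  "is_cospan C f g \<longleftrightarrow> f \<in> Ar C \<and> g \<in> Ar C \<and> Cod C f = Cod C g"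

definition admissible :: "('o, 'a, 'z) cat_scheme \<Rightarrow> ('a \<times> 'a) set \<Rightarrow> bool" where
  "admissible C S \<longleftrightarrow>
     S \<subseteq> spans C \<and>
     (\<forall>f g f' g'. (f, g) \<in> S \<and> f' \<in> Ar C \<and> Dom C f' = Cod C f \<and> g' \<in> Ar C \<and> Dom C g' = Cod C g
        \<longrightarrow> (f' \<cdot> f, g' \<cdot> g) \<in> S) \<and>
     (\<forall>f g h. (f, g) \<in> S \<and> h \<in> Ar C \<and> Cod C h = Dom C f \<longrightarrow> (f \<cdot> h, g \<cdot> h) \<in> S)"
  for C (structure)

definition monoidal_class :: "('o, 'a) mcat \<Rightarrow> ('a \<times> 'a) set \<Rightarrow> bool" where
  "monoidal_class C S \<longleftrightarrow>
     S \<subseteq> spans C \<and>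
     (Idt C (UnitO C), Idt C (UnitO C)) \<in> S \<and>
     (\<forall>f g f' g'. (f, g) \<in> S \<and> (f', g') \<in> S \<longrightarrow> (f \<otimes> f', g \<otimes> g') \<in> S)"
  for C (structure)

definition legs_in :: "('o, 'a, 'z) cat_scheme \<Rightarrow> ('a \<times> 'a) set \<Rightarrow> 'a \<Rightarrow> 'a \<Rightarrow> bool" where
  "legs_in C S f g \<longleftrightarrow> (Idt C (Dom C f), f) \<in> S \<and> (g, Idt C (Dom C g)) \<in> S"

text \<open>
  \<open>is_rel_pullback C S f g pA pD\<close>: the span \<open>A \<leftarrow> P \<rightarrow> D\<close> with legs \<open>pA\<close>, \<open>pD\<close> is an
  \<open>S\<close>-relative pullback of the cospan \<open>A \<rightarrow> B \<leftarrow> D\<close> with legs \<open>f\<close>, \<open>g\<close>.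
\<close>

definition is_rel_pullback ::
    "('o, 'a, 'z) cat_scheme \<Rightarrow> ('a \<times> 'a) set \<Rightarrow> 'a \<Rightarrow> 'a \<Rightarrow> 'a \<Rightarrow> 'a \<Rightarrow> bool" where
  "is_rel_pullback C S f g pA pD \<longleftrightarrow>
     is_cospan C f g \<and>
     (pA, pD) \<in> S \<and> Cod C pA = Dom C f \<and> Cod C pD = Dom C g \<and> f \<cdot> pA = g \<cdot> pD \<and>
     \<comment> \<open>universality\<close>
     (\<forall>a d. (a, d) \<in> S \<and> Cod C a = Dom C f \<and> Cod C d = Dom C g \<and> f \<cdot> a = g \<cdot> d
        \<longrightarrow> (\<exists>!h. h \<in> Hom C (Dom C a) (Dom C pA) \<and> pA \<cdot> h = a \<and> pD \<cdot> h = d)) \<and>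
     \<comment> \<open>reflection\<close>
     (\<forall>d e. d \<in> Ar C \<and> Cod C d = Dom C pA \<and> e \<in> Ar C \<and> Dom C e = Dom C d \<and>
        (pA \<cdot> d, e) \<in> S \<and> (pD \<cdot> d, e) \<in> S \<longrightarrow> (d, e) \<in> S) \<and>
     (\<forall>d e. d \<in> Ar C \<and> Cod C d = Dom C pA \<and> e \<in> Ar C \<and> Dom C e = Dom C d \<and>
        (e, pA \<cdot> d) \<in> S \<and> (e, pD \<cdot> d) \<in> S \<longrightarrow> (e, d) \<in> S)"
  for C (structure)

text \<open>
  ``The'' relative pullback is an arbitrarily chosen one.  It is meaningful only if a relative
  pullback exists; being unique up to a unique isomorphism compatible with the projections, the
  invertibility conditions below do not depend on the choice.
\<close>

definition rel_pullback ::
    "('o, 'a, 'z) cat_scheme \<Rightarrow> ('a \<times> 'a) set \<Rightarrow> 'a \<Rightarrow> 'a \<Rightarrow> 'a \<times> 'a" where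
  "rel_pullback C S f g = (SOME p. is_rel_pullback C S f g (fst p) (snd p))"

definition proj_left :: "('o, 'a, 'z) cat_scheme \<Rightarrow> ('a \<times> 'a) set \<Rightarrow> 'a \<Rightarrow> 'a \<Rightarrow> 'a" where
  "proj_left C S f g = fst (rel_pullback C S f g)"

definition proj_right :: "('o, 'a, 'z) cat_scheme \<Rightarrow> ('a \<times> 'a) set \<Rightarrow> 'a \<Rightarrow> 'a \<Rightarrow> 'a" where
  "proj_right C S f g = snd (rel_pullback C S f g)"

definition pullback_obj :: "('o, 'a, 'z) cat_scheme \<Rightarrow> ('a \<times> 'a) set \<Rightarrow> 'a \<Rightarrow> 'a \<Rightarrow> 'o" where
  "pullback_obj C S f g = Dom C (proj_left C S f g)"


section \<open>Monoids and distributive laws\<close>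

record ('o, 'a) mon =
  carr :: "'o"
  mult :: "'a"
  unit :: "'a"

definition is_monoid :: "('o, 'a) mcat \<Rightarrow> ('o, 'a) mon \<Rightarrow> bool" where
  "is_monoid C M \<longleftrightarrow>
     carr M \<in> Ob C \<and>
     mult M \<in> Hom C (carr M \<odot> carr M) (carr M) \<and>
     unit M \<in> Hom C (UnitO C) (carr M) \<and>
     mult M \<cdot> (mult M \<otimes> Idt C (carr M)) =
       mult M \<cdot> (Idt C (carr M) \<otimes> mult M) \<cdot> Assoc C (carr M) (carr M) (carr M) \<and>
     mult M \<cdot> (unit M \<otimes> Idt C (carr M)) = Lunit C (carr M) \<and>
     mult M \<cdot> (Idt C (carr M) \<otimes> unit M) = Runit C (carr M)"
  for C (structure)

definition is_monoid_morphism ::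
    "('o, 'a) mcat \<Rightarrow> ('o, 'a) mon \<Rightarrow> ('o, 'a) mon \<Rightarrow> 'a \<Rightarrow> bool" where
  "is_monoid_morphism C M N f \<longleftrightarrow>
     f \<in> Hom C (carr M) (carr N) \<and>
     f \<cdot> mult M = mult N \<cdot> (f \<otimes> f) \<and>
     f \<cdot> unit M = unit N"
  for C (structure)

definition trivial_monoid :: "('o, 'a) mcat \<Rightarrow> ('o, 'a) mon" where
  "trivial_monoid C =
     \<lparr>carr = UnitO C, mult = Lunit C (UnitO C), unit = Idt C (UnitO C)\<rparr>"

definition distributive_law ::
    "('o, 'a) mcat \<Rightarrow> ('o, 'a) mon \<Rightarrow> ('o, 'a) mon \<Rightarrow> 'a \<Rightarrow> bool" where
  "distributive_law C MB MY x \<longleftrightarrow>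
     (let B = carr MB; Y = carr MY; \<alpha> = Assoc C;
          \<alpha>' = (\<lambda>X Y Z. inv_arrow C (Assoc C X Y Z));
          l' = (\<lambda>X. inv_arrow C (Lunit C X));
          r' = (\<lambda>X. inv_arrow C (Runit C X))
      in
        x \<in> Hom C (B \<odot> Y) (Y \<odot> B) \<and>
        x \<cdot> (unit MB \<otimes> Idt C Y) \<cdot> l' Y = (Idt C Y \<otimes> unit MB) \<cdot> r' Y \<and>
        x \<cdot> (Idt C B \<otimes> unit MY) \<cdot> r' B = (unit MY \<otimes> Idt C B) \<cdot> l' B \<and>
        x \<cdot> (mult MB \<otimes> Idt C Y) =
          (Idt C Y \<otimes> mult MB) \<cdot> \<alpha> Y B B \<cdot> (x \<otimes> Idt C B) \<cdot> \<alpha>' B Y B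
            \<cdot> (Idt C B \<otimes> x) \<cdot> \<alpha> B B Y \<and>
        x \<cdot> (Idt C B \<otimes> mult MY) =
          (mult MY \<otimes> Idt C B) \<cdot> \<alpha>' Y Y B \<cdot> (Idt C Y \<otimes> x) \<cdot> \<alpha> Y B Y
            \<cdot> (x \<otimes> Idt C Y) \<cdot> \<alpha>' B Y Y)"
  for C (structure)


section \<open>The two categories\<close>

text \<open>
  A morphism in either category is a pair of arrows of \<open>C\<close>; source and target are stored along
  with it, since the same pair may represent morphisms between different objects.
\<close>

record ('x, 'a) pair_mor =
  src  :: "'x"
  tgt  :: "'x"
  base :: "'a"
  top  :: "'a"

definition pair_comp ::
    "('o, 'a, 'z) cat_scheme \<Rightarrow> ('x, 'a) pair_mor \<Rightarrow> ('x, 'a) pair_mor \<Rightarrow> ('x, 'a) pair_mor" where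
  "pair_comp C \<psi> \<phi> =
     \<lparr>src = src \<phi>, tgt = tgt \<psi>, base = base \<psi> \<cdot> base \<phi>, top = top \<psi> \<cdot> top \<phi>\<rparr>"
  for C (structure)


subsection \<open>Reflexive graphs of monoids\<close>

record ('o, 'a) refl_graph =
  rgB :: "('o, 'a) mon"
  rgA :: "('o, 'a) mon"
  rgi :: "'a"
  rgs :: "'a"
  rgt :: "'a"

definition refl_graph_of_monoids :: "('o, 'a) mcat \<Rightarrow> ('o, 'a) refl_graph \<Rightarrow> bool" where
  "refl_graph_of_monoids C G \<longleftrightarrow>
     is_monoid C (rgA G) \<and> is_monoid C (rgB G) \<and>
     is_monoid_morphism C (rgB G) (rgA G) (rgi G) \<and>
     is_monoid_morphism C (rgA G) (rgB G) (rgs G) \<and>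
     is_monoid_morphism C (rgA G) (rgB G) (rgt G) \<and>
     rgs G \<cdot> rgi G = Idt C (carr (rgB G)) \<and>
     rgt G \<cdot> rgi G = Idt C (carr (rgB G))"
  for C (structure)

definition rg_q :: "('o, 'a) mcat \<Rightarrow> ('a \<times> 'a) set \<Rightarrow> ('o, 'a) refl_graph \<Rightarrow> 'a" where
  "rg_q C S G = mult (rgA G) \<cdot> (proj_left C S (rgs G) (unit (rgB G)) \<otimes> rgi G)"
  for C (structure)

definition refl_graph_mon_obj ::
    "('o, 'a) mcat \<Rightarrow> ('a \<times> 'a) set \<Rightarrow> ('o, 'a) refl_graph \<Rightarrow> bool" where
  "refl_graph_mon_obj C S G \<longleftrightarrow>
     refl_graph_of_monoids C G \<and>
     (Idt C (carr (rgA G)), rgs G) \<in> S \<and>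
     invertible C (rg_q C S G)"

definition refl_graph_mon_mor ::
    "('o, 'a) mcat \<Rightarrow> ('a \<times> 'a) set \<Rightarrow> (('o, 'a) refl_graph, 'a) pair_mor \<Rightarrow> bool" where
  "refl_graph_mon_mor C S \<phi> \<longleftrightarrow>
     (let G = src \<phi>; G' = tgt \<phi>; b = base \<phi>; a = top \<phi> in
        refl_graph_mon_obj C S G \<and> refl_graph_mon_obj C S G' \<and>
        is_monoid_morphism C (rgB G) (rgB G') b \<and>
        is_monoid_morphism C (rgA G) (rgA G') a \<and>
        rgs G' \<cdot> a = b \<cdot> rgs G \<and>
        rgt G' \<cdot> a = b \<cdot> rgt G \<and>
        rgi G' \<cdot> b = a \<cdot> rgi G)"
  for C (structure)

definition ReflGraphMon ::
    "('o, 'a) mcat \<Rightarrow> ('a \<times> 'a) set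
      \<Rightarrow> (('o, 'a) refl_graph, (('o, 'a) refl_graph, 'a) pair_mor) cat" where
  "ReflGraphMon C S =
     \<lparr>Ob = {G. refl_graph_mon_obj C S G},
      Ar = {\<phi>. refl_graph_mon_mor C S \<phi>},
      Dom = src,
      Cod = tgt,
      Idt = (\<lambda>G. \<lparr>src = G, tgt = G,
                  base = Idt C (carr (rgB G)), top = Idt C (carr (rgA G))\<rparr>),
      Cmp = pair_comp C\<rparr>"


subsection \<open>Pre-crossed modules of monoids\<close>

record ('o, 'a) pre_x =
  pxB :: "('o, 'a) mon"
  pxY :: "('o, 'a) mon"
  pxe :: "'a"
  pxk :: "'a"
  pxx :: "'a"

text \<open>The arrow \<open>e \<otimes> 1 : Y \<otimes> B \<rightarrow> I \<otimes> B \<cong> B\<close>.\<close>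

definition px_e1 :: "('o, 'a) mcat \<Rightarrow> ('o, 'a) pre_x \<Rightarrow> 'a" where
  "px_e1 C P = Lunit C (carr (pxB P)) \<cdot> (pxe P \<otimes> Idt C (carr (pxB P)))"
  for C (structure)

text \<open>The unique \<open>f : Y \<rightarrow> (Y \<otimes> B) \<box>\<^sub>B I\<close> with first projection
  \<open>1 \<otimes> u : Y \<cong> Y \<otimes> I \<rightarrow> Y \<otimes> B\<close> and second projection \<open>e\<close>.\<close>

definition px_f :: "('o, 'a) mcat \<Rightarrow> ('a \<times> 'a) set \<Rightarrow> ('o, 'a) pre_x \<Rightarrow> 'a" where
  "px_f C S P =
     (let Y = carr (pxY P); u = unit (pxB P); e1 = px_e1 C P in
        THE f. f \<in> Hom C Y (pullback_obj C S e1 u) \<and>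
               proj_left C S e1 u \<cdot> f = (Idt C Y \<otimes> u) \<cdot> inv_arrow C (Runit C Y) \<and>
               proj_right C S e1 u \<cdot> f = pxe P)"
  for C (structure)

definition pre_x_obj :: "('o, 'a) mcat \<Rightarrow> ('a \<times> 'a) set \<Rightarrow> ('o, 'a) pre_x \<Rightarrow> bool" where
  "pre_x_obj C S P \<longleftrightarrow>
     (let B = carr (pxB P); Y = carr (pxY P); m = mult (pxB P);
          e = pxe P; k = pxk P; x = pxx P
      in
        is_monoid C (pxB P) \<and> is_monoid C (pxY P) \<and>
        is_monoid_morphism C (pxY P) (trivial_monoid C) e \<and>
        is_monoid_morphism C (pxY P) (pxB P) k \<and>
        distributive_law C (pxB P) (pxY P) x \<and>
        (Idt C Y, e) \<in> S \<and> (Idt C B, Idt C B) \<in> S \<and>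
        px_e1 C P \<cdot> x = Runit C B \<cdot> (Idt C B \<otimes> e) \<and>
        m \<cdot> (k \<otimes> Idt C B) \<cdot> x = m \<cdot> (Idt C B \<otimes> k) \<and>
        invertible C (px_f C S P))"
  for C (structure)

definition pre_x_mor ::
    "('o, 'a) mcat \<Rightarrow> ('a \<times> 'a) set \<Rightarrow> (('o, 'a) pre_x, 'a) pair_mor \<Rightarrow> bool" where
  "pre_x_mor C S \<phi> \<longleftrightarrow>
     (let P = src \<phi>; P' = tgt \<phi>; b = base \<phi>; y = top \<phi> in
        pre_x_obj C S P \<and> pre_x_obj C S P' \<and>
        is_monoid_morphism C (pxB P) (pxB P') b \<and>
        is_monoid_morphism C (pxY P) (pxY P') y \<and>
        pxe P' \<cdot> y = pxe P \<and>
        pxk P' \<cdot> y = b \<cdot> pxk P \<and>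
        pxx P' \<cdot> (b \<otimes> y) = (y \<otimes> b) \<cdot> pxx P)"
  for C (structure)

definition PreX ::
    "('o, 'a) mcat \<Rightarrow> ('a \<times> 'a) set
      \<Rightarrow> (('o, 'a) pre_x, (('o, 'a) pre_x, 'a) pair_mor) cat" where
  "PreX C S =
     \<lparr>Ob = {P. pre_x_obj C S P},
      Ar = {\<phi>. pre_x_mor C S \<phi>},
      Dom = src,
      Cod = tgt,
      Idt = (\<lambda>P. \<lparr>src = P, tgt = P,
                  base = Idt C (carr (pxB P)), top = Idt C (carr (pxY P))\<rparr>),
      Cmp = pair_comp C\<rparr>"

end

theory Submission
  imports Defs
begin

text \<open>
  The functor from pre-crossed modules to reflexive graphs sends \<open>(B, Y, e, k, x)\<close> to the
  composite monoid \<open>A = Y \<otimes> B\<close> of the distributive law, with \<open>i = u \<otimes> 1\<close>, \<open>s = e \<otimes> 1\<close> and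
  \<open>t = m (k \<otimes> 1)\<close>, and a morphism \<open>(b, y)\<close> to \<open>(b, y \<otimes> b)\<close>.  It is shown to be full, faithful and
  essentially surjective.

  The guiding idea is that a monoid \<open>A\<close> whose elements are uniquely products \<open>j(y) i(b)\<close>, for monoid
  morphisms \<open>j : Y \<rightarrow> A\<close> and \<open>i : B \<rightarrow> A\<close>, is the same thing as a distributive law \<open>x\<close>, the rule
  rewriting \<open>i(b) j(y)\<close> as such a product.  One direction is \<open>distributive_law_of_factorization\<close>; for
  the other, \<open>composite_monoid\<close> constructs \<open>Y \<otimes> B\<close> and \<open>copairing\<close> describes the monoid morphisms out
  of it as pairs \<open>(g, h)\<close> with \<open>(g \<star> h) x = h \<star> g\<close>, where \<open>\<star>\<close> is the pointwise product.  The axioms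
  relating \<open>x\<close> to \<open>e\<close> and \<open>k\<close> are instances of this compatibility: they say that \<open>s\<close> and \<open>t\<close> are
  monoid morphisms.

  A split epimorphism \<open>s\<close> with splitting \<open>i\<close> has a relative kernel \<open>p : A \<box>\<^sub>B I \<rightarrow> A\<close>, and the invertibility of
  \<open>q = p \<star> i\<close> is the unique factorisation property for \<open>Y = A \<box>\<^sub>B I\<close>.  Conversely, for \<open>A = Y \<otimes> B\<close>
  the invertibility of \<open>f : Y \<rightarrow> A \<box>\<^sub>B I\<close> says that \<open>Y\<close> is this kernel.  The two conditions correspond to
  each other since \<open>q (f \<otimes> 1) = 1\<close> (\<open>graph_obj\<close>) in one direction, and since \<open>q\<close> is an isomorphism
  over \<open>B\<close> (\<open>graph_functor_essentially_surjective\<close>) in the other.  A morphism of graphs restricts to the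
  kernels and is recovered from this restriction and \<open>b\<close> by the factorisation, which gives
  \<open>graph_functor_full\<close> and \<open>graph_functor_faithful\<close>.
\<close>

section \<open>Calculating in categories and monoidal categories\<close>

context category
begin

abbreviation in_hom  ("\<guillemotleft>_ : _ \<rightarrow> _\<guillemotright>")
  where "\<guillemotleft>f : X \<rightarrow> Y\<guillemotright> \<equiv> f \<in> Hom C X Y"

lemma comp_type [simp]:
  assumes "f \<in> Ar C" "g \<in> Ar C" "Dom C g = Cod C f"
  shows "g \<cdot> f \<in> Ar C" "Dom C (g \<cdot> f) = Dom C f" "Cod C (g \<cdot> f) = Cod C g"
  using Cmp_in[of f "Dom C f" "Cod C f" g "Cod C g"] assms by (auto simp: Hom_def)

lemma ident_type [simp]:
  assumes "X \<in> Ob C"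
  shows "Idt C X \<in> Ar C" "Dom C (Idt C X) = X" "Cod C (Idt C X) = X"
  using Idt_in[OF assms] by (auto simp: Hom_def)

lemma ident_comp [simp]:
  "\<lbrakk>f \<in> Ar C; Cod C f = X\<rbrakk> \<Longrightarrow> Idt C X \<cdot> f = f"
  "\<lbrakk>f \<in> Ar C; Dom C f = X\<rbrakk> \<Longrightarrow> f \<cdot> Idt C X = f"
  using Cmp_Idt_left[of f "Dom C f" X] Cmp_Idt_right[of f X "Cod C f"] by (auto simp: Hom_def)

lemma comp_assoc [simp]:
  assumes "f \<in> Ar C" "g \<in> Ar C" "h \<in> Ar C" "Dom C g = Cod C f" "Dom C h = Cod C g"
  shows "(h \<cdot> g) \<cdot> f = h \<cdot> g \<cdot> f"
  using Cmp_assoc[of f "Dom C f" "Cod C f" g "Cod C g" h "Cod C h"] assms by (auto simp: Hom_def)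

declare Dom_in [simp] Cod_in [simp]

lemma in_homD: "\<guillemotleft>f : X \<rightarrow> Y\<guillemotright> \<Longrightarrow> f \<in> Ar C \<and> Dom C f = X \<and> Cod C f = Y \<and> X \<in> Ob C \<and> Y \<in> Ob C"
  by (auto simp: Hom_def)

lemma inverse_arrows_unique: "inverse_arrows C f g \<Longrightarrow> inverse_arrows C f h \<Longrightarrow> g = h"
proof -
  assume g: "inverse_arrows C f g" and h: "inverse_arrows C f h"
  then have "g = (h \<cdot> f) \<cdot> g"
    by (auto simp: inverse_arrows_def Hom_def)
  also have "\<dots> = h \<cdot> f \<cdot> g"
    using g h by (subst comp_assoc) (auto simp: inverse_arrows_def Hom_def)
  also have "\<dots> = h"
    using g h by (auto simp: inverse_arrows_def Hom_def)
  finally show ?thesis .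
qed

lemma inv_arrow_inverse: "invertible C f \<Longrightarrow> inverse_arrows C f (inv_arrow C f)"
  unfolding invertible_def inv_arrow_def
  using inverse_arrows_unique by (metis (mono_tags) theI)

lemma inv_arrow_type:
  assumes "invertible C f"
  shows "inv_arrow C f \<in> Ar C" "Dom C (inv_arrow C f) = Cod C f" "Cod C (inv_arrow C f) = Dom C f"
  using inv_arrow_inverse[OF assms] by (auto simp: inverse_arrows_def Hom_def)

lemma inv_arrow_comp:
  assumes "invertible C f"
  shows "inv_arrow C f \<cdot> f = Idt C (Dom C f)" "f \<cdot> inv_arrow C f = Idt C (Cod C f)"
  using inv_arrow_inverse[OF assms] by (auto simp: inverse_arrows_def Hom_def)

lemma invertible_in_Ar: "invertible C f \<Longrightarrow> f \<in> Ar C"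
  by (auto simp: invertible_def inverse_arrows_def)

lemma inv_arrow_comp_assoc:
  assumes "invertible C f" "h \<in> Ar C"
  shows "Cod C h = Dom C f \<Longrightarrow> inv_arrow C f \<cdot> f \<cdot> h = h"
    "Cod C h = Cod C f \<Longrightarrow> f \<cdot> inv_arrow C f \<cdot> h = h"
  using inv_arrow_comp[OF assms(1)] inv_arrow_type[OF assms(1)] invertible_in_Ar[OF assms(1)] assms(2)
  by (metis comp_assoc ident_comp(1))+

lemma invertibleI:
  assumes "\<guillemotleft>f : X \<rightarrow> Y\<guillemotright>" "\<guillemotleft>g : Y \<rightarrow> X\<guillemotright>" "g \<cdot> f = Idt C X" "f \<cdot> g = Idt C Y"
  shows "invertible C f"
  using assms by (auto simp: invertible_def inverse_arrows_def Hom_def)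

lemma cancel_left_iso:
  assumes "invertible C q" "q \<cdot> f = q \<cdot> g" "f \<in> Ar C" "g \<in> Ar C" "Cod C f = Dom C q" "Cod C g = Dom C q"
  shows "f = g"
  using assms by (metis inv_arrow_comp_assoc(1))

lemma cancel_right_iso:
  assumes "invertible C q" "f \<cdot> q = g \<cdot> q" "f \<in> Ar C" "g \<in> Ar C" "Dom C f = Cod C q" "Dom C g = Cod C q"
  shows "f = g"
proof -
  have "f = (f \<cdot> q) \<cdot> inv_arrow C q"
    using assms(1,3,5) by (simp add: inv_arrow_comp inv_arrow_type invertible_in_Ar)
  also have "\<dots> = g"
    unfolding assms(2) using assms(1,4,6)
    by (simp add: inv_arrow_comp inv_arrow_type invertible_in_Ar)
  finally show ?thesis .
qed

text \<open>
  Composites are normalised to right-associated form, so an equation between two-fold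
  composites meets a redex only if it is also available with an arbitrary tail; this is the purpose
  of the rules with the suffix \<open>tail\<close>.
\<close>

lemma comp_cong_tail:
  assumes "a \<cdot> b = c" "a \<in> Ar C" "b \<in> Ar C" "z \<in> Ar C" "Dom C a = Cod C b" "Dom C b = Cod C z"
  shows "a \<cdot> b \<cdot> z = c \<cdot> z"
  using assms by (metis comp_assoc)

end

context monoidal_category
begin

abbreviation I where "I \<equiv> UnitO C"
abbreviation lun ("\<l>") where "\<l> \<equiv> Lunit C"
abbreviation run ("\<r>") where "\<r> \<equiv> Runit C"
abbreviation ass ("\<a>") where "\<a> \<equiv> Assoc C"
abbreviation lun' ("\<l>''") where "\<l>' X \<equiv> inv_arrow C (\<l> X)"
abbreviation run' ("\<r>''") where "\<r>' X \<equiv> inv_arrow C (\<r> X)"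
abbreviation ass' ("\<a>''") where "\<a>' X Y Z \<equiv> inv_arrow C (\<a> X Y Z)"
abbreviation idt ("\<one>") where "\<one> \<equiv> Idt C"

declare UnitO_in [simp] TenO_in [simp]

lemma ten_type [simp]:
  assumes "f \<in> Ar C" "g \<in> Ar C"
  shows "f \<otimes> g \<in> Ar C" "Dom C (f \<otimes> g) = Dom C f \<odot> Dom C g" "Cod C (f \<otimes> g) = Cod C f \<odot> Cod C g"
  using TenA_in[of f "Dom C f" "Cod C f" g "Dom C g" "Cod C g"] assms by (auto simp: Hom_def)

lemma ten_ident [simp]: "\<lbrakk>X \<in> Ob C; Y \<in> Ob C\<rbrakk> \<Longrightarrow> \<one> X \<otimes> \<one> Y = \<one> (X \<odot> Y)"
  by (rule TenA_Idt)

lemma interchange: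
  assumes "f \<in> Ar C" "g \<in> Ar C" "f' \<in> Ar C" "g' \<in> Ar C" "Dom C f' = Cod C f" "Dom C g' = Cod C g"
  shows "(f' \<otimes> g') \<cdot> (f \<otimes> g) = (f' \<cdot> f) \<otimes> (g' \<cdot> g)"
  using TenA_Cmp[of f "Dom C f" "Cod C f" f' "Cod C f'" g "Dom C g" "Cod C g" g' "Cod C g'"] assms
  by (auto simp: Hom_def)

lemma interchange_tail:
  assumes "f \<in> Ar C" "g \<in> Ar C" "f' \<in> Ar C" "g' \<in> Ar C" "Dom C f' = Cod C f" "Dom C g' = Cod C g"
    "h \<in> Ar C" "Cod C h = Dom C f \<odot> Dom C g"
  shows "(f' \<otimes> g') \<cdot> (f \<otimes> g) \<cdot> h = ((f' \<cdot> f) \<otimes> (g' \<cdot> g)) \<cdot> h"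
  by (rule comp_cong_tail[OF interchange]) (use assms in simp_all)

lemmas merge = interchange interchange_tail

lemma structural_type [simp]:
  "\<lbrakk>X \<in> Ob C; Y \<in> Ob C; Z \<in> Ob C\<rbrakk> \<Longrightarrow> \<a> X Y Z \<in> Ar C"
  "\<lbrakk>X \<in> Ob C; Y \<in> Ob C; Z \<in> Ob C\<rbrakk> \<Longrightarrow> Dom C (\<a> X Y Z) = (X \<odot> Y) \<odot> Z"
  "\<lbrakk>X \<in> Ob C; Y \<in> Ob C; Z \<in> Ob C\<rbrakk> \<Longrightarrow> Cod C (\<a> X Y Z) = X \<odot> Y \<odot> Z"
  "X \<in> Ob C \<Longrightarrow> \<l> X \<in> Ar C" "X \<in> Ob C \<Longrightarrow> Dom C (\<l> X) = I \<odot> X" "X \<in> Ob C \<Longrightarrow> Cod C (\<l> X) = X"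
  "X \<in> Ob C \<Longrightarrow> \<r> X \<in> Ar C" "X \<in> Ob C \<Longrightarrow> Dom C (\<r> X) = X \<odot> I" "X \<in> Ob C \<Longrightarrow> Cod C (\<r> X) = X"
  using Assoc_in[of X Y Z] Lunit_in[of X] Runit_in[of X] by (auto simp: Hom_def)

lemma structural_inverse_type [simp]:
  "\<lbrakk>X \<in> Ob C; Y \<in> Ob C; Z \<in> Ob C\<rbrakk> \<Longrightarrow> \<a>' X Y Z \<in> Ar C"
  "\<lbrakk>X \<in> Ob C; Y \<in> Ob C; Z \<in> Ob C\<rbrakk> \<Longrightarrow> Cod C (\<a>' X Y Z) = (X \<odot> Y) \<odot> Z"
  "\<lbrakk>X \<in> Ob C; Y \<in> Ob C; Z \<in> Ob C\<rbrakk> \<Longrightarrow> Dom C (\<a>' X Y Z) = X \<odot> Y \<odot> Z"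
  "X \<in> Ob C \<Longrightarrow> \<l>' X \<in> Ar C" "X \<in> Ob C \<Longrightarrow> Cod C (\<l>' X) = I \<odot> X" "X \<in> Ob C \<Longrightarrow> Dom C (\<l>' X) = X"
  "X \<in> Ob C \<Longrightarrow> \<r>' X \<in> Ar C" "X \<in> Ob C \<Longrightarrow> Cod C (\<r>' X) = X \<odot> I" "X \<in> Ob C \<Longrightarrow> Dom C (\<r>' X) = X"
  by (simp_all add: inv_arrow_type Assoc_iso Lunit_iso Runit_iso)

lemma structural_inverse [simp]:
  "\<lbrakk>X \<in> Ob C; Y \<in> Ob C; Z \<in> Ob C\<rbrakk> \<Longrightarrow> \<a> X Y Z \<cdot> \<a>' X Y Z = \<one> (X \<odot> Y \<odot> Z)"
  "\<lbrakk>X \<in> Ob C; Y \<in> Ob C; Z \<in> Ob C\<rbrakk> \<Longrightarrow> \<a>' X Y Z \<cdot> \<a> X Y Z = \<one> ((X \<odot> Y) \<odot> Z)"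
  "X \<in> Ob C \<Longrightarrow> \<l> X \<cdot> \<l>' X = \<one> X" "X \<in> Ob C \<Longrightarrow> \<l>' X \<cdot> \<l> X = \<one> (I \<odot> X)"
  "X \<in> Ob C \<Longrightarrow> \<r> X \<cdot> \<r>' X = \<one> X" "X \<in> Ob C \<Longrightarrow> \<r>' X \<cdot> \<r> X = \<one> (X \<odot> I)"
  by (simp_all add: inv_arrow_comp Assoc_iso Lunit_iso Runit_iso)

lemma structural_inverse_tail [simp]:
  "\<lbrakk>X \<in> Ob C; Y \<in> Ob C; Z \<in> Ob C; h \<in> Ar C; Cod C h = X \<odot> Y \<odot> Z\<rbrakk> \<Longrightarrow> \<a> X Y Z \<cdot> \<a>' X Y Z \<cdot> h = h"
  "\<lbrakk>X \<in> Ob C; Y \<in> Ob C; Z \<in> Ob C; h \<in> Ar C; Cod C h = (X \<odot> Y) \<odot> Z\<rbrakk> \<Longrightarrow> \<a>' X Y Z \<cdot> \<a> X Y Z \<cdot> h = h"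
  "\<lbrakk>X \<in> Ob C; h \<in> Ar C; Cod C h = X\<rbrakk> \<Longrightarrow> \<l> X \<cdot> \<l>' X \<cdot> h = h"
  "\<lbrakk>X \<in> Ob C; h \<in> Ar C; Cod C h = I \<odot> X\<rbrakk> \<Longrightarrow> \<l>' X \<cdot> \<l> X \<cdot> h = h"
  "\<lbrakk>X \<in> Ob C; h \<in> Ar C; Cod C h = X\<rbrakk> \<Longrightarrow> \<r> X \<cdot> \<r>' X \<cdot> h = h"
  "\<lbrakk>X \<in> Ob C; h \<in> Ar C; Cod C h = X \<odot> I\<rbrakk> \<Longrightarrow> \<r>' X \<cdot> \<r> X \<cdot> h = h"
  by (simp_all add: inv_arrow_comp_assoc Assoc_iso Lunit_iso Runit_iso)

lemma assoc_nat:
  "\<lbrakk>f \<in> Ar C; g \<in> Ar C; h \<in> Ar C; X' = Cod C f; Y' = Cod C g; Z' = Cod C h\<rbrakk>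
    \<Longrightarrow> \<a> X' Y' Z' \<cdot> ((f \<otimes> g) \<otimes> h) = (f \<otimes> g \<otimes> h) \<cdot> \<a> (Dom C f) (Dom C g) (Dom C h)"
  by (rule Assoc_nat) (auto simp: Hom_def)

lemma assoc_nat_tail:
  "\<lbrakk>f \<in> Ar C; g \<in> Ar C; h \<in> Ar C; X' = Cod C f; Y' = Cod C g; Z' = Cod C h; k \<in> Ar C;
     Cod C k = (Dom C f \<odot> Dom C g) \<odot> Dom C h\<rbrakk>
    \<Longrightarrow> \<a> X' Y' Z' \<cdot> ((f \<otimes> g) \<otimes> h) \<cdot> k = (f \<otimes> g \<otimes> h) \<cdot> \<a> (Dom C f) (Dom C g) (Dom C h) \<cdot> k"
  by (subst comp_cong_tail[OF assoc_nat]) auto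

lemma assoc'_nat:
  assumes "f \<in> Ar C" "g \<in> Ar C" "h \<in> Ar C" "X' = Cod C f" "Y' = Cod C g" "Z' = Cod C h"
  shows "\<a>' X' Y' Z' \<cdot> (f \<otimes> g \<otimes> h) = ((f \<otimes> g) \<otimes> h) \<cdot> \<a>' (Dom C f) (Dom C g) (Dom C h)"
proof (rule cancel_left_iso[of "\<a> X' Y' Z'"])
  show "\<a> X' Y' Z' \<cdot> \<a>' X' Y' Z' \<cdot> (f \<otimes> g \<otimes> h)
      = \<a> X' Y' Z' \<cdot> ((f \<otimes> g) \<otimes> h) \<cdot> \<a>' (Dom C f) (Dom C g) (Dom C h)"
    using assms by (simp add: assoc_nat_tail)
qed (use assms in \<open>simp_all add: Assoc_iso\<close>)

lemma assoc'_nat_tail: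
  "\<lbrakk>f \<in> Ar C; g \<in> Ar C; h \<in> Ar C; X' = Cod C f; Y' = Cod C g; Z' = Cod C h; k \<in> Ar C;
     Cod C k = Dom C f \<odot> Dom C g \<odot> Dom C h\<rbrakk>
    \<Longrightarrow> \<a>' X' Y' Z' \<cdot> (f \<otimes> g \<otimes> h) \<cdot> k = ((f \<otimes> g) \<otimes> h) \<cdot> \<a>' (Dom C f) (Dom C g) (Dom C h) \<cdot> k"
  by (subst comp_cong_tail[OF assoc'_nat]) auto

lemma unit_nat:
  "\<lbrakk>f \<in> Ar C; Cod C f = X'\<rbrakk> \<Longrightarrow> \<l> X' \<cdot> (\<one> I \<otimes> f) = f \<cdot> \<l> (Dom C f)"
  "\<lbrakk>f \<in> Ar C; Cod C f = X'\<rbrakk> \<Longrightarrow> \<r> X' \<cdot> (f \<otimes> \<one> I) = f \<cdot> \<r> (Dom C f)"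
  using Lunit_nat[of f "Dom C f" X'] Runit_nat[of f "Dom C f" X'] by (auto simp: Hom_def)

lemma unit'_nat:
  assumes "f \<in> Ar C" "Cod C f = X'"
  shows "(\<one> I \<otimes> f) \<cdot> \<l>' (Dom C f) = \<l>' X' \<cdot> f"
    "(f \<otimes> \<one> I) \<cdot> \<r>' (Dom C f) = \<r>' X' \<cdot> f"
proof -
  have "(\<l> X' \<cdot> (\<one> I \<otimes> f)) \<cdot> \<l>' (Dom C f) = f" "(\<r> X' \<cdot> (f \<otimes> \<one> I)) \<cdot> \<r>' (Dom C f) = f"
    using assms by (simp_all only: unit_nat) simp_all
  then have "\<l> X' \<cdot> (\<one> I \<otimes> f) \<cdot> \<l>' (Dom C f) = \<l> X' \<cdot> \<l>' X' \<cdot> f"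
    "\<r> X' \<cdot> (f \<otimes> \<one> I) \<cdot> \<r>' (Dom C f) = \<r> X' \<cdot> \<r>' X' \<cdot> f"
    using assms by auto
  then show "(\<one> I \<otimes> f) \<cdot> \<l>' (Dom C f) = \<l>' X' \<cdot> f" "(f \<otimes> \<one> I) \<cdot> \<r>' (Dom C f) = \<r>' X' \<cdot> f"
    using assms by (auto intro: cancel_left_iso[OF Lunit_iso[of X']] cancel_left_iso[OF Runit_iso[of X']])
qed

section \<open>Coherence of the unit isomorphisms\<close>

lemma unit_ten_faithful:
  assumes "\<one> I \<otimes> f = \<one> I \<otimes> g" "f \<in> Ar C" "g \<in> Ar C" "Dom C f = Dom C g" "Cod C f = Cod C g"
  shows "f = g"
proof (rule cancel_right_iso[of "\<l> (Dom C g)"])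
  show "f \<cdot> \<l> (Dom C g) = g \<cdot> \<l> (Dom C g)"
    using assms unit_nat(1)[of f "Cod C g"] unit_nat(1)[of g "Cod C g"] by simp
qed (use assms in \<open>auto simp: Lunit_iso\<close>)

lemma ten_unit_faithful:
  assumes "f \<otimes> \<one> I = g \<otimes> \<one> I" "f \<in> Ar C" "g \<in> Ar C" "Dom C f = Dom C g" "Cod C f = Cod C g"
  shows "f = g"
proof (rule cancel_right_iso[of "\<r> (Dom C g)"])
  show "f \<cdot> \<r> (Dom C g) = g \<cdot> \<r> (Dom C g)"
    using assms unit_nat(2)[of f "Cod C g"] unit_nat(2)[of g "Cod C g"] by simp
qed (use assms in \<open>auto simp: Runit_iso\<close>)

lemma inverse_arrows_ten:
  assumes "inverse_arrows C f f'" "inverse_arrows C g g'"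
  shows "inverse_arrows C (f \<otimes> g) (f' \<otimes> g')"
  using assms by (auto simp: inverse_arrows_def Hom_def interchange)

lemma invertible_ten: "\<lbrakk>invertible C f; invertible C g\<rbrakk> \<Longrightarrow> invertible C (f \<otimes> g)"
  unfolding invertible_def using inverse_arrows_ten by blast

lemma invertible_ident: "X \<in> Ob C \<Longrightarrow> invertible C (\<one> X)"
  by (rule invertibleI[of _ X X "\<one> X"]) (auto simp: Hom_def)

text \<open>
  Kelly's observation: the pentagon and the triangle imply the remaining unit coherences.  It is
  enough to compare both sides after tensoring with the unit on the left, where the triangle turns
  \<open>l\<close> into \<open>r\<close>, on which the pentagon can act; for \<open>r\<close> one tensors on the right instead.
\<close>

lemma lunit_ten:
  assumes [simp]: "X \<in> Ob C" "Y \<in> Ob C"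
  shows "\<l> (X \<odot> Y) \<cdot> \<a> I X Y = \<l> X \<otimes> \<one> Y"
proof (rule unit_ten_faithful)
  show "\<one> I \<otimes> (\<l> (X \<odot> Y) \<cdot> \<a> I X Y) = \<one> I \<otimes> \<l> X \<otimes> \<one> Y"
  proof (rule cancel_right_iso[of "\<a> I (I \<odot> X) Y"], simp add: Assoc_iso,
      rule cancel_right_iso[of "\<a> I I X \<otimes> \<one> Y"], simp add: invertible_ten Assoc_iso invertible_ident)
    have "((\<one> I \<otimes> (\<l> (X \<odot> Y) \<cdot> \<a> I X Y)) \<cdot> \<a> I (I \<odot> X) Y) \<cdot> (\<a> I I X \<otimes> \<one> Y)
        = (\<one> I \<otimes> \<l> (X \<odot> Y)) \<cdot> (\<one> I \<otimes> \<a> I X Y) \<cdot> \<a> I (I \<odot> X) Y \<cdot> (\<a> I I X \<otimes> \<one> Y)"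
      by (simp add: merge)
    also have "\<dots> = ((\<one> I \<otimes> \<l> (X \<odot> Y)) \<cdot> \<a> I I (X \<odot> Y)) \<cdot> \<a> (I \<odot> I) X Y"
      by (simp flip: pentagon)
    also have "\<dots> = (\<r> I \<otimes> \<one> X \<otimes> \<one> Y) \<cdot> \<a> (I \<odot> I) X Y"
      by (simp only: triangle assms UnitO_in TenO_in ten_ident)
    also have "\<dots> = \<a> I X Y \<cdot> ((\<r> I \<otimes> \<one> X) \<otimes> \<one> Y)"
      by (simp add: assoc_nat del: ten_ident)
    also have "\<dots> = \<a> I X Y \<cdot> ((\<one> I \<otimes> \<l> X) \<otimes> \<one> Y) \<cdot> (\<a> I I X \<otimes> \<one> Y)"
      by (simp add: interchange triangle)
    also have "\<dots> = ((\<one> I \<otimes> \<l> X \<otimes> \<one> Y) \<cdot> \<a> I (I \<odot> X) Y) \<cdot> (\<a> I I X \<otimes> \<one> Y)"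
      by (simp add: assoc_nat_tail)
    finally show "((\<one> I \<otimes> (\<l> (X \<odot> Y) \<cdot> \<a> I X Y)) \<cdot> \<a> I (I \<odot> X) Y) \<cdot> (\<a> I I X \<otimes> \<one> Y)
        = ((\<one> I \<otimes> \<l> X \<otimes> \<one> Y) \<cdot> \<a> I (I \<odot> X) Y) \<cdot> (\<a> I I X \<otimes> \<one> Y)" .
  qed simp_all
qed simp_all

lemma runit_ten:
  assumes [simp]: "X \<in> Ob C" "Y \<in> Ob C"
  shows "(\<one> X \<otimes> \<r> Y) \<cdot> \<a> X Y I = \<r> (X \<odot> Y)"
proof (rule ten_unit_faithful)
  show "((\<one> X \<otimes> \<r> Y) \<cdot> \<a> X Y I) \<otimes> \<one> I = \<r> (X \<odot> Y) \<otimes> \<one> I"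
  proof (rule cancel_left_iso[of "\<a> X Y I"], simp add: Assoc_iso)
    have "\<a> X Y I \<cdot> (((\<one> X \<otimes> \<r> Y) \<cdot> \<a> X Y I) \<otimes> \<one> I)
        = \<a> X Y I \<cdot> ((\<one> X \<otimes> \<r> Y) \<otimes> \<one> I) \<cdot> (\<a> X Y I \<otimes> \<one> I)"
      by (simp add: interchange)
    also have "\<dots> = (\<one> X \<otimes> \<r> Y \<otimes> \<one> I) \<cdot> \<a> X (Y \<odot> I) I \<cdot> (\<a> X Y I \<otimes> \<one> I)"
      by (simp add: assoc_nat_tail)
    also have "\<dots> = (\<one> X \<otimes> \<one> Y \<otimes> \<l> I) \<cdot> (\<one> X \<otimes> \<a> Y I I) \<cdot> \<a> X (Y \<odot> I) I \<cdot> (\<a> X Y I \<otimes> \<one> I)"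
      by (simp add: merge triangle)
    also have "\<dots> = (\<one> X \<otimes> \<one> Y \<otimes> \<l> I) \<cdot> \<a> X Y (I \<odot> I) \<cdot> \<a> (X \<odot> Y) I I"
      by (simp add: pentagon)
    also have "\<dots> = \<a> X Y I \<cdot> (\<one> (X \<odot> Y) \<otimes> \<l> I) \<cdot> \<a> (X \<odot> Y) I I"
      using assoc_nat_tail[of "\<one> X" "\<one> Y" "\<l> I" X Y I "\<a> (X \<odot> Y) I I"] by simp
    also have "\<dots> = \<a> X Y I \<cdot> (\<r> (X \<odot> Y) \<otimes> \<one> I)"
      by (simp add: triangle)
    finally show "\<a> X Y I \<cdot> (((\<one> X \<otimes> \<r> Y) \<cdot> \<a> X Y I) \<otimes> \<one> I) = \<a> X Y I \<cdot> (\<r> (X \<odot> Y) \<otimes> \<one> I)" .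
  qed simp_all
qed simp_all

text \<open>
  Naturality of \<open>l\<close> at \<open>l\<^bsub>I\<^esub>\<close> gives \<open>l\<^bsub>I \<otimes> I\<^esub> = 1 \<otimes> l\<^bsub>I\<^esub>\<close>, so the triangle and \<open>lunit_ten\<close> equate
  \<open>l\<^bsub>I\<^esub> \<otimes> 1\<close> with \<open>r\<^bsub>I\<^esub> \<otimes> 1\<close>.
\<close>

lemma lunit_eq_runit: "\<l> I = \<r> I"
proof (rule ten_unit_faithful)
  have "\<l> (I \<odot> I) = \<one> I \<otimes> \<l> I"
    by (rule cancel_left_iso[of "\<l> I"]) (simp_all add: unit_nat Lunit_iso)
  then show "\<l> I \<otimes> \<one> I = \<r> I \<otimes> \<one> I"
    using triangle[of I I] by (simp flip: lunit_ten)
qed simp_all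

lemma runit'_ten:
  assumes [simp]: "X \<in> Ob C" "Y \<in> Ob C"
  shows "\<a>' X Y I \<cdot> (\<one> X \<otimes> \<r>' Y) = \<r>' (X \<odot> Y)"
proof (rule cancel_left_iso[of "\<r> (X \<odot> Y)"])
  have "((\<one> X \<otimes> \<r> Y) \<cdot> \<a> X Y I) \<cdot> \<a>' X Y I \<cdot> (\<one> X \<otimes> \<r>' Y) = \<one> (X \<odot> Y)"
    by (simp add: interchange)
  then show "\<r> (X \<odot> Y) \<cdot> \<a>' X Y I \<cdot> (\<one> X \<otimes> \<r>' Y) = \<r> (X \<odot> Y) \<cdot> \<r>' (X \<odot> Y)"
    by (simp only: runit_ten assms) simp
qed (simp_all add: Runit_iso)

lemma lunit'_ten:
  assumes [simp]: "X \<in> Ob C" "Y \<in> Ob C"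
  shows "\<a> I X Y \<cdot> (\<l>' X \<otimes> \<one> Y) = \<l>' (X \<odot> Y)"
proof (rule cancel_left_iso[of "\<l> (X \<odot> Y)"])
  show "\<l> (X \<odot> Y) \<cdot> \<a> I X Y \<cdot> (\<l>' X \<otimes> \<one> Y) = \<l> (X \<odot> Y) \<cdot> \<l>' (X \<odot> Y)"
    by (simp add: comp_cong_tail[OF lunit_ten] interchange)
qed (simp_all add: Lunit_iso)

section \<open>Pointwise products in a monoid\<close>

text \<open>
  The pointwise product of two generalised elements \<open>f : X \<rightarrow> M\<close> and \<open>g : Z \<rightarrow> M\<close> of a monoid, an
  element of shape \<open>X \<otimes> Z\<close>.  Its associativity and unit laws absorb all structural isomorphisms, so
  computations with monoid morphisms look as in the strict case.
\<close>

definition star :: "'a \<Rightarrow> ('o, 'a) mon \<Rightarrow> 'a \<Rightarrow> 'a"  ("_ \<star>\<^bsub>_\<^esub> _" [71,0,70] 70)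
  where "f \<star>\<^bsub>M\<^esub> g = mult M \<cdot> (f \<otimes> g)"

lemma monoid_type:
  assumes "is_monoid C M"
  shows "carr M \<in> Ob C" "mult M \<in> Ar C" "Dom C (mult M) = carr M \<odot> carr M" "Cod C (mult M) = carr M"
    "unit M \<in> Ar C" "Dom C (unit M) = I" "Cod C (unit M) = carr M"
  using assms by (auto simp: is_monoid_def Hom_def)

lemma star_type [simp]:
  assumes "is_monoid C M" "f \<in> Ar C" "g \<in> Ar C" "Cod C f = carr M" "Cod C g = carr M"
  shows "f \<star>\<^bsub>M\<^esub> g \<in> Ar C" "Dom C (f \<star>\<^bsub>M\<^esub> g) = Dom C f \<odot> Dom C g" "Cod C (f \<star>\<^bsub>M\<^esub> g) = carr M"
  using assms by (auto simp: star_def monoid_type)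

lemma star_comp:
  assumes "is_monoid C M" "f \<in> Ar C" "g \<in> Ar C" "Cod C f = carr M" "Cod C g = carr M"
    "h \<in> Ar C" "k \<in> Ar C" "Dom C f = Cod C h" "Dom C g = Cod C k"
  shows "(f \<star>\<^bsub>M\<^esub> g) \<cdot> (h \<otimes> k) = (f \<cdot> h) \<star>\<^bsub>M\<^esub> (g \<cdot> k)"
  using assms by (simp add: star_def interchange monoid_type)

lemma star_comp_tail:
  assumes "is_monoid C M" "f \<in> Ar C" "g \<in> Ar C" "Cod C f = carr M" "Cod C g = carr M"
    "h \<in> Ar C" "k \<in> Ar C" "Dom C f = Cod C h" "Dom C g = Cod C k"
    "z \<in> Ar C" "Cod C z = Dom C h \<odot> Dom C k"
  shows "(f \<star>\<^bsub>M\<^esub> g) \<cdot> (h \<otimes> k) \<cdot> z = ((f \<cdot> h) \<star>\<^bsub>M\<^esub> (g \<cdot> k)) \<cdot> z"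
  using comp_cong_tail[OF star_comp[OF assms(1-9)], of z] assms by simp

lemma star_assoc:
  assumes M: "is_monoid C M" and [simp]: "f \<in> Ar C" "g \<in> Ar C" "h \<in> Ar C"
    "Cod C f = carr M" "Cod C g = carr M" "Cod C h = carr M"
  shows "(f \<star>\<^bsub>M\<^esub> g) \<star>\<^bsub>M\<^esub> h = (f \<star>\<^bsub>M\<^esub> (g \<star>\<^bsub>M\<^esub> h)) \<cdot> \<a> (Dom C f) (Dom C g) (Dom C h)"
proof -
  note [simp] = monoid_type[OF M]
  have "(f \<star>\<^bsub>M\<^esub> g) \<star>\<^bsub>M\<^esub> h = (mult M \<cdot> (mult M \<otimes> \<one> (carr M))) \<cdot> ((f \<otimes> g) \<otimes> h)"
    by (simp add: star_def interchange)
  also have "\<dots> = (mult M \<cdot> (\<one> (carr M) \<otimes> mult M) \<cdot> \<a> (carr M) (carr M) (carr M)) \<cdot> ((f \<otimes> g) \<otimes> h)"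
    using M by (simp only: is_monoid_def)
  also have "\<dots> = (f \<star>\<^bsub>M\<^esub> (g \<star>\<^bsub>M\<^esub> h)) \<cdot> \<a> (Dom C f) (Dom C g) (Dom C h)"
    by (simp add: star_def merge assoc_nat)
  finally show ?thesis .
qed

lemma star_assoc':
  assumes M: "is_monoid C M" and "f \<in> Ar C" "g \<in> Ar C" "h \<in> Ar C"
    "Cod C f = carr M" "Cod C g = carr M" "Cod C h = carr M"
  shows "((f \<star>\<^bsub>M\<^esub> g) \<star>\<^bsub>M\<^esub> h) \<cdot> \<a>' (Dom C f) (Dom C g) (Dom C h) = f \<star>\<^bsub>M\<^esub> (g \<star>\<^bsub>M\<^esub> h)"
  using assms by (simp add: star_assoc)

lemma star_unit:
  assumes M: "is_monoid C M" and "f \<in> Ar C" "Cod C f = carr M"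
  shows "unit M \<star>\<^bsub>M\<^esub> f = f \<cdot> \<l> (Dom C f)" "f \<star>\<^bsub>M\<^esub> unit M = f \<cdot> \<r> (Dom C f)"
proof -
  note [simp] = monoid_type[OF M] assms(2,3)
  have "unit M \<star>\<^bsub>M\<^esub> f = (mult M \<cdot> (unit M \<otimes> \<one> (carr M))) \<cdot> (\<one> I \<otimes> f)"
    by (simp add: star_def interchange)
  also have "\<dots> = f \<cdot> \<l> (Dom C f)"
    using M unit_nat by (simp add: is_monoid_def)
  finally show "unit M \<star>\<^bsub>M\<^esub> f = f \<cdot> \<l> (Dom C f)" .
  have "f \<star>\<^bsub>M\<^esub> unit M = (mult M \<cdot> (\<one> (carr M) \<otimes> unit M)) \<cdot> (f \<otimes> \<one> I)"
    by (simp add: star_def interchange)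
  also have "\<dots> = f \<cdot> \<r> (Dom C f)"
    using M unit_nat by (simp add: is_monoid_def)
  finally show "f \<star>\<^bsub>M\<^esub> unit M = f \<cdot> \<r> (Dom C f)" .
qed

lemma monoid_morphism_type:
  assumes "is_monoid_morphism C M N f"
  shows "f \<in> Ar C" "Dom C f = carr M" "Cod C f = carr N"
  using assms by (auto simp: is_monoid_morphism_def Hom_def)

lemma monoid_morphism_star:
  assumes \<phi>: "is_monoid_morphism C M N \<phi>" and M: "is_monoid C M" and N: "is_monoid C N"
    and [simp]: "f \<in> Ar C" "g \<in> Ar C" "Cod C f = carr M" "Cod C g = carr M"
  shows "\<phi> \<cdot> (f \<star>\<^bsub>M\<^esub> g) = (\<phi> \<cdot> f) \<star>\<^bsub>N\<^esub> (\<phi> \<cdot> g)"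
proof -
  note [simp] = monoid_type[OF M] monoid_type[OF N] monoid_morphism_type[OF \<phi>]
  have "\<phi> \<cdot> (f \<star>\<^bsub>M\<^esub> g) = (\<phi> \<cdot> mult M) \<cdot> (f \<otimes> g)"
    by (simp add: star_def)
  also have "\<dots> = (mult N \<cdot> (\<phi> \<otimes> \<phi>)) \<cdot> (f \<otimes> g)"
    using \<phi> by (simp only: is_monoid_morphism_def)
  also have "\<dots> = (\<phi> \<cdot> f) \<star>\<^bsub>N\<^esub> (\<phi> \<cdot> g)"
    by (simp add: star_def interchange)
  finally show ?thesis .
qed

lemma mult_eq_star: "is_monoid C M \<Longrightarrow> mult M = \<one> (carr M) \<star>\<^bsub>M\<^esub> \<one> (carr M)"
  by (simp add: star_def monoid_type)

lemma trivial_monoid: "is_monoid C (trivial_monoid C)"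
  using triangle[of I I] unit_nat(1)[of "\<l> I" I]
  by (auto simp: is_monoid_def trivial_monoid_def Hom_def lunit_eq_runit)

lemma monoid_morphism_mult: "is_monoid_morphism C M N f \<Longrightarrow> f \<cdot> mult M = f \<star>\<^bsub>N\<^esub> f"
  by (simp add: is_monoid_morphism_def star_def)

lemma monoid_morphism_unit: "is_monoid_morphism C M N f \<Longrightarrow> f \<cdot> unit M = unit N"
  by (simp add: is_monoid_morphism_def)

lemma monoid_morphismI:
  assumes "f \<in> Ar C" "Dom C f = carr M" "Cod C f = carr N" "f \<cdot> mult M = f \<star>\<^bsub>N\<^esub> f" "f \<cdot> unit M = unit N"
  shows "is_monoid_morphism C M N f"
  using assms by (simp add: is_monoid_morphism_def star_def Hom_def)

text \<open>
  If every element of \<open>N\<close> factors uniquely as a product \<open>j(y) i(b)\<close>, then rewriting \<open>i(b) j(y)\<close> in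
  this form is a distributive law.  Because \<open>q = j \<star> i\<close> can be cancelled, each axiom reduces to two
  ways of multiplying the same elements in \<open>N\<close>, e.g. \<open>(i \<star> i) \<star> j = i \<star> (i \<star> j)\<close> up to the
  associativity isomorphism.
\<close>

lemma distributive_law_of_factorization:
  assumes N: "is_monoid C N" and MB: "is_monoid C MB" and MY: "is_monoid C MY"
    and i: "is_monoid_morphism C MB N i" and j: "is_monoid_morphism C MY N j"
    and q: "invertible C (j \<star>\<^bsub>N\<^esub> i)"
    and x: "x \<in> Ar C" "Dom C x = carr MB \<odot> carr MY" "Cod C x = carr MY \<odot> carr MB"
      "(j \<star>\<^bsub>N\<^esub> i) \<cdot> x = i \<star>\<^bsub>N\<^esub> j"
  shows "distributive_law C MB MY x"
proof -
  let ?B = "carr MB" and ?Y = "carr MY" and ?q = "j \<star>\<^bsub>N\<^esub> i"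
  note [simp] = monoid_type[OF MB] monoid_type[OF MY] monoid_type[OF N]
    monoid_morphism_type[OF i] monoid_morphism_type[OF j] x(1-3) N
  have qx: "?q \<cdot> x \<cdot> k = (i \<star>\<^bsub>N\<^esub> j) \<cdot> k" if "k \<in> Ar C" "Cod C k = ?B \<odot> ?Y" for k
    using comp_cong_tail[OF x(4), of k] that by simp
  note mor = monoid_morphism_mult[OF i] monoid_morphism_mult[OF j]
    monoid_morphism_unit[OF i] monoid_morphism_unit[OF j]
  have unit_B: "x \<cdot> (unit MB \<otimes> \<one> ?Y) \<cdot> \<l>' ?Y = (\<one> ?Y \<otimes> unit MB) \<cdot> \<r>' ?Y"
  proof (rule cancel_left_iso[OF q])
    have "?q \<cdot> x \<cdot> (unit MB \<otimes> \<one> ?Y) \<cdot> \<l>' ?Y = ((i \<star>\<^bsub>N\<^esub> j) \<cdot> (unit MB \<otimes> \<one> ?Y)) \<cdot> \<l>' ?Y"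
      by (simp add: qx)
    also have "\<dots> = j"
      by (simp add: star_comp mor star_unit)
    also have "j = (?q \<cdot> (\<one> ?Y \<otimes> unit MB)) \<cdot> \<r>' ?Y"
      by (simp add: star_comp mor star_unit)
    finally show "?q \<cdot> x \<cdot> (unit MB \<otimes> \<one> ?Y) \<cdot> \<l>' ?Y = ?q \<cdot> (\<one> ?Y \<otimes> unit MB) \<cdot> \<r>' ?Y"
      by simp
  qed simp_all
  have unit_Y: "x \<cdot> (\<one> ?B \<otimes> unit MY) \<cdot> \<r>' ?B = (unit MY \<otimes> \<one> ?B) \<cdot> \<l>' ?B"
  proof (rule cancel_left_iso[OF q])
    have "?q \<cdot> x \<cdot> (\<one> ?B \<otimes> unit MY) \<cdot> \<r>' ?B = ((i \<star>\<^bsub>N\<^esub> j) \<cdot> (\<one> ?B \<otimes> unit MY)) \<cdot> \<r>' ?B"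
      by (simp add: qx)
    also have "\<dots> = i"
      by (simp add: star_comp mor star_unit)
    also have "i = (?q \<cdot> (unit MY \<otimes> \<one> ?B)) \<cdot> \<l>' ?B"
      by (simp add: star_comp mor star_unit)
    finally show "?q \<cdot> x \<cdot> (\<one> ?B \<otimes> unit MY) \<cdot> \<r>' ?B = ?q \<cdot> (unit MY \<otimes> \<one> ?B) \<cdot> \<l>' ?B"
      by simp
  qed simp_all
  have mult_B: "x \<cdot> (mult MB \<otimes> \<one> ?Y) = (\<one> ?Y \<otimes> mult MB) \<cdot> \<a> ?Y ?B ?B \<cdot> (x \<otimes> \<one> ?B)
      \<cdot> \<a>' ?B ?Y ?B \<cdot> (\<one> ?B \<otimes> x) \<cdot> \<a> ?B ?B ?Y" (is "_ = ?rhs")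
  proof (rule cancel_left_iso[OF q])
    have "?q \<cdot> ?rhs = ((?q \<cdot> (\<one> ?Y \<otimes> mult MB)) \<cdot> \<a> ?Y ?B ?B) \<cdot> (x \<otimes> \<one> ?B)
      \<cdot> \<a>' ?B ?Y ?B \<cdot> (\<one> ?B \<otimes> x) \<cdot> \<a> ?B ?B ?Y"
      by simp
    also have "\<dots> = ((?q \<star>\<^bsub>N\<^esub> i) \<cdot> (x \<otimes> \<one> ?B)) \<cdot> \<a>' ?B ?Y ?B \<cdot> (\<one> ?B \<otimes> x) \<cdot> \<a> ?B ?B ?Y"
      using star_assoc[OF N, of j i i] by (simp add: star_comp mor)
    also have "\<dots> = (((i \<star>\<^bsub>N\<^esub> j) \<star>\<^bsub>N\<^esub> i) \<cdot> \<a>' ?B ?Y ?B) \<cdot> (\<one> ?B \<otimes> x) \<cdot> \<a> ?B ?B ?Y"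
      by (simp add: star_comp star_comp_tail x(4))
    also have "\<dots> = (i \<star>\<^bsub>N\<^esub> (i \<star>\<^bsub>N\<^esub> j)) \<cdot> \<a> ?B ?B ?Y"
      using star_assoc'[OF N, of i j i]
      by (simp add: star_comp_tail x(4))
    also have "\<dots> = ?q \<cdot> x \<cdot> (mult MB \<otimes> \<one> ?Y)"
      using star_assoc[OF N, of i i j] by (simp add: qx star_comp mor)
    finally show "?q \<cdot> x \<cdot> (mult MB \<otimes> \<one> ?Y) = ?q \<cdot> ?rhs" ..
  qed simp_all
  have mult_Y: "x \<cdot> (\<one> ?B \<otimes> mult MY) = (mult MY \<otimes> \<one> ?B) \<cdot> \<a>' ?Y ?Y ?B \<cdot> (\<one> ?Y \<otimes> x)
      \<cdot> \<a> ?Y ?B ?Y \<cdot> (x \<otimes> \<one> ?Y) \<cdot> \<a>' ?B ?Y ?Y" (is "_ = ?rhs")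
  proof (rule cancel_left_iso[OF q])
    have "?q \<cdot> ?rhs = ((?q \<cdot> (mult MY \<otimes> \<one> ?B)) \<cdot> \<a>' ?Y ?Y ?B) \<cdot> (\<one> ?Y \<otimes> x)
      \<cdot> \<a> ?Y ?B ?Y \<cdot> (x \<otimes> \<one> ?Y) \<cdot> \<a>' ?B ?Y ?Y"
      by simp
    also have "\<dots> = ((j \<star>\<^bsub>N\<^esub> ?q) \<cdot> (\<one> ?Y \<otimes> x)) \<cdot> \<a> ?Y ?B ?Y \<cdot> (x \<otimes> \<one> ?Y) \<cdot> \<a>' ?B ?Y ?Y"
      using star_assoc'[OF N, of j j i] by (simp add: star_comp star_comp_tail mor)
    also have "\<dots> = ((j \<star>\<^bsub>N\<^esub> (i \<star>\<^bsub>N\<^esub> j)) \<cdot> \<a> ?Y ?B ?Y) \<cdot> (x \<otimes> \<one> ?Y) \<cdot> \<a>' ?B ?Y ?Y"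
      by (simp add: star_comp star_comp_tail x(4))
    also have "(j \<star>\<^bsub>N\<^esub> (i \<star>\<^bsub>N\<^esub> j)) \<cdot> \<a> ?Y ?B ?Y = ?q \<star>\<^bsub>N\<^esub> j"
      using star_assoc[OF N, of j i j] by simp
    also have "(?q \<star>\<^bsub>N\<^esub> j) \<cdot> (x \<otimes> \<one> ?Y) \<cdot> \<a>' ?B ?Y ?Y = ((i \<star>\<^bsub>N\<^esub> j) \<star>\<^bsub>N\<^esub> j) \<cdot> \<a>' ?B ?Y ?Y"
      by (simp add: star_comp_tail x(4))
    also have "\<dots> = ?q \<cdot> x \<cdot> (\<one> ?B \<otimes> mult MY)"
      using star_assoc'[OF N, of i j j] by (simp add: qx star_comp mor)
    finally show "?q \<cdot> x \<cdot> (\<one> ?B \<otimes> mult MY) = ?q \<cdot> ?rhs" ..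
  qed simp_all
  show ?thesis
    using unit_B unit_Y mult_B mult_Y by (simp add: distributive_law_def Let_def Hom_def)
qed

section \<open>The composite monoid of a distributive law\<close>

text \<open>
  The rules \<open>push\<close> shift structural isomorphisms to the right past tensor products of arrows.  Since
  tensor products of identities are kept contracted, naturality has to be stated separately for
  arguments of the form \<open>1\<^bsub>X \<otimes> Y\<^esub>\<close>.
\<close>

lemma whisker:
  "\<lbrakk>X \<in> Ob C; f \<in> Ar C; g \<in> Ar C; Dom C g = Cod C f\<rbrakk> \<Longrightarrow> \<one> X \<otimes> (g \<cdot> f) = (\<one> X \<otimes> g) \<cdot> (\<one> X \<otimes> f)"
  "\<lbrakk>X \<in> Ob C; f \<in> Ar C; g \<in> Ar C; Dom C g = Cod C f\<rbrakk> \<Longrightarrow> (g \<cdot> f) \<otimes> \<one> X = (g \<otimes> \<one> X) \<cdot> (f \<otimes> \<one> X)"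
  by (simp_all add: interchange)

lemma assoc_nat_right:
  assumes "X \<in> Ob C" "Y \<in> Ob C" "h \<in> Ar C" "Z' = Cod C h"
  shows "\<a> X Y Z' \<cdot> (\<one> (X \<odot> Y) \<otimes> h) = (\<one> X \<otimes> \<one> Y \<otimes> h) \<cdot> \<a> X Y (Dom C h)"
  using assoc_nat[of "\<one> X" "\<one> Y" h X Y Z'] assms by simp

lemma assoc_nat_right_tail:
  assumes "X \<in> Ob C" "Y \<in> Ob C" "h \<in> Ar C" "Z' = Cod C h" "k \<in> Ar C" "Cod C k = (X \<odot> Y) \<odot> Dom C h"
  shows "\<a> X Y Z' \<cdot> (\<one> (X \<odot> Y) \<otimes> h) \<cdot> k = (\<one> X \<otimes> \<one> Y \<otimes> h) \<cdot> \<a> X Y (Dom C h) \<cdot> k"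
  using assoc_nat_tail[of "\<one> X" "\<one> Y" h X Y Z' k] assms by simp

lemma assoc'_nat_left:
  assumes "f \<in> Ar C" "Y \<in> Ob C" "Z \<in> Ob C" "X' = Cod C f"
  shows "\<a>' X' Y Z \<cdot> (f \<otimes> \<one> (Y \<odot> Z)) = ((f \<otimes> \<one> Y) \<otimes> \<one> Z) \<cdot> \<a>' (Dom C f) Y Z"
  using assoc'_nat[of f "\<one> Y" "\<one> Z" X' Y Z] assms by simp

lemma assoc'_nat_left_tail:
  assumes "f \<in> Ar C" "Y \<in> Ob C" "Z \<in> Ob C" "X' = Cod C f" "k \<in> Ar C" "Cod C k = Dom C f \<odot> Y \<odot> Z"
  shows "\<a>' X' Y Z \<cdot> (f \<otimes> \<one> (Y \<odot> Z)) \<cdot> k = ((f \<otimes> \<one> Y) \<otimes> \<one> Z) \<cdot> \<a>' (Dom C f) Y Z \<cdot> k"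
  using assoc'_nat_tail[of f "\<one> Y" "\<one> Z" X' Y Z k] assms by simp

lemmas push = assoc_nat assoc_nat_tail assoc_nat_right assoc_nat_right_tail
  assoc'_nat assoc'_nat_tail assoc'_nat_left assoc'_nat_left_tail

lemma pentagon_tail:
  "\<lbrakk>W \<in> Ob C; X \<in> Ob C; Y \<in> Ob C; Z \<in> Ob C; k \<in> Ar C; Cod C k = ((W \<odot> X) \<odot> Y) \<odot> Z\<rbrakk>
    \<Longrightarrow> (\<one> W \<otimes> \<a> X Y Z) \<cdot> \<a> W (X \<odot> Y) Z \<cdot> (\<a> W X Y \<otimes> \<one> Z) \<cdot> k
      = \<a> W X (Y \<odot> Z) \<cdot> \<a> (W \<odot> X) Y Z \<cdot> k"
  using comp_cong_tail[OF pentagon[of W X Y Z], of k] by simp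

lemma pentagon_inner_inverse:
  assumes [simp]: "W \<in> Ob C" "X \<in> Ob C" "Y \<in> Ob C" "Z \<in> Ob C"
  shows "(\<one> W \<otimes> \<a>' X Y Z) \<cdot> \<a> W X (Y \<odot> Z)
    = \<a> W (X \<odot> Y) Z \<cdot> (\<a> W X Y \<otimes> \<one> Z) \<cdot> \<a>' (W \<odot> X) Y Z"
proof -
  have "(\<one> W \<otimes> \<a>' X Y Z) \<cdot> \<a> W X (Y \<odot> Z)
      = (\<one> W \<otimes> \<a>' X Y Z) \<cdot> \<a> W X (Y \<odot> Z) \<cdot> \<a> (W \<odot> X) Y Z \<cdot> \<a>' (W \<odot> X) Y Z"
    by simp
  also have "\<dots> = (\<one> W \<otimes> \<a>' X Y Z) \<cdot> (\<one> W \<otimes> \<a> X Y Z) \<cdot> \<a> W (X \<odot> Y) Z \<cdot> (\<a> W X Y \<otimes> \<one> Z) \<cdot> \<a>' (W \<odot> X) Y Z"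
    by (simp add: pentagon_tail)
  also have "\<dots> = \<a> W (X \<odot> Y) Z \<cdot> (\<a> W X Y \<otimes> \<one> Z) \<cdot> \<a>' (W \<odot> X) Y Z"
    by (simp add: merge)
  finally show ?thesis .
qed

lemma pentagon_outer_inverse:
  assumes [simp]: "W \<in> Ob C" "X \<in> Ob C" "Y \<in> Ob C" "Z \<in> Ob C"
  shows "\<a> (W \<odot> X) Y Z \<cdot> (\<a>' W X Y \<otimes> \<one> Z)
    = \<a>' W X (Y \<odot> Z) \<cdot> (\<one> W \<otimes> \<a> X Y Z) \<cdot> \<a> W (X \<odot> Y) Z"
proof -
  have "\<a>' W X (Y \<odot> Z) \<cdot> (\<one> W \<otimes> \<a> X Y Z) \<cdot> \<a> W (X \<odot> Y) Z
      = \<a>' W X (Y \<odot> Z) \<cdot> (\<one> W \<otimes> \<a> X Y Z) \<cdot> \<a> W (X \<odot> Y) Z \<cdot> (\<a> W X Y \<otimes> \<one> Z) \<cdot> (\<a>' W X Y \<otimes> \<one> Z)"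
    by (simp add: interchange)
  also have "\<dots> = \<a> (W \<odot> X) Y Z \<cdot> (\<a>' W X Y \<otimes> \<one> Z)"
    by (simp add: pentagon_tail)
  finally show ?thesis ..
qed

lemma pentagon_inverse_tail:
  "\<lbrakk>W \<in> Ob C; X \<in> Ob C; Y \<in> Ob C; Z \<in> Ob C; k \<in> Ar C; Cod C k = (W \<odot> X) \<odot> Y \<odot> Z\<rbrakk>
    \<Longrightarrow> (\<one> W \<otimes> \<a>' X Y Z) \<cdot> \<a> W X (Y \<odot> Z) \<cdot> k
      = \<a> W (X \<odot> Y) Z \<cdot> (\<a> W X Y \<otimes> \<one> Z) \<cdot> \<a>' (W \<odot> X) Y Z \<cdot> k"
  "\<lbrakk>W \<in> Ob C; X \<in> Ob C; Y \<in> Ob C; Z \<in> Ob C; k \<in> Ar C; Cod C k = (W \<odot> X \<odot> Y) \<odot> Z\<rbrakk>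
    \<Longrightarrow> \<a> (W \<odot> X) Y Z \<cdot> (\<a>' W X Y \<otimes> \<one> Z) \<cdot> k
      = \<a>' W X (Y \<odot> Z) \<cdot> (\<one> W \<otimes> \<a> X Y Z) \<cdot> \<a> W (X \<odot> Y) Z \<cdot> k"
  by (subst comp_cong_tail[OF pentagon_inner_inverse], simp_all)
    (subst comp_cong_tail[OF pentagon_outer_inverse], simp_all)

text \<open>
  Let \<open>x\<^bsub>W\<^esub> : B \<otimes> (Y \<otimes> W) \<rightarrow> Y \<otimes> (B \<otimes> W)\<close> be \<open>x\<close> acting on the first two factors of a right-nested
  product.  Tensoring \<open>x\<^bsub>W\<^esub>\<close> with \<open>Z\<close> on the left agrees, up to associators, with letting \<open>1\<^bsub>Z\<^esub> \<otimes> x\<close>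
  act on a left-nested product.  Both multiplication axioms of a distributive law contain the
  factor \<open>1 \<otimes> x\<close>, and this is the only coherence needed to bring it into right-nested form.
\<close>

lemma whisker_swap:
  assumes [simp]: "x \<in> Ar C" "Dom C x = B \<odot> Y" "Cod C x = Y \<odot> B" "B \<in> Ob C" "Y \<in> Ob C" "W \<in> Ob C" "Z \<in> Ob C"
  shows "(\<one> Z \<otimes> \<a> Y B W) \<cdot> (\<one> Z \<otimes> x \<otimes> \<one> W) \<cdot> (\<one> Z \<otimes> \<a>' B Y W) \<cdot> \<a> Z B (Y \<odot> W)
    = \<a> Z Y (B \<odot> W) \<cdot> \<a> (Z \<odot> Y) B W \<cdot> ((\<a>' Z Y B \<cdot> (\<one> Z \<otimes> x) \<cdot> \<a> Z B Y) \<otimes> \<one> W) \<cdot> \<a>' (Z \<odot> B) Y W"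
  by (simp add: whisker push pentagon_inner_inverse pentagon_inverse_tail)

lemma whisker_swap_tail:
  assumes "x \<in> Ar C" "Dom C x = B \<odot> Y" "Cod C x = Y \<odot> B" "B \<in> Ob C" "Y \<in> Ob C" "W \<in> Ob C" "Z \<in> Ob C"
    "k \<in> Ar C" "Cod C k = (Z \<odot> B) \<odot> Y \<odot> W"
  shows "(\<one> Z \<otimes> \<a> Y B W) \<cdot> (\<one> Z \<otimes> x \<otimes> \<one> W) \<cdot> (\<one> Z \<otimes> \<a>' B Y W) \<cdot> \<a> Z B (Y \<odot> W) \<cdot> k
    = \<a> Z Y (B \<odot> W) \<cdot> \<a> (Z \<odot> Y) B W \<cdot> ((\<a>' Z Y B \<cdot> (\<one> Z \<otimes> x) \<cdot> \<a> Z B Y) \<otimes> \<one> W) \<cdot> \<a>' (Z \<odot> B) Y W \<cdot> k"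
  using assms comp_cong_tail[OF whisker_swap[OF assms(1-7)], of k] by simp

lemma exchange:
  "\<lbrakk>f \<in> Ar C; g \<in> Ar C; Dom C f = W; Cod C g = Z\<rbrakk>
    \<Longrightarrow> (f \<otimes> \<one> Z) \<cdot> (\<one> W \<otimes> g) = (\<one> (Cod C f) \<otimes> g) \<cdot> (f \<otimes> \<one> (Dom C g))"
  "\<lbrakk>f \<in> Ar C; g \<in> Ar C; Dom C f = W; Cod C g = Z; k \<in> Ar C; Cod C k = W \<odot> Dom C g\<rbrakk>
    \<Longrightarrow> (f \<otimes> \<one> Z) \<cdot> (\<one> W \<otimes> g) \<cdot> k = (\<one> (Cod C f) \<otimes> g) \<cdot> (f \<otimes> \<one> (Dom C g)) \<cdot> k"
  by (auto simp: merge)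

lemma whiskered_inverse [simp]:
  "\<lbrakk>W \<in> Ob C; X \<in> Ob C; Y \<in> Ob C; Z \<in> Ob C\<rbrakk> \<Longrightarrow> (\<a>' X Y Z \<otimes> \<one> W) \<cdot> (\<a> X Y Z \<otimes> \<one> W) = \<one> (((X \<odot> Y) \<odot> Z) \<odot> W)"
  "\<lbrakk>W \<in> Ob C; X \<in> Ob C; Y \<in> Ob C; Z \<in> Ob C; k \<in> Ar C; Cod C k = ((X \<odot> Y) \<odot> Z) \<odot> W\<rbrakk>
    \<Longrightarrow> (\<a>' X Y Z \<otimes> \<one> W) \<cdot> (\<a> X Y Z \<otimes> \<one> W) \<cdot> k = k"
  by (simp_all add: merge)

end

locale distributive_monoids = monoidal_category C
  for C :: "('o, 'a) mcat" (structure) +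
  fixes MB MY :: "('o, 'a) mon" and x :: 'a
  assumes MB: "is_monoid C MB" and MY: "is_monoid C MY" and law: "distributive_law C MB MY x"
begin

abbreviation "B \<equiv> carr MB"
abbreviation "Y \<equiv> carr MY"
abbreviation "A \<equiv> Y \<odot> B"

lemmas [simp] = monoid_type[OF MB] monoid_type[OF MY]

lemma law_type [simp]: "x \<in> Ar C" "Dom C x = B \<odot> Y" "Cod C x = Y \<odot> B"
  using law by (auto simp: distributive_law_def Let_def Hom_def)

lemma law_unit_B: "x \<cdot> (unit MB \<otimes> \<one> Y) = (\<one> Y \<otimes> unit MB) \<cdot> \<r>' Y \<cdot> \<l> Y"
proof -
  have "x \<cdot> (unit MB \<otimes> \<one> Y) = (x \<cdot> (unit MB \<otimes> \<one> Y) \<cdot> \<l>' Y) \<cdot> \<l> Y"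
    by simp
  also have "\<dots> = ((\<one> Y \<otimes> unit MB) \<cdot> \<r>' Y) \<cdot> \<l> Y"
    using law by (simp only: distributive_law_def Let_def)
  finally show ?thesis by simp
qed

lemma law_unit_Y: "x \<cdot> (\<one> B \<otimes> unit MY) = (unit MY \<otimes> \<one> B) \<cdot> \<l>' B \<cdot> \<r> B"
proof -
  have "x \<cdot> (\<one> B \<otimes> unit MY) = (x \<cdot> (\<one> B \<otimes> unit MY) \<cdot> \<r>' B) \<cdot> \<r> B"
    by simp
  also have "\<dots> = ((unit MY \<otimes> \<one> B) \<cdot> \<l>' B) \<cdot> \<r> B"
    using law by (simp only: distributive_law_def Let_def)
  finally show ?thesis by simp
qed

lemma law_mult:
  "x \<cdot> (mult MB \<otimes> \<one> Y) = (\<one> Y \<otimes> mult MB) \<cdot> \<a> Y B B \<cdot> (x \<otimes> \<one> B) \<cdot> \<a>' B Y B \<cdot> (\<one> B \<otimes> x) \<cdot> \<a> B B Y"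
  "x \<cdot> (\<one> B \<otimes> mult MY) = (mult MY \<otimes> \<one> B) \<cdot> \<a>' Y Y B \<cdot> (\<one> Y \<otimes> x) \<cdot> \<a> Y B Y \<cdot> (x \<otimes> \<one> Y) \<cdot> \<a>' B Y Y"
  using law by (auto simp: distributive_law_def Let_def)

lemma mult_assoc:
  "mult MY \<cdot> (mult MY \<otimes> \<one> Y) = mult MY \<cdot> (\<one> Y \<otimes> mult MY) \<cdot> \<a> Y Y Y"
  "mult MB \<cdot> (mult MB \<otimes> \<one> B) = mult MB \<cdot> (\<one> B \<otimes> mult MB) \<cdot> \<a> B B B"
  using MB MY by (auto simp: is_monoid_def)

lemma mult_unit:
  "mult MY \<cdot> (unit MY \<otimes> \<one> Y) = \<l> Y" "mult MY \<cdot> (\<one> Y \<otimes> unit MY) = \<r> Y"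
  "mult MB \<cdot> (unit MB \<otimes> \<one> B) = \<l> B" "mult MB \<cdot> (\<one> B \<otimes> unit MB) = \<r> B"
  using MB MY by (auto simp: is_monoid_def)

text \<open>
  The left actions of \<open>Y\<close> and, through \<open>x\<close>, of \<open>B\<close> on \<open>A = Y \<otimes> B\<close>: in terms of elements,
  \<open>y \<cdot> (y', b') = (y y', b')\<close> and \<open>b \<cdot> (y', b') = (y'', b'' b')\<close> where \<open>x (b, y') = (y'', b'')\<close>.
  The multiplication of \<open>A\<close> is the iterated action \<open>(y, b) \<cdot> a = y \<cdot> (b \<cdot> a)\<close>; it equals the
  usual \<open>(m \<otimes> m)(1 \<otimes> x \<otimes> 1)\<close>, but in this form associativity splits into facts about one action at
  a time.
\<close>

definition actY where "actY = (mult MY \<otimes> \<one> B) \<cdot> \<a>' Y Y B"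
definition actB where "actB = (\<one> Y \<otimes> mult MB) \<cdot> \<a> Y B B \<cdot> (x \<otimes> \<one> B) \<cdot> \<a>' B Y B"
definition actA where "actA = actY \<cdot> (\<one> Y \<otimes> actB) \<cdot> \<a> Y B A"

lemma act_type [simp]:
  "actY \<in> Ar C" "Dom C actY = Y \<odot> A" "Cod C actY = A"
  "actB \<in> Ar C" "Dom C actB = B \<odot> A" "Cod C actB = A"
  "actA \<in> Ar C" "Dom C actA = A \<odot> A" "Cod C actA = A"
  by (simp_all add: actY_def actB_def actA_def)

lemma actY_unit: "actY \<cdot> (unit MY \<otimes> \<one> A) = \<l> A"
proof -
  have "actY \<cdot> (unit MY \<otimes> \<one> A) = ((mult MY \<cdot> (unit MY \<otimes> \<one> Y)) \<otimes> \<one> B) \<cdot> \<a>' I Y B"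
    by (simp add: actY_def push merge del: ten_ident flip: ten_ident[of Y B])
  also have "\<dots> = \<l> A \<cdot> \<a> I Y B \<cdot> \<a>' I Y B"
    by (simp add: mult_unit flip: lunit_ten)
  finally show ?thesis by simp
qed

lemma actB_unit: "actB \<cdot> (unit MB \<otimes> \<one> A) = \<l> A"
proof -
  have "actB \<cdot> (unit MB \<otimes> \<one> A)
      = (\<one> Y \<otimes> mult MB) \<cdot> \<a> Y B B \<cdot> ((x \<cdot> (unit MB \<otimes> \<one> Y)) \<otimes> \<one> B) \<cdot> \<a>' I Y B"
    by (simp add: actB_def push merge)
  also have "\<dots> = (\<one> Y \<otimes> (mult MB \<cdot> (unit MB \<otimes> \<one> B))) \<cdot> \<a> Y I B \<cdot> (\<r>' Y \<otimes> \<one> B) \<cdot> (\<l> Y \<otimes> \<one> B) \<cdot> \<a>' I Y B"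
    by (simp add: law_unit_B whisker push)
  also have "\<dots> = ((\<one> Y \<otimes> \<l> B) \<cdot> \<a> Y I B) \<cdot> (\<r>' Y \<otimes> \<one> B) \<cdot> (\<l> Y \<otimes> \<one> B) \<cdot> \<a>' I Y B"
    by (simp add: mult_unit)
  also have "\<dots> = (\<l> Y \<otimes> \<one> B) \<cdot> \<a>' I Y B"
    by (simp only: triangle monoid_type[OF MB] monoid_type[OF MY]) (simp add: merge)
  also have "\<dots> = \<l> A"
    by (simp flip: lunit_ten)
  finally show ?thesis .
qed

lemma actY_assoc: "actY \<cdot> (mult MY \<otimes> \<one> A) = actY \<cdot> (\<one> Y \<otimes> actY) \<cdot> \<a> Y Y A"
proof -
  have "actY \<cdot> (mult MY \<otimes> \<one> A) = ((mult MY \<cdot> (mult MY \<otimes> \<one> Y)) \<otimes> \<one> B) \<cdot> \<a>' (Y \<odot> Y) Y B"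
    by (simp add: actY_def push merge)
  also have "\<dots> = (mult MY \<otimes> \<one> B) \<cdot> ((\<one> Y \<otimes> mult MY) \<otimes> \<one> B) \<cdot> (\<a> Y Y Y \<otimes> \<one> B) \<cdot> \<a>' (Y \<odot> Y) Y B"
    by (simp add: mult_assoc whisker)
  also have "\<dots> = actY \<cdot> (\<one> Y \<otimes> actY) \<cdot> \<a> Y Y A"
    by (simp add: actY_def whisker push pentagon_inner_inverse)
  finally show ?thesis .
qed

lemma actB_assoc: "actB \<cdot> (mult MB \<otimes> \<one> A) = actB \<cdot> (\<one> B \<otimes> actB) \<cdot> \<a> B B A"
proof -
  have "actB \<cdot> (mult MB \<otimes> \<one> A)
      = (\<one> Y \<otimes> mult MB) \<cdot> \<a> Y B B \<cdot> ((x \<cdot> (mult MB \<otimes> \<one> Y)) \<otimes> \<one> B) \<cdot> \<a>' (B \<odot> B) Y B"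
    by (simp add: actB_def push merge)
  also have "\<dots> = (\<one> Y \<otimes> (mult MB \<cdot> (mult MB \<otimes> \<one> B))) \<cdot> \<a> Y (B \<odot> B) B \<cdot> (\<a> Y B B \<otimes> \<one> B)
      \<cdot> ((x \<otimes> \<one> B) \<otimes> \<one> B) \<cdot> ((\<a>' B Y B \<cdot> (\<one> B \<otimes> x) \<cdot> \<a> B B Y) \<otimes> \<one> B) \<cdot> \<a>' (B \<odot> B) Y B"
    by (simp add: law_mult whisker push)
  also have "\<dots> = (\<one> Y \<otimes> mult MB) \<cdot> (\<one> Y \<otimes> \<one> B \<otimes> mult MB) \<cdot> \<a> Y B (B \<odot> B) \<cdot> (x \<otimes> \<one> (B \<odot> B))
      \<cdot> \<a> (B \<odot> Y) B B \<cdot> ((\<a>' B Y B \<cdot> (\<one> B \<otimes> x) \<cdot> \<a> B B Y) \<otimes> \<one> B) \<cdot> \<a>' (B \<odot> B) Y B"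
    by (simp add: mult_assoc whisker(1) pentagon_tail push)
  also have "\<dots> = (\<one> Y \<otimes> mult MB) \<cdot> \<a> Y B B \<cdot> (x \<otimes> \<one> B) \<cdot> \<a>' B Y B \<cdot> (\<one> B \<otimes> \<one> Y \<otimes> mult MB)
      \<cdot> \<a> B Y (B \<odot> B) \<cdot> \<a> (B \<odot> Y) B B \<cdot> ((\<a>' B Y B \<cdot> (\<one> B \<otimes> x) \<cdot> \<a> B B Y) \<otimes> \<one> B) \<cdot> \<a>' (B \<odot> B) Y B"
    by (simp add: push exchange)
  also have "\<dots> = actB \<cdot> (\<one> B \<otimes> actB) \<cdot> \<a> B B A"
    by (simp add: actB_def whisker(1) whisker_swap)
  finally show ?thesis .
qed

text \<open>
  The second multiplication axiom of the law says precisely that the two actions commute past each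
  other along \<open>x\<close>: \<open>b \<cdot> (y \<cdot> a) = y' \<cdot> (b' \<cdot> a)\<close> where \<open>x (b, y) = (y', b')\<close>.
\<close>

lemma act_compat: "actB \<cdot> (\<one> B \<otimes> actY) \<cdot> \<a> B Y A = actY \<cdot> (\<one> Y \<otimes> actB) \<cdot> \<a> Y B A \<cdot> (x \<otimes> \<one> A)"
proof -
  have "actB \<cdot> (\<one> B \<otimes> actY) \<cdot> \<a> B Y A
      = (\<one> Y \<otimes> mult MB) \<cdot> \<a> Y B B \<cdot> ((x \<cdot> (\<one> B \<otimes> mult MY)) \<otimes> \<one> B) \<cdot> (\<a> B Y Y \<otimes> \<one> B) \<cdot> \<a>' (B \<odot> Y) Y B"
    by (simp add: actB_def actY_def whisker push pentagon_inner_inverse)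
  also have "\<dots> = (\<one> Y \<otimes> mult MB) \<cdot> \<a> Y B B \<cdot> ((mult MY \<otimes> \<one> B) \<otimes> \<one> B)
      \<cdot> ((\<a>' Y Y B \<cdot> (\<one> Y \<otimes> x) \<cdot> \<a> Y B Y) \<otimes> \<one> B) \<cdot> ((x \<otimes> \<one> Y) \<otimes> \<one> B) \<cdot> \<a>' (B \<odot> Y) Y B"
    by (simp add: law_mult whisker(2))
  also have "\<dots> = (mult MY \<otimes> \<one> B) \<cdot> (\<one> (Y \<odot> Y) \<otimes> mult MB) \<cdot> \<a> (Y \<odot> Y) B B
      \<cdot> ((\<a>' Y Y B \<cdot> (\<one> Y \<otimes> x) \<cdot> \<a> Y B Y) \<otimes> \<one> B) \<cdot> \<a>' (Y \<odot> B) Y B \<cdot> (x \<otimes> \<one> A)"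
    by (simp add: push whisker(2) exchange)
  also have "\<dots> = (mult MY \<otimes> \<one> B) \<cdot> \<a>' Y Y B \<cdot> (\<one> Y \<otimes> \<one> Y \<otimes> mult MB) \<cdot> \<a> Y Y (B \<odot> B) \<cdot> \<a> (Y \<odot> Y) B B
      \<cdot> ((\<a>' Y Y B \<cdot> (\<one> Y \<otimes> x) \<cdot> \<a> Y B Y) \<otimes> \<one> B) \<cdot> \<a>' (Y \<odot> B) Y B \<cdot> (x \<otimes> \<one> A)"
    by (simp add: push)
  also have "\<dots> = actY \<cdot> (\<one> Y \<otimes> actB) \<cdot> \<a> Y B A \<cdot> (x \<otimes> \<one> A)"
    by (simp add: actB_def actY_def whisker(1) whisker_swap_tail)
  finally show ?thesis .
qed

text \<open>
  Associativity is checked on the two kinds of factors of the leftmost argument: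
  \<open>(y \<cdot> a) a' = y \<cdot> (a a')\<close> here and \<open>(b \<cdot> a) a' = b \<cdot> (a a')\<close> next, where the latter combines
  \<open>actB_assoc\<close> with \<open>act_compat\<close>.
\<close>

lemma actA_actY: "actA \<cdot> (actY \<otimes> \<one> A) = actY \<cdot> (\<one> Y \<otimes> actA) \<cdot> \<a> Y A A"
proof -
  have "actA \<cdot> (actY \<otimes> \<one> A)
      = actY \<cdot> (\<one> Y \<otimes> actB) \<cdot> (mult MY \<otimes> \<one> (B \<odot> A)) \<cdot> \<a> (Y \<odot> Y) B A \<cdot> (\<a>' Y Y B \<otimes> \<one> A)"
    by (simp add: actA_def actY_def whisker push)
  also have "\<dots> = (actY \<cdot> (mult MY \<otimes> \<one> A)) \<cdot> (\<one> (Y \<odot> Y) \<otimes> actB) \<cdot> \<a> (Y \<odot> Y) B A \<cdot> (\<a>' Y Y B \<otimes> \<one> A)"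
    by (simp add: exchange)
  also have "\<dots> = actY \<cdot> (\<one> Y \<otimes> actY) \<cdot> (\<one> Y \<otimes> \<one> Y \<otimes> actB) \<cdot> (\<one> Y \<otimes> \<a> Y B A) \<cdot> \<a> Y A A"
    by (simp only: actY_assoc) (simp add: push pentagon_outer_inverse)
  also have "\<dots> = actY \<cdot> (\<one> Y \<otimes> actA) \<cdot> \<a> Y A A"
    by (simp add: actA_def whisker(1))
  finally show ?thesis .
qed

lemma actA_actB: "actA \<cdot> (actB \<otimes> \<one> A) = actB \<cdot> (\<one> B \<otimes> actA) \<cdot> \<a> B A A"
proof -
  have actB_A: "actB \<otimes> \<one> A = ((\<one> Y \<otimes> mult MB) \<otimes> \<one> A) \<cdot> (\<a> Y B B \<otimes> \<one> A) \<cdot> ((x \<otimes> \<one> B) \<otimes> \<one> A) \<cdot> (\<a>' B Y B \<otimes> \<one> A)"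
    by (simp add: actB_def whisker(2))
  have "actA \<cdot> (actB \<otimes> \<one> A)
      = actY \<cdot> (\<one> Y \<otimes> (actB \<cdot> (mult MB \<otimes> \<one> A))) \<cdot> \<a> Y (B \<odot> B) A
        \<cdot> (\<a> Y B B \<otimes> \<one> A) \<cdot> ((x \<otimes> \<one> B) \<otimes> \<one> A) \<cdot> (\<a>' B Y B \<otimes> \<one> A)"
    by (simp add: actA_def actB_A whisker(1) push)
  also have "\<dots> = actY \<cdot> (\<one> Y \<otimes> actB) \<cdot> (\<one> Y \<otimes> \<one> B \<otimes> actB) \<cdot> \<a> Y B (B \<odot> A) \<cdot> (x \<otimes> \<one> (B \<odot> A))
        \<cdot> \<a> (B \<odot> Y) B A \<cdot> (\<a>' B Y B \<otimes> \<one> A)"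
    by (simp add: actB_assoc whisker(1) pentagon_tail push)
  also have "\<dots> = (actY \<cdot> (\<one> Y \<otimes> actB) \<cdot> \<a> Y B A \<cdot> (x \<otimes> \<one> A)) \<cdot> (\<one> (B \<odot> Y) \<otimes> actB)
        \<cdot> \<a> (B \<odot> Y) B A \<cdot> (\<a>' B Y B \<otimes> \<one> A)"
    by (simp add: push exchange)
  also have "\<dots> = actB \<cdot> (\<one> B \<otimes> actY) \<cdot> (\<one> B \<otimes> \<one> Y \<otimes> actB) \<cdot> (\<one> B \<otimes> \<a> Y B A) \<cdot> \<a> B A A"
    by (simp only: act_compat[symmetric]) (simp add: push pentagon_outer_inverse)
  also have "\<dots> = actB \<cdot> (\<one> B \<otimes> actA) \<cdot> \<a> B A A"
    by (simp add: actA_def whisker(1))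
  finally show ?thesis .
qed

lemma actA_assoc: "actA \<cdot> (actA \<otimes> \<one> A) = actA \<cdot> (\<one> A \<otimes> actA) \<cdot> \<a> A A A"
proof -
  have "actA \<cdot> (actA \<otimes> \<one> A)
      = (actA \<cdot> (actY \<otimes> \<one> A)) \<cdot> ((\<one> Y \<otimes> actB) \<otimes> \<one> A) \<cdot> (\<a> Y B A \<otimes> \<one> A)"
    by (simp add: actA_def whisker(2))
  also have "\<dots> = actY \<cdot> (\<one> Y \<otimes> (actA \<cdot> (actB \<otimes> \<one> A))) \<cdot> \<a> Y (B \<odot> A) A \<cdot> (\<a> Y B A \<otimes> \<one> A)"
    by (simp only: actA_actY) (simp add: push whisker(1))
  also have "\<dots> = actY \<cdot> (\<one> Y \<otimes> actB) \<cdot> (\<one> Y \<otimes> \<one> B \<otimes> actA) \<cdot> \<a> Y B (A \<odot> A) \<cdot> \<a> A A A"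
    by (simp only: actA_actB) (simp add: pentagon whisker(1))
  also have "\<dots> = actA \<cdot> (\<one> A \<otimes> actA) \<cdot> \<a> A A A"
    by (simp add: actA_def push)
  finally show ?thesis .
qed

definition inY where "inY = (\<one> Y \<otimes> unit MB) \<cdot> \<r>' Y"
definition inB where "inB = (unit MY \<otimes> \<one> B) \<cdot> \<l>' B"

definition composite :: "('o, 'a) mon" where "composite = \<lparr>carr = A, mult = actA, unit = inY \<cdot> unit MY\<rparr>"

lemma in_type [simp]:
  "inY \<in> Ar C" "Dom C inY = Y" "Cod C inY = A" "inB \<in> Ar C" "Dom C inB = B" "Cod C inB = A"
  by (simp_all add: inY_def inB_def)

lemma composite_simps [simp]: "carr composite = A" "mult composite = actA" "unit composite = inY \<cdot> unit MY"
  by (simp_all add: composite_def)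

lemma unit_composite: "inB \<cdot> unit MB = inY \<cdot> unit MY"
proof -
  have "inB \<cdot> unit MB = (unit MY \<otimes> \<one> B) \<cdot> (\<one> I \<otimes> unit MB) \<cdot> \<l>' I"
    using unit'_nat(1)[of "unit MB" B] by (simp add: inB_def)
  also have "\<dots> = (\<one> Y \<otimes> unit MB) \<cdot> (unit MY \<otimes> \<one> I) \<cdot> \<r>' I"
    by (simp add: exchange lunit_eq_runit)
  also have "\<dots> = inY \<cdot> unit MY"
    using unit'_nat(2)[of "unit MY" Y] by (simp add: inY_def)
  finally show ?thesis .
qed

lemma actA_inY: "actA \<cdot> (inY \<otimes> \<one> A) = actY"
proof -
  have "actA \<cdot> (inY \<otimes> \<one> A) = actY \<cdot> (\<one> Y \<otimes> (actB \<cdot> (unit MB \<otimes> \<one> A))) \<cdot> \<a> Y I A \<cdot> (\<r>' Y \<otimes> \<one> A)"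
    by (simp add: actA_def inY_def whisker push)
  also have "\<dots> = actY \<cdot> ((\<one> Y \<otimes> \<l> A) \<cdot> \<a> Y I A) \<cdot> (\<r>' Y \<otimes> \<one> A)"
    by (simp add: actB_unit)
  also have "\<dots> = actY"
    by (simp only: triangle monoid_type[OF MB] monoid_type[OF MY] TenO_in) (simp add: merge)
  finally show ?thesis .
qed

lemma actA_inB: "actA \<cdot> (inB \<otimes> \<one> A) = actB"
proof -
  have "actA \<cdot> (inB \<otimes> \<one> A) = (actY \<cdot> (unit MY \<otimes> \<one> A)) \<cdot> (\<one> I \<otimes> actB) \<cdot> \<a> I B A \<cdot> (\<l>' B \<otimes> \<one> A)"
    by (simp add: actA_def inB_def whisker push exchange)
  also have "\<dots> = (\<l> A \<cdot> (\<one> I \<otimes> actB)) \<cdot> \<a> I B A \<cdot> (\<l>' B \<otimes> \<one> A)"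
    by (simp add: actY_unit)
  also have "\<dots> = actB \<cdot> (\<l> (B \<odot> A) \<cdot> \<a> I B A) \<cdot> (\<l>' B \<otimes> \<one> A)"
    by (simp add: unit_nat)
  also have "\<dots> = actB"
    by (simp only: lunit_ten monoid_type[OF MB] monoid_type[OF MY] TenO_in) (simp add: merge)
  finally show ?thesis .
qed

lemma actA_inY_comp:
  assumes "f \<in> Ar C" "Cod C f = Y" "g \<in> Ar C" "Cod C g = A"
  shows "actA \<cdot> ((inY \<cdot> f) \<otimes> g) = actY \<cdot> (f \<otimes> g)"
proof -
  have "actA \<cdot> ((inY \<cdot> f) \<otimes> g) = (actA \<cdot> (inY \<otimes> \<one> A)) \<cdot> (f \<otimes> g)"
    using assms by (simp add: interchange)
  then show ?thesis by (simp only: actA_inY)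
qed

lemma actA_inB_comp:
  assumes "f \<in> Ar C" "Cod C f = B" "g \<in> Ar C" "Cod C g = A"
  shows "actA \<cdot> ((inB \<cdot> f) \<otimes> g) = actB \<cdot> (f \<otimes> g)"
proof -
  have "actA \<cdot> ((inB \<cdot> f) \<otimes> g) = (actA \<cdot> (inB \<otimes> \<one> A)) \<cdot> (f \<otimes> g)"
    using assms by (simp add: interchange)
  then show ?thesis by (simp only: actA_inB)
qed

text \<open>
  Together with the next three lemmas this determines all products of \<open>inY\<close> and \<open>inB\<close>: in the
  composite monoid, \<open>Y\<close> and \<open>B\<close> are submonoids, every element is uniquely a product of one from
  each, and \<open>x\<close> records how to exchange them.
\<close>

lemma actY_inB: "actY \<cdot> (\<one> Y \<otimes> inB) = \<one> A"
proof -
  have "actY \<cdot> (\<one> Y \<otimes> inB) = ((mult MY \<cdot> (\<one> Y \<otimes> unit MY)) \<otimes> \<one> B) \<cdot> \<a>' Y I B \<cdot> (\<one> Y \<otimes> \<l>' B)"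
    by (simp add: actY_def inB_def whisker push)
  also have "\<dots> = ((\<one> Y \<otimes> \<l> B) \<cdot> \<a> Y I B) \<cdot> \<a>' Y I B \<cdot> (\<one> Y \<otimes> \<l>' B)"
    by (simp add: mult_unit triangle)
  also have "\<dots> = \<one> A"
    by (simp add: merge)
  finally show ?thesis .
qed

lemma actB_inY: "actB \<cdot> (\<one> B \<otimes> inY) = x"
proof -
  have "actB \<cdot> (\<one> B \<otimes> inY) = (\<one> Y \<otimes> (mult MB \<cdot> (\<one> B \<otimes> unit MB))) \<cdot> \<a> Y B I \<cdot> (x \<otimes> \<one> I) \<cdot> \<a>' B Y I \<cdot> (\<one> B \<otimes> \<r>' Y)"
    by (simp add: actB_def inY_def whisker push exchange)
  also have "\<dots> = (\<r> A \<cdot> (x \<otimes> \<one> I)) \<cdot> \<a>' B Y I \<cdot> (\<one> B \<otimes> \<r>' Y)"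
    by (simp add: mult_unit flip: runit_ten)
  also have "\<dots> = x"
    by (simp add: unit_nat runit'_ten)
  finally show ?thesis .
qed

lemma actY_inY: "actY \<cdot> (\<one> Y \<otimes> inY) = inY \<cdot> mult MY"
proof -
  have "actY \<cdot> (\<one> Y \<otimes> inY) = (\<one> Y \<otimes> unit MB) \<cdot> (mult MY \<otimes> \<one> I) \<cdot> \<a>' Y Y I \<cdot> (\<one> Y \<otimes> \<r>' Y)"
    by (simp add: actY_def inY_def whisker push exchange)
  also have "\<a>' Y Y I \<cdot> (\<one> Y \<otimes> \<r>' Y) = \<r>' (Y \<odot> Y)"
    by (simp add: runit'_ten)
  also have "(mult MY \<otimes> \<one> I) \<cdot> \<r>' (Y \<odot> Y) = \<r>' Y \<cdot> mult MY"
    using unit'_nat(2)[of "mult MY" Y] by simp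
  finally show ?thesis by (simp add: inY_def)
qed

lemma actB_inB: "actB \<cdot> (\<one> B \<otimes> inB) = inB \<cdot> mult MB"
proof -
  have "actB \<cdot> (\<one> B \<otimes> inB) = (\<one> Y \<otimes> mult MB) \<cdot> \<a> Y B B \<cdot> ((x \<cdot> (\<one> B \<otimes> unit MY)) \<otimes> \<one> B) \<cdot> \<a>' B I B \<cdot> (\<one> B \<otimes> \<l>' B)"
    by (simp add: actB_def inB_def whisker push)
  also have "\<dots> = (\<one> Y \<otimes> mult MB) \<cdot> (unit MY \<otimes> \<one> (B \<odot> B)) \<cdot> \<a> I B B \<cdot> (\<l>' B \<otimes> \<one> B) \<cdot> (\<r> B \<otimes> \<one> B) \<cdot> \<a>' B I B \<cdot> (\<one> B \<otimes> \<l>' B)"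
    by (simp add: law_unit_Y whisker push)
  also have "(\<r> B \<otimes> \<one> B) \<cdot> \<a>' B I B \<cdot> (\<one> B \<otimes> \<l>' B) = \<one> (B \<odot> B)"
    by (simp add: interchange flip: triangle)
  also have "\<a> I B B \<cdot> (\<l>' B \<otimes> \<one> B) \<cdot> \<one> (B \<odot> B) = \<l>' (B \<odot> B)"
    by (simp add: lunit'_ten)
  also have "(\<one> Y \<otimes> mult MB) \<cdot> (unit MY \<otimes> \<one> (B \<odot> B)) \<cdot> \<l>' (B \<odot> B)
      = (unit MY \<otimes> \<one> B) \<cdot> (\<one> I \<otimes> mult MB) \<cdot> \<l>' (B \<odot> B)"
    by (simp add: merge)
  also have "(\<one> I \<otimes> mult MB) \<cdot> \<l>' (B \<odot> B) = \<l>' B \<cdot> mult MB"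
    using unit'_nat(1)[of "mult MB" B] by simp
  finally show ?thesis by (simp add: inB_def)
qed

lemma composite_monoid: "is_monoid C composite"
proof -
  have "actA \<cdot> ((inY \<cdot> unit MY) \<otimes> \<one> A) = \<l> A"
    by (simp add: actA_inY_comp actY_unit)
  moreover have "actA \<cdot> (\<one> A \<otimes> (inY \<cdot> unit MY)) = \<r> A"
  proof -
    have "actB \<cdot> (\<one> B \<otimes> (inB \<cdot> unit MB)) = (actB \<cdot> (\<one> B \<otimes> inB)) \<cdot> (\<one> B \<otimes> unit MB)"
      by (simp add: whisker)
    also have "\<dots> = inB \<cdot> \<r> B"
      by (simp only: actB_inB) (simp add: mult_unit)
    finally have "actA \<cdot> (\<one> A \<otimes> (inY \<cdot> unit MY)) = (actY \<cdot> (\<one> Y \<otimes> inB)) \<cdot> (\<one> Y \<otimes> \<r> B) \<cdot> \<a> Y B I"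
      by (simp add: actA_def push merge flip: unit_composite)
    then show ?thesis
      by (simp only: actY_inB) (simp add: runit_ten)
  qed
  ultimately show ?thesis
    using actA_assoc by (simp add: is_monoid_def Hom_def)
qed

lemma inY_morphism: "is_monoid_morphism C MY composite inY"
  using actA_inY_comp[of "\<one> Y" inY] by (auto intro!: monoid_morphismI simp: star_def actY_inY)

lemma inB_morphism: "is_monoid_morphism C MB composite inB"
  using actA_inB_comp[of "\<one> B" inB] by (auto intro!: monoid_morphismI simp: star_def actB_inB unit_composite)

lemma inY_star_inB: "inY \<star>\<^bsub>composite\<^esub> inB = \<one> A"
  using actA_inY_comp[of "\<one> Y" inB] by (simp add: star_def actY_inB)

lemma inB_star_inY: "inB \<star>\<^bsub>composite\<^esub> inY = x"
  using actA_inB_comp[of "\<one> B" inY] by (simp add: star_def actB_inY)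

text \<open>
  The universal property of the composite monoid: morphisms \<open>g\<close> and \<open>h\<close> on the factors that
  respect the exchange rule extend to the product.  It yields the source and target morphisms of
  the graph, the action on morphisms, and the comparison with a given reflexive graph.  The extension
  \<open>\<phi> = g \<star> h\<close> is multiplicative since it turns the actions of \<open>Y\<close> and \<open>B\<close> into multiplication by
  \<open>g\<close> and \<open>h\<close>.
\<close>

lemma copairing:
  assumes N: "is_monoid C N" and g: "is_monoid_morphism C MY N g" and h: "is_monoid_morphism C MB N h"
    and law: "(g \<star>\<^bsub>N\<^esub> h) \<cdot> x = h \<star>\<^bsub>N\<^esub> g"
  shows "is_monoid_morphism C composite N (g \<star>\<^bsub>N\<^esub> h)"
    and "(g \<star>\<^bsub>N\<^esub> h) \<cdot> inY = g" and "(g \<star>\<^bsub>N\<^esub> h) \<cdot> inB = h"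
proof -
  note [simp] = monoid_type[OF N] monoid_morphism_type[OF g] monoid_morphism_type[OF h] N
  let ?\<phi> = "g \<star>\<^bsub>N\<^esub> h"
  note mor = monoid_morphism_mult[OF g] monoid_morphism_mult[OF h]
    monoid_morphism_unit[OF g] monoid_morphism_unit[OF h]
  have "?\<phi> \<cdot> inY = (?\<phi> \<cdot> (\<one> Y \<otimes> unit MB)) \<cdot> \<r>' Y"
    by (simp add: inY_def)
  then show inY: "?\<phi> \<cdot> inY = g"
    by (simp add: star_comp mor star_unit)
  have "?\<phi> \<cdot> inB = (?\<phi> \<cdot> (unit MY \<otimes> \<one> B)) \<cdot> \<l>' B"
    by (simp add: inB_def)
  then show "?\<phi> \<cdot> inB = h"
    by (simp add: star_comp mor star_unit)
  have "?\<phi> \<cdot> actY = (?\<phi> \<cdot> (mult MY \<otimes> \<one> B)) \<cdot> \<a>' Y Y B"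
    by (simp add: actY_def)
  also have "\<dots> = g \<star>\<^bsub>N\<^esub> ?\<phi>"
    using star_assoc'[OF N, of g g h] by (simp add: star_comp mor)
  finally have actY: "?\<phi> \<cdot> actY = g \<star>\<^bsub>N\<^esub> ?\<phi>" .
  have "?\<phi> \<cdot> actB = (((?\<phi> \<cdot> (\<one> Y \<otimes> mult MB)) \<cdot> \<a> Y B B) \<cdot> (x \<otimes> \<one> B)) \<cdot> \<a>' B Y B"
    by (simp add: actB_def)
  also have "\<dots> = ((?\<phi> \<star>\<^bsub>N\<^esub> h) \<cdot> (x \<otimes> \<one> B)) \<cdot> \<a>' B Y B"
    using star_assoc[OF N, of g h h] by (simp add: star_comp mor)
  also have "\<dots> = h \<star>\<^bsub>N\<^esub> ?\<phi>"
    using star_assoc'[OF N, of h g h] by (simp add: star_comp law)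
  finally have actB: "?\<phi> \<cdot> actB = h \<star>\<^bsub>N\<^esub> ?\<phi>" .
  have "?\<phi> \<cdot> actA = (?\<phi> \<cdot> actY) \<cdot> (\<one> Y \<otimes> actB) \<cdot> \<a> Y B A"
    by (simp add: actA_def)
  also have "\<dots> = ((g \<star>\<^bsub>N\<^esub> ?\<phi>) \<cdot> (\<one> Y \<otimes> actB)) \<cdot> \<a> Y B A"
    by (simp add: actY)
  also have "\<dots> = ?\<phi> \<star>\<^bsub>N\<^esub> ?\<phi>"
    using star_assoc[OF N, of g h ?\<phi>] by (simp add: star_comp actB)
  finally have mult: "?\<phi> \<cdot> actA = ?\<phi> \<star>\<^bsub>N\<^esub> ?\<phi>" .
  have "?\<phi> \<cdot> inY \<cdot> unit MY = unit N"
    using comp_cong_tail[OF inY, of "unit MY"] by (simp add: mor)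
  with mult show "is_monoid_morphism C composite N ?\<phi>"
    by (auto intro!: monoid_morphismI)
qed

lemma morphism_eq_star:
  assumes N: "is_monoid C N" and \<phi>: "is_monoid_morphism C composite N \<phi>"
  shows "\<phi> = (\<phi> \<cdot> inY) \<star>\<^bsub>N\<^esub> (\<phi> \<cdot> inB)"
  using monoid_morphism_star[OF \<phi> composite_monoid N, of inY inB] monoid_morphism_type[OF \<phi>]
  by (simp add: inY_star_inB)

end

section \<open>Equivalences from fully faithful functors\<close>

lemma cat_functor_id: "category C \<Longrightarrow> cat_functor C C id id"
  by (simp add: cat_functor_def cat_functor_axioms_def)

lemma cat_functor_comp:
  assumes "cat_functor C D Fo Fa" "cat_functor D E Go Ga"
  shows "cat_functor C E (Go \<circ> Fo) (Ga \<circ> Fa)"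
proof -
  interpret F: cat_functor C D Fo Fa by (rule assms)
  interpret G: cat_functor D E Go Ga by (rule assms)
  show ?thesis
  proof unfold_locales
    show "(Go \<circ> Fo) X \<in> Ob E" "(Ga \<circ> Fa) (Idt C X) = Idt E ((Go \<circ> Fo) X)" if "X \<in> Ob C" for X
      using F.obj[OF that] F.idt[OF that] G.obj G.idt by simp_all
    show "(Ga \<circ> Fa) f \<in> Hom E ((Go \<circ> Fo) X) ((Go \<circ> Fo) Y)" if "f \<in> Hom C X Y" for f X Y
      using G.arr[OF F.arr[OF that]] by simp
    show "(Ga \<circ> Fa) (Cmp C g f) = Cmp E ((Ga \<circ> Fa) g) ((Ga \<circ> Fa) f)"
      if "f \<in> Hom C X Y" "g \<in> Hom C Y Z" for f X Y g Z
      using G.cmp[OF F.arr[OF that(1)] F.arr[OF that(2)]] F.cmp[OF that] by simp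
  qed
qed

text \<open>
  A quasi-inverse is built by choosing for each \<open>X\<close> an isomorphism \<open>h\<^bsub>X\<^esub> : K P \<rightarrow> X\<close>, and transporting
  arrows by conjugation with \<open>h\<close>; fullness provides the preimages, faithfulness all equations.
\<close>

lemma equivalent_categories_if_fully_faithful:
  fixes C :: "('o1, 'a1, 'z1) cat_scheme" and D :: "('o2, 'a2, 'z2) cat_scheme"
  assumes K_functor: "cat_functor D C Ko Ka"
    and full: "\<And>P Q f. \<lbrakk>P \<in> Ob D; Q \<in> Ob D; f \<in> Hom C (Ko P) (Ko Q)\<rbrakk> \<Longrightarrow> \<exists>g \<in> Hom D P Q. Ka g = f"
    and faithful: "\<And>P Q g g'. \<lbrakk>g \<in> Hom D P Q; g' \<in> Hom D P Q; Ka g = Ka g'\<rbrakk> \<Longrightarrow> g = g'"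
    and essentially_surjective:
      "\<And>X. X \<in> Ob C \<Longrightarrow> \<exists>P \<in> Ob D. \<exists>h \<in> Hom C (Ko P) X. invertible C h"
  shows "equivalent_categories C D"
proof -
  interpret C: category C using K_functor by (simp add: cat_functor_def)
  interpret D: category D using K_functor by (simp add: cat_functor_def)
  interpret K: cat_functor D C Ko Ka by (rule K_functor)
  define preimage where "preimage P Q f = (SOME g. g \<in> Hom D P Q \<and> Ka g = f)" for P Q f
  have preimage: "preimage P Q f \<in> Hom D P Q" "Ka (preimage P Q f) = f"
    if "P \<in> Ob D" "Q \<in> Ob D" "f \<in> Hom C (Ko P) (Ko Q)" for P Q f
    using someI_ex[of "\<lambda>g. g \<in> Hom D P Q \<and> Ka g = f"] full[OF that] by (auto simp: preimage_def)
  have "\<forall>X. \<exists>P h. X \<in> Ob C \<longrightarrow> P \<in> Ob D \<and> h \<in> Hom C (Ko P) X \<and> invertible C h"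
    using essentially_surjective by blast
  then obtain Fo h where Fo: "\<And>X. X \<in> Ob C \<Longrightarrow> Fo X \<in> Ob D"
    and h: "\<And>X. X \<in> Ob C \<Longrightarrow> h X \<in> Hom C (Ko (Fo X)) X"
    and h_iso: "\<And>X. X \<in> Ob C \<Longrightarrow> invertible C (h X)"
    by metis
  define h' where "h' X = inv_arrow C (h X)" for X
  have h': "h' X \<in> Hom C X (Ko (Fo X))" if "X \<in> Ob C" for X
    using C.inv_arrow_type[OF h_iso[OF that]] h[OF that] by (simp add: h'_def Hom_def)
  have h'_h: "Cmp C (h' X) (h X) = Idt C (Ko (Fo X))" "Cmp C (h X) (h' X) = Idt C X" if "X \<in> Ob C" for X
    using C.inv_arrow_comp[OF h_iso[OF that]] h[OF that] by (auto simp: h'_def Hom_def)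
  have h_iso': "invertible C (h' X)" if "X \<in> Ob C" for X
    using C.invertibleI[OF h'[OF that] h[OF that]] h'_h[OF that] by simp
  define conj where "conj f = Cmp C (h' (Cod C f)) (Cmp C f (h (Dom C f)))" for f
  have conj: "conj f \<in> Hom C (Ko (Fo X)) (Ko (Fo Y))" if "f \<in> Hom C X Y" for f X Y
    using that h[of X] h'[of Y] by (auto simp: conj_def Hom_def)
  define Fa where "Fa f = preimage (Fo (Dom C f)) (Fo (Cod C f)) (conj f)" for f
  have Fa: "Fa f \<in> Hom D (Fo X) (Fo Y)" "Ka (Fa f) = conj f" if "f \<in> Hom C X Y" for f X Y
    using preimage[OF Fo Fo conj[OF that]] C.in_homD[OF that] that by (auto simp: Fa_def)
  have F: "cat_functor C D Fo Fa"
  proof unfold_locales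
    fix X assume X: "X \<in> Ob C"
    then show "Fo X \<in> Ob D" by (rule Fo)
    have idt: "Idt C X \<in> Hom C X X" using X by (rule C.Idt_in)
    have "conj (Idt C X) = Ka (Idt D (Fo X))"
      using X h[OF X] h'[OF X] h'_h[OF X] K.idt[OF Fo[OF X]] by (simp add: conj_def Hom_def)
    then show "Fa (Idt C X) = Idt D (Fo X)"
      using Fa[OF idt] D.Idt_in[OF Fo[OF X]] by (metis faithful)
  next
    fix f X Y assume "f \<in> Hom C X Y"
    then show "Fa f \<in> Hom D (Fo X) (Fo Y)" by (rule Fa)
  next
    fix f X Y g Z assume f: "f \<in> Hom C X Y" and g: "g \<in> Hom C Y Z"
    have X: "X \<in> Ob C" and Y: "Y \<in> Ob C" and Z: "Z \<in> Ob C"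
      using f g by (auto dest: C.in_homD)
    have "Cmp C (conj g) (conj f) = Cmp C (h' Z) (Cmp C g (Cmp C (h Y) (Cmp C (h' Y) (Cmp C f (h X)))))"
      using f g h[OF X] h[OF Y] h'[OF Y] h'[OF Z] by (simp add: conj_def Hom_def)
    also have "\<dots> = conj (Cmp C g f)"
      using f g h[OF X] h'[OF Z] h'[OF Y] h[OF Y]
        C.comp_cong_tail[OF h'_h(2)[OF Y], of "Cmp C f (h X)"] Y by (simp add: conj_def Hom_def)
    finally have "Ka (Fa (Cmp C g f)) = Ka (Cmp D (Fa g) (Fa f))"
      using Fa[OF f] Fa[OF g] Fa[OF C.Cmp_in[OF f g]] K.cmp[OF Fa(1)[OF f] Fa(1)[OF g]] by simp
    then show "Fa (Cmp C g f) = Cmp D (Fa g) (Fa f)"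
      using Fa(1)[OF C.Cmp_in[OF f g]] D.Cmp_in[OF Fa(1)[OF f] Fa(1)[OF g]] faithful by blast
  qed
  interpret F: cat_functor C D Fo Fa by (rule F)
  define \<epsilon> where "\<epsilon> P = preimage (Fo (Ko P)) P (h (Ko P))" for P
  have \<epsilon>: "\<epsilon> P \<in> Hom D (Fo (Ko P)) P" "Ka (\<epsilon> P) = h (Ko P)" if "P \<in> Ob D" for P
    using preimage[OF Fo[OF K.obj] _ h[OF K.obj]] that by (auto simp: \<epsilon>_def)
  have "natural_isomorphism C C id id (Ko \<circ> Fo) (Ka \<circ> Fa) h'"
  proof (intro natural_isomorphism.intro natural_isomorphism_axioms.intro)
    show "cat_functor C C id id" by (rule cat_functor_id[OF C.category_axioms])
    show "cat_functor C C (Ko \<circ> Fo) (Ka \<circ> Fa)" by (rule cat_functor_comp[OF F K_functor])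
    show "h' X \<in> Hom C (id X) ((Ko \<circ> Fo) X)" "invertible C (h' X)" if "X \<in> Ob C" for X
      using h'[OF that] h_iso'[OF that] by auto
    show "Cmp C (h' Y) (id f) = Cmp C ((Ka \<circ> Fa) f) (h' X)" if f: "f \<in> Hom C X Y" for f X Y
    proof -
      have "X \<in> Ob C" "Y \<in> Ob C" using f by (auto dest: C.in_homD)
      then show ?thesis
        using f h[of X] h'[of Y] h'[of X] h'_h[of X] Fa[OF f] by (simp add: conj_def Hom_def)
    qed
  qed
  moreover have "natural_isomorphism D D (Fo \<circ> Ko) (Fa \<circ> Ka) id id \<epsilon>"
  proof (intro natural_isomorphism.intro natural_isomorphism_axioms.intro)
    show "cat_functor D D id id" by (rule cat_functor_id[OF D.category_axioms])
    show "cat_functor D D (Fo \<circ> Ko) (Fa \<circ> Ka)" by (rule cat_functor_comp[OF K_functor F])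
    show "\<epsilon> P \<in> Hom D ((Fo \<circ> Ko) P) (id P)" if "P \<in> Ob D" for P
      using \<epsilon>[OF that] by auto
    show "invertible D (\<epsilon> P)" if P: "P \<in> Ob D" for P
    proof -
      let ?X = "Ko P"
      note X = K.obj[OF P]
      obtain g where g: "g \<in> Hom D P (Fo ?X)" "Ka g = h' ?X"
        using preimage[OF P Fo[OF X] h'[OF X]] by blast
      have "Ka (Cmp D g (\<epsilon> P)) = Ka (Idt D (Fo ?X))" "Ka (Cmp D (\<epsilon> P) g) = Ka (Idt D P)"
        using K.cmp[OF \<epsilon>(1)[OF P] g(1)] K.cmp[OF g(1) \<epsilon>(1)[OF P]] \<epsilon>(2)[OF P] g(2) h'_h[OF X]
          K.idt[OF P] K.idt[OF Fo[OF X]] by auto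
      then have "Cmp D g (\<epsilon> P) = Idt D (Fo ?X)" "Cmp D (\<epsilon> P) g = Idt D P"
        using D.Cmp_in[OF \<epsilon>(1)[OF P] g(1)] D.Cmp_in[OF g(1) \<epsilon>(1)[OF P]]
          D.Idt_in[OF P] D.Idt_in[OF Fo[OF X]] faithful by blast+
      then show ?thesis using D.invertibleI[OF \<epsilon>(1)[OF P] g(1)] by blast
    qed
    show "Cmp D (\<epsilon> Q) ((Fa \<circ> Ka) g) = Cmp D (id g) (\<epsilon> P)" if g: "g \<in> Hom D P Q" for g P Q
    proof -
      have P: "P \<in> Ob D" and Q: "Q \<in> Ob D" using g by (auto dest: D.in_homD)
      note Kg = K.arr[OF g]
      note FKg = Fa[OF Kg]
      have "Ka (Cmp D (\<epsilon> Q) (Fa (Ka g))) = Cmp C (h (Ko Q)) (conj (Ka g))"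
        using K.cmp[OF FKg(1) \<epsilon>(1)[OF Q]] \<epsilon>(2)[OF Q] FKg(2) by simp
      also have "\<dots> = Cmp C (Ka g) (h (Ko P))"
        using Kg h[OF K.obj[OF P]] h[OF K.obj[OF Q]] h'[OF K.obj[OF Q]]
          C.comp_cong_tail[OF h'_h(2)[OF K.obj[OF Q]], of "Cmp C (Ka g) (h (Ko P))"] K.obj[OF Q]
        by (simp add: conj_def Hom_def)
      also have "\<dots> = Ka (Cmp D g (\<epsilon> P))"
        using K.cmp[OF \<epsilon>(1)[OF P] g] \<epsilon>(2)[OF P] by simp
      finally show ?thesis
        using D.Cmp_in[OF FKg(1) \<epsilon>(1)[OF Q]] D.Cmp_in[OF \<epsilon>(1)[OF P] g] faithful by fastforce
    qed
  qed
  ultimately show ?thesis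
    unfolding equivalent_categories_def using F K_functor by blast
qed

section \<open>The categories of reflexive graphs and of pre-crossed modules\<close>

context monoidal_category
begin

lemma monoid_morphism_ident:
  assumes "is_monoid C M"
  shows "is_monoid_morphism C M M (\<one> (carr M))"
  using monoid_type[OF assms] by (auto intro!: monoid_morphismI simp: star_def)

lemma monoid_morphism_comp:
  assumes M: "is_monoid C M" and N: "is_monoid C N" and Q: "is_monoid C Q"
    and f: "is_monoid_morphism C M N f" and g: "is_monoid_morphism C N Q g"
  shows "is_monoid_morphism C M Q (g \<cdot> f)"
proof (rule monoid_morphismI)
  note [simp] = monoid_type[OF M] monoid_type[OF N] monoid_type[OF Q]
    monoid_morphism_type[OF f] monoid_morphism_type[OF g]
  show "(g \<cdot> f) \<cdot> mult M = (g \<cdot> f) \<star>\<^bsub>Q\<^esub> (g \<cdot> f)"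
    by (simp add: monoid_morphism_mult[OF f] monoid_morphism_star[OF g N Q])
  show "(g \<cdot> f) \<cdot> unit M = unit Q"
    by (simp add: monoid_morphism_unit[OF f] monoid_morphism_unit[OF g])
qed (use monoid_morphism_type[OF f] monoid_morphism_type[OF g] in simp_all)

lemma monoid_morphism_inverse:
  assumes M: "is_monoid C M" and N: "is_monoid C N"
    and f: "is_monoid_morphism C M N f" and iso: "invertible C f"
  shows "is_monoid_morphism C N M (inv_arrow C f)"
proof -
  note [simp] = monoid_type[OF M] monoid_type[OF N] monoid_morphism_type[OF f] M N
    inv_arrow_type[OF iso] inv_arrow_comp[OF iso] inv_arrow_comp_assoc[OF iso]
  have "inv_arrow C f \<cdot> mult N = inv_arrow C f \<star>\<^bsub>M\<^esub> inv_arrow C f"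
    by (rule cancel_left_iso[OF iso]) (simp_all add: monoid_morphism_star[OF f M N] flip: mult_eq_star)
  moreover have "inv_arrow C f \<cdot> unit N = unit M"
    by (rule cancel_left_iso[OF iso]) (simp_all add: monoid_morphism_unit[OF f])
  ultimately show ?thesis
    by (auto intro!: monoid_morphismI)
qed

lemma refl_graphD:
  assumes "refl_graph_mon_obj C S G"
  shows "is_monoid C (rgA G)" "is_monoid C (rgB G)"
    "is_monoid_morphism C (rgB G) (rgA G) (rgi G)"
    "is_monoid_morphism C (rgA G) (rgB G) (rgs G)"
    "is_monoid_morphism C (rgA G) (rgB G) (rgt G)"
    "rgs G \<cdot> rgi G = \<one> (carr (rgB G))" "rgt G \<cdot> rgi G = \<one> (carr (rgB G))"
    "(\<one> (carr (rgA G)), rgs G) \<in> S" "invertible C (rg_q C S G)"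
  using assms by (auto simp: refl_graph_mon_obj_def refl_graph_of_monoids_def)

lemma refl_graph_morD:
  assumes "refl_graph_mon_mor C S \<phi>"
  shows "refl_graph_mon_obj C S (src \<phi>)" "refl_graph_mon_obj C S (tgt \<phi>)"
    "is_monoid_morphism C (rgB (src \<phi>)) (rgB (tgt \<phi>)) (base \<phi>)"
    "is_monoid_morphism C (rgA (src \<phi>)) (rgA (tgt \<phi>)) (top \<phi>)"
    "rgs (tgt \<phi>) \<cdot> top \<phi> = base \<phi> \<cdot> rgs (src \<phi>)"
    "rgt (tgt \<phi>) \<cdot> top \<phi> = base \<phi> \<cdot> rgt (src \<phi>)"
    "rgi (tgt \<phi>) \<cdot> base \<phi> = top \<phi> \<cdot> rgi (src \<phi>)"
  using assms by (auto simp: refl_graph_mon_mor_def Let_def)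

text \<open>
  Compatibility of a morphism with \<open>s\<close>, \<open>t\<close>, \<open>i\<close>, \<open>k\<close> or \<open>x\<close> is the commutativity of a square, so closure
  under composition is pasting of squares.
\<close>

lemma square_comp:
  assumes "h' \<cdot> f = g \<cdot> h" "h'' \<cdot> f' = g' \<cdot> h'"
    "f \<in> Ar C" "f' \<in> Ar C" "g \<in> Ar C" "g' \<in> Ar C" "h \<in> Ar C" "h' \<in> Ar C" "h'' \<in> Ar C"
    "Dom C f' = Cod C f" "Dom C h' = Cod C f" "Dom C g' = Cod C g" "Cod C h = Dom C g"
    "Cod C h' = Cod C g" "Dom C h'' = Cod C f'"
  shows "h'' \<cdot> f' \<cdot> f = (g' \<cdot> g) \<cdot> h"
proof -
  have "h'' \<cdot> f' \<cdot> f = (g' \<cdot> h') \<cdot> f"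
    using comp_cong_tail[OF assms(2), of f] assms(3-) by simp
  also have "\<dots> = g' \<cdot> g \<cdot> h"
    using assms(1,3-) by simp
  finally show ?thesis using assms(3-) by simp
qed

lemma category_ReflGraphMon: "category (ReflGraphMon C S)"
proof
  fix G assume "G \<in> Ob (ReflGraphMon C S)"
  then have G: "refl_graph_mon_obj C S G" by (simp add: ReflGraphMon_def)
  note D = refl_graphD[OF G]
  show "Idt (ReflGraphMon C S) G \<in> Hom (ReflGraphMon C S) G G"
    using G monoid_morphism_ident[OF D(1)] monoid_morphism_ident[OF D(2)]
      monoid_morphism_type[OF D(3)] monoid_morphism_type[OF D(4)] monoid_morphism_type[OF D(5)]
    by (simp add: ReflGraphMon_def Hom_def refl_graph_mon_mor_def)
next
  fix \<phi> G G' \<psi> G''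
  assume "\<phi> \<in> Hom (ReflGraphMon C S) G G'" "\<psi> \<in> Hom (ReflGraphMon C S) G' G''"
  then have mor: "refl_graph_mon_mor C S \<phi>" "refl_graph_mon_mor C S \<psi>"
    and [simp]: "src \<phi> = G" "tgt \<phi> = G'" "src \<psi> = G'" "tgt \<psi> = G''"
    by (auto simp: ReflGraphMon_def Hom_def)
  note \<phi> = refl_graph_morD[OF mor(1), simplified] and \<psi> = refl_graph_morD[OF mor(2), simplified]
  note D = refl_graphD[OF \<phi>(1)] and D' = refl_graphD[OF \<phi>(2)] and D'' = refl_graphD[OF \<psi>(2)]
  note [simp] = monoid_morphism_type[OF \<phi>(3)] monoid_morphism_type[OF \<phi>(4)]
    monoid_morphism_type[OF \<psi>(3)] monoid_morphism_type[OF \<psi>(4)]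
    monoid_morphism_type[OF D(3)] monoid_morphism_type[OF D(4)] monoid_morphism_type[OF D(5)]
    monoid_morphism_type[OF D'(3)] monoid_morphism_type[OF D'(4)] monoid_morphism_type[OF D'(5)]
    monoid_morphism_type[OF D''(3)] monoid_morphism_type[OF D''(4)] monoid_morphism_type[OF D''(5)]
  have "rgs G'' \<cdot> top \<psi> \<cdot> top \<phi> = (base \<psi> \<cdot> base \<phi>) \<cdot> rgs G"
    "rgt G'' \<cdot> top \<psi> \<cdot> top \<phi> = (base \<psi> \<cdot> base \<phi>) \<cdot> rgt G"
    "rgi G'' \<cdot> base \<psi> \<cdot> base \<phi> = (top \<psi> \<cdot> top \<phi>) \<cdot> rgi G"
    by (rule square_comp[OF \<phi>(5) \<psi>(5)] square_comp[OF \<phi>(6) \<psi>(6)] square_comp[OF \<phi>(7) \<psi>(7)]; simp)+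
  then show "Cmp (ReflGraphMon C S) \<psi> \<phi> \<in> Hom (ReflGraphMon C S) G G''"
    using \<phi>(1) \<psi>(2) monoid_morphism_comp[OF D(1) D'(1) D''(1) \<phi>(4) \<psi>(4)]
      monoid_morphism_comp[OF D(2) D'(2) D''(2) \<phi>(3) \<psi>(3)]
    by (simp add: ReflGraphMon_def Hom_def refl_graph_mon_mor_def pair_comp_def)
next
  fix \<phi> G G' assume "\<phi> \<in> Hom (ReflGraphMon C S) G G'"
  then have mor: "refl_graph_mon_mor C S \<phi>" and [simp]: "src \<phi> = G" "tgt \<phi> = G'"
    by (auto simp: ReflGraphMon_def Hom_def)
  note \<phi> = refl_graph_morD[OF mor, simplified]
  note [simp] = monoid_morphism_type[OF \<phi>(3)] monoid_morphism_type[OF \<phi>(4)]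
  show "Cmp (ReflGraphMon C S) (Idt (ReflGraphMon C S) G') \<phi> = \<phi>"
    "Cmp (ReflGraphMon C S) \<phi> (Idt (ReflGraphMon C S) G) = \<phi>"
    by (auto simp: ReflGraphMon_def pair_comp_def)
next
  fix \<phi> G G' \<psi> G'' \<chi> G'''
  assume "\<phi> \<in> Hom (ReflGraphMon C S) G G'" "\<psi> \<in> Hom (ReflGraphMon C S) G' G''"
    "\<chi> \<in> Hom (ReflGraphMon C S) G'' G'''"
  then have mor: "refl_graph_mon_mor C S \<phi>" "refl_graph_mon_mor C S \<psi>" "refl_graph_mon_mor C S \<chi>"
    and [simp]: "src \<phi> = G" "tgt \<phi> = G'" "src \<psi> = G'" "tgt \<psi> = G''" "src \<chi> = G''" "tgt \<chi> = G'''"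
    by (auto simp: ReflGraphMon_def Hom_def)
  note \<phi> = refl_graph_morD[OF mor(1), simplified] and \<psi> = refl_graph_morD[OF mor(2), simplified]
    and \<chi> = refl_graph_morD[OF mor(3), simplified]
  show "Cmp (ReflGraphMon C S) (Cmp (ReflGraphMon C S) \<chi> \<psi>) \<phi>
      = Cmp (ReflGraphMon C S) \<chi> (Cmp (ReflGraphMon C S) \<psi> \<phi>)"
    using monoid_morphism_type[OF \<phi>(3)] monoid_morphism_type[OF \<phi>(4)]
      monoid_morphism_type[OF \<psi>(3)] monoid_morphism_type[OF \<psi>(4)]
      monoid_morphism_type[OF \<chi>(3)] monoid_morphism_type[OF \<chi>(4)]
    by (simp add: ReflGraphMon_def pair_comp_def)
qed (auto simp: ReflGraphMon_def dest: refl_graph_morD)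

lemma pre_xD:
  assumes "pre_x_obj C S P"
  shows "is_monoid C (pxB P)" "is_monoid C (pxY P)"
    "is_monoid_morphism C (pxY P) (trivial_monoid C) (pxe P)"
    "is_monoid_morphism C (pxY P) (pxB P) (pxk P)"
    "distributive_law C (pxB P) (pxY P) (pxx P)"
    "(\<one> (carr (pxY P)), pxe P) \<in> S" "(\<one> (carr (pxB P)), \<one> (carr (pxB P))) \<in> S"
    "px_e1 C P \<cdot> pxx P = \<r> (carr (pxB P)) \<cdot> (\<one> (carr (pxB P)) \<otimes> pxe P)"
    "mult (pxB P) \<cdot> (pxk P \<otimes> \<one> (carr (pxB P))) \<cdot> pxx P = mult (pxB P) \<cdot> (\<one> (carr (pxB P)) \<otimes> pxk P)"
    "invertible C (px_f C S P)"
    "pxx P \<in> Ar C" "Dom C (pxx P) = carr (pxB P) \<odot> carr (pxY P)" "Cod C (pxx P) = carr (pxY P) \<odot> carr (pxB P)"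
  using assms by (auto simp: pre_x_obj_def Let_def distributive_law_def Hom_def)

lemma pre_x_morD:
  assumes "pre_x_mor C S \<phi>"
  shows "pre_x_obj C S (src \<phi>)" "pre_x_obj C S (tgt \<phi>)"
    "is_monoid_morphism C (pxB (src \<phi>)) (pxB (tgt \<phi>)) (base \<phi>)"
    "is_monoid_morphism C (pxY (src \<phi>)) (pxY (tgt \<phi>)) (top \<phi>)"
    "pxe (tgt \<phi>) \<cdot> top \<phi> = pxe (src \<phi>)"
    "pxk (tgt \<phi>) \<cdot> top \<phi> = base \<phi> \<cdot> pxk (src \<phi>)"
    "pxx (tgt \<phi>) \<cdot> (base \<phi> \<otimes> top \<phi>) = (top \<phi> \<otimes> base \<phi>) \<cdot> pxx (src \<phi>)"
  using assms by (auto simp: pre_x_mor_def Let_def)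

lemma category_PreX: "category (PreX C S)"
proof
  fix P assume "P \<in> Ob (PreX C S)"
  then have P: "pre_x_obj C S P" by (simp add: PreX_def)
  note D = pre_xD[OF P]
  note [simp] = monoid_type[OF D(1)] monoid_type[OF D(2)]
  show "Idt (PreX C S) P \<in> Hom (PreX C S) P P"
    using P monoid_morphism_ident[OF D(1)] monoid_morphism_ident[OF D(2)]
      monoid_morphism_type[OF D(3)] monoid_morphism_type[OF D(4)] D(11-13)
    by (simp add: PreX_def Hom_def pre_x_mor_def)
next
  fix \<phi> P P' \<psi> P''
  assume "\<phi> \<in> Hom (PreX C S) P P'" "\<psi> \<in> Hom (PreX C S) P' P''"
  then have mor: "pre_x_mor C S \<phi>" "pre_x_mor C S \<psi>"
    and [simp]: "src \<phi> = P" "tgt \<phi> = P'" "src \<psi> = P'" "tgt \<psi> = P''"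
    by (auto simp: PreX_def Hom_def)
  note \<phi> = pre_x_morD[OF mor(1), simplified] and \<psi> = pre_x_morD[OF mor(2), simplified]
  note D = pre_xD[OF \<phi>(1)] and D' = pre_xD[OF \<phi>(2)] and D'' = pre_xD[OF \<psi>(2)]
  note [simp] = monoid_morphism_type[OF \<phi>(3)] monoid_morphism_type[OF \<phi>(4)]
    monoid_morphism_type[OF \<psi>(3)] monoid_morphism_type[OF \<psi>(4)]
    monoid_morphism_type[OF D(4)] monoid_morphism_type[OF D'(4)] monoid_morphism_type[OF D''(4)]
    monoid_morphism_type[OF D''(3)] D(11-13) D'(11-13) D''(11-13)
  have "pxk P'' \<cdot> top \<psi> \<cdot> top \<phi> = (base \<psi> \<cdot> base \<phi>) \<cdot> pxk P"
    by (rule square_comp[OF \<phi>(6) \<psi>(6)]; simp)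
  moreover have "pxx P'' \<cdot> ((base \<psi> \<cdot> base \<phi>) \<otimes> (top \<psi> \<cdot> top \<phi>)) = ((top \<psi> \<cdot> top \<phi>) \<otimes> (base \<psi> \<cdot> base \<phi>)) \<cdot> pxx P"
    using square_comp[OF \<phi>(7) \<psi>(7)] by (simp add: merge)
  moreover have "pxe P'' \<cdot> top \<psi> \<cdot> top \<phi> = pxe P"
    using comp_cong_tail[OF \<psi>(5), of "top \<phi>"] by (simp add: \<phi>(5))
  ultimately show "Cmp (PreX C S) \<psi> \<phi> \<in> Hom (PreX C S) P P''"
    using \<phi>(1) \<psi>(2) monoid_morphism_comp[OF D(1) D'(1) D''(1) \<phi>(3) \<psi>(3)]
      monoid_morphism_comp[OF D(2) D'(2) D''(2) \<phi>(4) \<psi>(4)]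
    by (simp add: PreX_def Hom_def pre_x_mor_def pair_comp_def)
next
  fix \<phi> P P' assume "\<phi> \<in> Hom (PreX C S) P P'"
  then have mor: "pre_x_mor C S \<phi>" and [simp]: "src \<phi> = P" "tgt \<phi> = P'"
    by (auto simp: PreX_def Hom_def)
  note \<phi> = pre_x_morD[OF mor, simplified]
  note [simp] = monoid_morphism_type[OF \<phi>(3)] monoid_morphism_type[OF \<phi>(4)]
  show "Cmp (PreX C S) (Idt (PreX C S) P') \<phi> = \<phi>" "Cmp (PreX C S) \<phi> (Idt (PreX C S) P) = \<phi>"
    by (auto simp: PreX_def pair_comp_def)
next
  fix \<phi> P P' \<psi> P'' \<chi> P'''
  assume "\<phi> \<in> Hom (PreX C S) P P'" "\<psi> \<in> Hom (PreX C S) P' P''" "\<chi> \<in> Hom (PreX C S) P'' P'''"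
  then have mor: "pre_x_mor C S \<phi>" "pre_x_mor C S \<psi>" "pre_x_mor C S \<chi>"
    and [simp]: "src \<phi> = P" "tgt \<phi> = P'" "src \<psi> = P'" "tgt \<psi> = P''" "src \<chi> = P''" "tgt \<chi> = P'''"
    by (auto simp: PreX_def Hom_def)
  note \<phi> = pre_x_morD[OF mor(1), simplified] and \<psi> = pre_x_morD[OF mor(2), simplified]
    and \<chi> = pre_x_morD[OF mor(3), simplified]
  show "Cmp (PreX C S) (Cmp (PreX C S) \<chi> \<psi>) \<phi> = Cmp (PreX C S) \<chi> (Cmp (PreX C S) \<psi> \<phi>)"
    using monoid_morphism_type[OF \<phi>(3)] monoid_morphism_type[OF \<phi>(4)]
      monoid_morphism_type[OF \<psi>(3)] monoid_morphism_type[OF \<psi>(4)]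
      monoid_morphism_type[OF \<chi>(3)] monoid_morphism_type[OF \<chi>(4)]
    by (simp add: PreX_def pair_comp_def)
qed (auto simp: PreX_def dest: pre_x_morD)

lemma square_inverse:
  assumes "h' \<cdot> f = g \<cdot> h" "invertible C f" "invertible C g" "h \<in> Ar C" "h' \<in> Ar C"
    "Dom C h = Dom C f" "Dom C h' = Cod C f" "Cod C h = Dom C g" "Cod C h' = Cod C g"
  shows "h \<cdot> inv_arrow C f = inv_arrow C g \<cdot> h'"
proof (rule cancel_left_iso[OF assms(3)])
  note [simp] = inv_arrow_type[OF assms(2)] inv_arrow_type[OF assms(3)] inv_arrow_comp[OF assms(2)]
    inv_arrow_comp_assoc[OF assms(3)] invertible_in_Ar[OF assms(2)] invertible_in_Ar[OF assms(3)]
  have "g \<cdot> h \<cdot> inv_arrow C f = (h' \<cdot> f) \<cdot> inv_arrow C f"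
    unfolding assms(1) using assms(4-) by simp
  then show "g \<cdot> h \<cdot> inv_arrow C f = g \<cdot> inv_arrow C g \<cdot> h'"
    using assms(4-) by simp
qed (use assms in \<open>simp_all add: inv_arrow_type invertible_in_Ar\<close>)

lemma invertible_ReflGraphMon:
  assumes mor: "refl_graph_mon_mor C S \<phi>" and b: "invertible C (base \<phi>)" and a: "invertible C (top \<phi>)"
  shows "invertible (ReflGraphMon C S) \<phi>"
proof -
  note \<phi> = refl_graph_morD[OF mor]
  note D = refl_graphD[OF \<phi>(1)] and D' = refl_graphD[OF \<phi>(2)]
  note [simp] = monoid_morphism_type[OF \<phi>(3)] monoid_morphism_type[OF \<phi>(4)]
    monoid_morphism_type[OF D(3)] monoid_morphism_type[OF D(4)] monoid_morphism_type[OF D(5)]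
    monoid_morphism_type[OF D'(3)] monoid_morphism_type[OF D'(4)] monoid_morphism_type[OF D'(5)]
  let ?\<psi> = "\<lparr>src = tgt \<phi>, tgt = src \<phi>, base = inv_arrow C (base \<phi>), top = inv_arrow C (top \<phi>)\<rparr>"
  have "refl_graph_mon_mor C S ?\<psi>"
    using \<phi>(1,2) monoid_morphism_inverse[OF D(1) D'(1) \<phi>(4) a] monoid_morphism_inverse[OF D(2) D'(2) \<phi>(3) b]
      square_inverse[OF \<phi>(5) a b] square_inverse[OF \<phi>(6) a b] square_inverse[OF \<phi>(7) b a]
    by (simp add: refl_graph_mon_mor_def)
  then have "inverse_arrows (ReflGraphMon C S) \<phi> ?\<psi>"
    using mor inv_arrow_comp[OF a] inv_arrow_comp[OF b]
    by (auto simp: inverse_arrows_def ReflGraphMon_def Hom_def pair_comp_def)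
  then show ?thesis by (auto simp: invertible_def)
qed

end

section \<open>Relative pullbacks along unit morphisms\<close>

context category
begin

lemma rel_pullback_cone:
  assumes "is_rel_pullback C S f g p e" "S \<subseteq> spans C"
  shows "(p, e) \<in> S" "p \<in> Ar C" "e \<in> Ar C" "Dom C e = Dom C p"
    "Cod C p = Dom C f" "Cod C e = Dom C g" "f \<cdot> p = g \<cdot> e"
    "f \<in> Ar C" "g \<in> Ar C" "Cod C f = Cod C g"
proof -
  show pe: "(p, e) \<in> S" and "Cod C p = Dom C f" "Cod C e = Dom C g" "f \<cdot> p = g \<cdot> e"
    "f \<in> Ar C" "g \<in> Ar C" "Cod C f = Cod C g"
    using assms(1) unfolding is_rel_pullback_def is_cospan_def by blast+
  then have "(p, e) \<in> spans C" using assms(2) by blast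
  then show "p \<in> Ar C" "e \<in> Ar C" "Dom C e = Dom C p" by (simp_all add: spans_def)
qed

lemma rel_pullback_lift:
  assumes pb: "is_rel_pullback C S f g p e" and S: "S \<subseteq> spans C"
    and "(a, d) \<in> S" "Cod C a = Dom C f" "Cod C d = Dom C g" "f \<cdot> a = g \<cdot> d"
  obtains h where "h \<in> Ar C" "Dom C h = Dom C a" "Cod C h = Dom C p" "p \<cdot> h = a" "e \<cdot> h = d"
proof -
  have "\<exists>!h. h \<in> Hom C (Dom C a) (Dom C p) \<and> p \<cdot> h = a \<and> e \<cdot> h = d"
    using pb assms(3-) unfolding is_rel_pullback_def by blast
  with that show thesis by (auto simp: Hom_def)
qed

text \<open>
  Uniqueness in the universal property concerns spans of the class; the span obtained by composing
  the projections with \<open>h\<close> belongs to it by closure under precomposition.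
\<close>

lemma rel_pullback_jointly_monic:
  assumes pb: "is_rel_pullback C S f g p e" and adm: "admissible C S"
    and h: "h \<in> Ar C" "Cod C h = Dom C p" and k: "k \<in> Ar C" "Cod C k = Dom C p" "Dom C k = Dom C h"
    and "p \<cdot> h = p \<cdot> k" "e \<cdot> h = e \<cdot> k"
  shows "h = k"
proof -
  have S: "S \<subseteq> spans C" using adm by (simp add: admissible_def)
  note cone = rel_pullback_cone[OF pb S]
  have "(p \<cdot> h, e \<cdot> h) \<in> S"
    using adm cone h unfolding admissible_def by blast
  moreover have "f \<cdot> p \<cdot> h = g \<cdot> e \<cdot> h"
    using comp_cong_tail[OF cone(7) cone(8,2), of h] cone(2-6,8,9) h by simp
  moreover have "Cod C (p \<cdot> h) = Dom C f" "Cod C (e \<cdot> h) = Dom C g" and dom: "Dom C (p \<cdot> h) = Dom C h"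
    using cone(2-6) h by simp_all
  ultimately have "\<exists>!l. l \<in> Hom C (Dom C (p \<cdot> h)) (Dom C p) \<and> p \<cdot> l = p \<cdot> h \<and> e \<cdot> l = e \<cdot> h"
    using pb unfolding is_rel_pullback_def by blast
  then have unique: "l = l'" if "l \<in> Hom C (Dom C h) (Dom C p)" "p \<cdot> l = p \<cdot> h" "e \<cdot> l = e \<cdot> h"
      "l' \<in> Hom C (Dom C h) (Dom C p)" "p \<cdot> l' = p \<cdot> h" "e \<cdot> l' = e \<cdot> h" for l l'
    using that unfolding dom by blast
  show ?thesis
    by (rule unique) (use h k assms(8,9) in \<open>simp_all add: Hom_def\<close>)
qed

end

locale span_class = monoidal_category C
  for C :: "('o, 'a) mcat" (structure) +
  fixes S :: "('a \<times> 'a) set"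
  assumes admissible: "admissible C S"
    and monoidal: "monoidal_class C S"
    and pullback_exists: "\<lbrakk>is_cospan C f g; legs_in C S f g\<rbrakk> \<Longrightarrow> \<exists>p e. is_rel_pullback C S f g p e"
begin

lemma S_spans: "S \<subseteq> spans C"
  using admissible by (simp add: admissible_def)

lemma span_type: "(f, g) \<in> S \<Longrightarrow> f \<in> Ar C \<and> g \<in> Ar C \<and> Dom C g = Dom C f"
  using S_spans by (auto simp: spans_def)

lemma span_post:
  "\<lbrakk>(f, g) \<in> S; f' \<in> Ar C; Dom C f' = Cod C f; g' \<in> Ar C; Dom C g' = Cod C g\<rbrakk> \<Longrightarrow> (f' \<cdot> f, g' \<cdot> g) \<in> S"
  using admissible unfolding admissible_def by blast

lemma span_pre: "\<lbrakk>(f, g) \<in> S; h \<in> Ar C; Cod C h = Dom C f\<rbrakk> \<Longrightarrow> (f \<cdot> h, g \<cdot> h) \<in> S"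
  using admissible unfolding admissible_def by blast

lemma span_post_ident:
  assumes "(\<one> X, g) \<in> S" "X \<in> Ob C" "f \<in> Ar C" "Dom C f = X"
  shows "(f, g) \<in> S"
  using span_post[OF assms(1), of f "\<one> (Cod C g)"] span_type[OF assms(1)] assms by simp

lemma span_unit: "(\<one> I, \<one> I) \<in> S"
  using monoidal by (simp add: monoidal_class_def)

lemma span_ten: "\<lbrakk>(f, g) \<in> S; (f', g') \<in> S\<rbrakk> \<Longrightarrow> (f \<otimes> f', g \<otimes> g') \<in> S"
  using monoidal unfolding monoidal_class_def by blast

text \<open>
  By unitality and closure under precomposition.  This is what makes reflection applicable to the
  projection of a pullback along a unit morphism onto the unit object.
\<close>

lemma span_over_unit:
  assumes "e \<in> Ar C" "Cod C e = I"
  shows "(e, e) \<in> S"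
  using span_pre[OF span_unit, of e] assms by simp

lemma rel_pullback_along_unit:
  assumes "(\<one> (Dom C s), s) \<in> S" "u \<in> Ar C" "Dom C u = I" "Cod C u = Cod C s"
  shows "is_rel_pullback C S s u (proj_left C S s u) (proj_right C S s u)"
proof -
  have s: "s \<in> Ar C" using span_type[OF assms(1)] by simp
  have "(u, \<one> I) \<in> S"
    using span_post[OF span_unit, of u "\<one> I"] assms by simp
  then have "\<exists>p e. is_rel_pullback C S s u p e"
    using assms s by (intro pullback_exists) (auto simp: is_cospan_def legs_in_def)
  then have "\<exists>p. is_rel_pullback C S s u (fst p) (snd p)" by auto
  then show ?thesis
    unfolding proj_left_def proj_right_def rel_pullback_def by (rule someI_ex)
qed

text \<open>
  Multiplication and unit are induced by the universal property from those of \<open>A\<close> and \<open>I\<close>; the spans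
  to be lifted lie in the class by multiplicativity and unitality, and the axioms hold because
  the projections are jointly monic.
\<close>

lemma pullback_monoid:
  assumes A: "is_monoid C MA" and B: "is_monoid C MB" and s: "is_monoid_morphism C MA MB s"
    and pb: "is_rel_pullback C S s (unit MB) p e"
  obtains MY where "is_monoid C MY" "carr MY = Dom C p"
    "is_monoid_morphism C MY MA p" "is_monoid_morphism C MY (trivial_monoid C) e"
proof -
  let ?T = "trivial_monoid C"
  have T: "is_monoid C ?T" by (rule trivial_monoid)
  have [simp]: "carr ?T = I" "unit ?T = \<one> I" by (simp_all add: trivial_monoid_def)
  note cone = rel_pullback_cone[OF pb S_spans]
  note [simp] = monoid_type[OF A] monoid_type[OF B] monoid_type[OF T] monoid_morphism_type[OF s] cone(2-6) A B T
  define Y where "Y = Dom C p"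
  have [simp]: "Y \<in> Ob C" "Dom C p = Y" by (simp_all add: Y_def)
  have u: "unit MB \<star>\<^bsub>MB\<^esub> unit MB = unit MB \<cdot> mult ?T"
    by (simp add: star_unit trivial_monoid_def lunit_eq_runit)
  have "(p \<star>\<^bsub>MA\<^esub> p, e \<star>\<^bsub>?T\<^esub> e) \<in> S"
    unfolding star_def using span_ten[OF cone(1) cone(1)] by (rule span_post) simp_all
  moreover have "s \<cdot> (p \<star>\<^bsub>MA\<^esub> p) = unit MB \<cdot> (e \<star>\<^bsub>?T\<^esub> e)"
  proof -
    have "s \<cdot> (p \<star>\<^bsub>MA\<^esub> p) = (unit MB \<star>\<^bsub>MB\<^esub> unit MB) \<cdot> (e \<otimes> e)"
      by (simp add: monoid_morphism_star[OF s] cone(7) star_comp)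
    also have "\<dots> = unit MB \<cdot> (e \<star>\<^bsub>?T\<^esub> e)"
      unfolding u by (simp add: star_def)
    finally show ?thesis .
  qed
  ultimately obtain m where m: "m \<in> Ar C" "Dom C m = Y \<odot> Y" "Cod C m = Y"
    and pm: "p \<cdot> m = p \<star>\<^bsub>MA\<^esub> p" and em: "e \<cdot> m = e \<star>\<^bsub>?T\<^esub> e"
    using rel_pullback_lift[OF pb S_spans, of "p \<star>\<^bsub>MA\<^esub> p" "e \<star>\<^bsub>?T\<^esub> e"] by auto
  have "(unit MA, \<one> I) \<in> S"
    using span_post[OF span_unit, of "unit MA" "\<one> I"] by simp
  then obtain v where v: "v \<in> Ar C" "Dom C v = I" "Cod C v = Y"
    and pv: "p \<cdot> v = unit MA" and ev: "e \<cdot> v = \<one> I"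
    using rel_pullback_lift[OF pb S_spans, of "unit MA" "\<one> I"] by (auto simp: monoid_morphism_unit[OF s])
  note [simp] = m v
  have tail: "p \<cdot> m \<cdot> k = (p \<star>\<^bsub>MA\<^esub> p) \<cdot> k" "e \<cdot> m \<cdot> k = (e \<star>\<^bsub>?T\<^esub> e) \<cdot> k"
    if "k \<in> Ar C" "Cod C k = Y \<odot> Y" for k
    using comp_cong_tail[OF pm, of k] comp_cong_tail[OF em, of k] that by simp_all
  note monic = rel_pullback_jointly_monic[OF pb admissible]
  define MY where "MY = \<lparr>carr = Y, mult = m, unit = v\<rparr>"
  have "m \<cdot> (m \<otimes> \<one> Y) = m \<cdot> (\<one> Y \<otimes> m) \<cdot> \<a> Y Y Y"
    by (rule monic) (use star_assoc[OF A, of p p p] star_assoc[OF T, of e e e] in \<open>simp_all add: tail star_comp star_comp_tail pm em\<close>)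
  moreover have "m \<cdot> (v \<otimes> \<one> Y) = \<l> Y"
    by (rule monic) (use star_unit(1)[OF A, of p] star_unit(1)[OF T, of e] in \<open>simp_all add: tail star_comp pv ev\<close>)
  moreover have "m \<cdot> (\<one> Y \<otimes> v) = \<r> Y"
    by (rule monic) (use star_unit(2)[OF A, of p] star_unit(2)[OF T, of e] in \<open>simp_all add: tail star_comp pv ev\<close>)
  ultimately have "is_monoid C MY"
    by (simp add: is_monoid_def MY_def Hom_def)
  moreover have "is_monoid_morphism C MY MA p" "is_monoid_morphism C MY ?T e"
    by (auto intro!: monoid_morphismI simp: MY_def pm pv em ev)
  ultimately show thesis
    by (intro that[of MY]) (simp_all add: MY_def)
qed

end

section \<open>From pre-crossed modules to reflexive graphs\<close>

text \<open>
  The data of a pre-crossed module without the invertibility of the comparison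
  \<open>f : Y \<rightarrow> (Y \<otimes> B) \<box>\<^sub>B I\<close>.  It is separated because, when a pre-crossed module is built from a
  reflexive graph, the invertibility of \<open>f\<close> is established with the help of the composite monoid of
  these data.
\<close>

locale pre_crossed = span_class C S + distributive_monoids C "pxB P" "pxY P" "pxx P"
  for C :: "('o, 'a) mcat" (structure) and S and P :: "('o, 'a) pre_x" +
  assumes counit: "is_monoid_morphism C (pxY P) (trivial_monoid C) (pxe P)"
    and boundary: "is_monoid_morphism C (pxY P) (pxB P) (pxk P)"
    and span_Y: "(\<one> (carr (pxY P)), pxe P) \<in> S"
    and span_B: "(\<one> (carr (pxB P)), \<one> (carr (pxB P))) \<in> S"
    and counit_law: "px_e1 C P \<cdot> pxx P = \<r> (carr (pxB P)) \<cdot> (\<one> (carr (pxB P)) \<otimes> pxe P)"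
    and boundary_law: "mult (pxB P) \<cdot> (pxk P \<otimes> \<one> (carr (pxB P))) \<cdot> pxx P = mult (pxB P) \<cdot> (\<one> (carr (pxB P)) \<otimes> pxk P)"
begin

abbreviation "MB \<equiv> pxB P"
abbreviation "MY \<equiv> pxY P"
abbreviation "e \<equiv> pxe P"
abbreviation "k \<equiv> pxk P"
abbreviation "x \<equiv> pxx P"
abbreviation "e1 \<equiv> px_e1 C P"
abbreviation "p \<equiv> proj_left C S e1 (unit MB)"
abbreviation "p' \<equiv> proj_right C S e1 (unit MB)"

lemma counit_type [simp]: "e \<in> Ar C" "Dom C e = Y" "Cod C e = I"
  using monoid_morphism_type[OF counit] by (simp_all add: trivial_monoid_def)

lemmas [simp] = monoid_morphism_type[OF boundary]

lemma e1_type [simp]: "e1 \<in> Ar C" "Dom C e1 = A" "Cod C e1 = B"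
  by (simp_all add: px_e1_def)

lemma unit_morphism: "is_monoid_morphism C (trivial_monoid C) MB (unit MB)"
  by (rule monoid_morphismI) (simp_all add: trivial_monoid_def star_unit[OF MB] lunit_eq_runit)

text \<open>
  Writing \<open>e \<otimes> 1\<close> as a pointwise product exhibits it as a copairing: it is trivial on \<open>Y\<close> and the
  identity on \<open>B\<close>.  Similarly, the target morphism is the boundary \<open>k\<close> on \<open>Y\<close> and the identity on
  \<open>B\<close>.  The conditions relating \<open>x\<close> to \<open>e\<close> and \<open>k\<close> are the compatibilities required by
  \<open>copairing\<close>.
\<close>

lemma e1_eq_star: "e1 = (unit MB \<cdot> e) \<star>\<^bsub>MB\<^esub> \<one> B"
  using star_comp[OF MB, of "unit MB" "\<one> B" e "\<one> B"] by (simp add: star_unit[OF MB] px_e1_def)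

lemma source:
  shows "is_monoid_morphism C composite MB e1" and "e1 \<cdot> inY = unit MB \<cdot> e" and "e1 \<cdot> inB = \<one> B"
proof -
  have g: "is_monoid_morphism C MY MB (unit MB \<cdot> e)"
    by (rule monoid_morphism_comp[OF MY trivial_monoid MB counit unit_morphism])
  have "((unit MB \<cdot> e) \<star>\<^bsub>MB\<^esub> \<one> B) \<cdot> x = \<one> B \<star>\<^bsub>MB\<^esub> (unit MB \<cdot> e)"
    using counit_law star_comp[OF MB, of "\<one> B" "unit MB" "\<one> B" e]
    by (simp add: star_unit[OF MB] flip: e1_eq_star)
  from copairing[OF MB g monoid_morphism_ident[OF MB] this]
  show "is_monoid_morphism C composite MB e1" "e1 \<cdot> inY = unit MB \<cdot> e" "e1 \<cdot> inB = \<one> B"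
    by (simp_all flip: e1_eq_star)
qed

definition target where "target = mult MB \<cdot> (k \<otimes> \<one> B)"

lemma target_eq_star: "target = k \<star>\<^bsub>MB\<^esub> \<one> B"
  by (simp add: target_def star_def)

lemma target:
  shows "is_monoid_morphism C composite MB target" and "target \<cdot> inY = k" and "target \<cdot> inB = \<one> B"
proof -
  have "(k \<star>\<^bsub>MB\<^esub> \<one> B) \<cdot> x = \<one> B \<star>\<^bsub>MB\<^esub> k"
    using boundary_law by (simp add: star_def)
  from copairing[OF MB boundary monoid_morphism_ident[OF MB] this]
  show "is_monoid_morphism C composite MB target" "target \<cdot> inY = k" "target \<cdot> inB = \<one> B"
    by (simp_all add: target_eq_star)
qed

lemma span_A: "(\<one> A, e1) \<in> S"
  using span_post[OF span_ten[OF span_Y span_B], of "\<one> A" "\<l> B"] by (simp add: px_e1_def)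

lemma pullback: "is_rel_pullback C S e1 (unit MB) p p'"
  by (rule rel_pullback_along_unit) (simp_all add: span_A)

lemma pullback_type [simp]:
  "p \<in> Ar C" "Cod C p = A" "p' \<in> Ar C" "Dom C p' = Dom C p" "Cod C p' = I"
  using rel_pullback_cone[OF pullback S_spans] by simp_all

lemmas monic = rel_pullback_jointly_monic[OF pullback admissible]

lemma px_f: "px_f C S P \<in> Ar C" "Dom C (px_f C S P) = Y" "Cod C (px_f C S P) = Dom C p"
  "p \<cdot> px_f C S P = inY" "p' \<cdot> px_f C S P = e"
proof -
  have "(inY, e) \<in> S" by (rule span_post_ident[OF span_Y]) simp_all
  then obtain f where f: "f \<in> Hom C Y (Dom C p) \<and> p \<cdot> f = inY \<and> p' \<cdot> f = e"
    using rel_pullback_lift[OF pullback S_spans, of inY e] source(2) by (auto simp: Hom_def)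
  have "px_f C S P = (THE f. f \<in> Hom C Y (Dom C p) \<and> p \<cdot> f = inY \<and> p' \<cdot> f = e)"
    by (simp add: px_f_def inY_def pullback_obj_def Let_def)
  also have "\<dots> = f"
  proof (rule the_equality, rule f)
    fix g assume "g \<in> Hom C Y (Dom C p) \<and> p \<cdot> g = inY \<and> p' \<cdot> g = e"
    then show "g = f" using f by (intro monic[of g f]) (simp_all add: Hom_def)
  qed
  finally show "px_f C S P \<in> Ar C" "Dom C (px_f C S P) = Y" "Cod C (px_f C S P) = Dom C p"
    "p \<cdot> px_f C S P = inY" "p' \<cdot> px_f C S P = e"
    using f by (auto simp: Hom_def)
qed

text \<open>
  Invertibility of \<open>f\<close> says that \<open>Y\<close> itself is the pullback, with projections \<open>inY\<close> and \<open>e\<close>.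
\<close>

lemma inY_jointly_monic:
  assumes inv: "invertible C (px_f C S P)" and g: "g \<in> Ar C" "Cod C g = Y"
    and h: "h \<in> Ar C" "Cod C h = Y" "Dom C h = Dom C g"
    and "inY \<cdot> g = inY \<cdot> h" "e \<cdot> g = e \<cdot> h"
  shows "g = h"
proof (rule cancel_left_iso[OF inv])
  have f: "p \<cdot> px_f C S P \<cdot> l = inY \<cdot> l" "p' \<cdot> px_f C S P \<cdot> l = e \<cdot> l"
    if "l \<in> Ar C" "Cod C l = Y" for l
    using comp_cong_tail[OF px_f(4), of l] comp_cong_tail[OF px_f(5), of l] that
    by (simp_all add: px_f(1-3))
  show "px_f C S P \<cdot> g = px_f C S P \<cdot> h"
  proof (rule monic)
    show "p \<cdot> px_f C S P \<cdot> g = p \<cdot> px_f C S P \<cdot> h" "p' \<cdot> px_f C S P \<cdot> g = p' \<cdot> px_f C S P \<cdot> h"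
      unfolding f[OF g] f[OF h(1,2)] by (rule assms)+
  qed (use g h px_f in simp_all)
qed (use g h px_f in simp_all)

definition graph where
  "graph = \<lparr>rgB = MB, rgA = composite, rgi = inB, rgs = e1, rgt = target\<rparr>"

lemma graph_simps [simp]:
  "rgB graph = MB" "rgA graph = composite" "rgi graph = inB" "rgs graph = e1" "rgt graph = target"
  by (simp_all add: graph_def)

text \<open>
  Since \<open>p \<circ> f = inY\<close>, one has \<open>q \<circ> (f \<otimes> 1) = inY \<star> inB = 1\<close>, so \<open>q\<close> is the inverse of \<open>f \<otimes> 1\<close>.
\<close>

lemma graph_obj:
  assumes "invertible C (px_f C S P)"
  shows "refl_graph_mon_obj C S graph"
proof -
  let ?f = "px_f C S P" and ?q = "rg_q C S graph"
  have q: "?q = p \<star>\<^bsub>composite\<^esub> inB"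
    by (simp add: rg_q_def star_def)
  have fB: "inverse_arrows C (?f \<otimes> \<one> B) (inv_arrow C ?f \<otimes> \<one> B)"
    using inv_arrow_inverse[OF assms] by (intro inverse_arrows_ten) (auto simp: inverse_arrows_def Hom_def)
  have qf: "?q \<cdot> (?f \<otimes> \<one> B) = \<one> A"
    by (simp add: q px_f star_comp composite_monoid inY_star_inB)
  have "?q = ?q \<cdot> (?f \<otimes> \<one> B) \<cdot> (inv_arrow C ?f \<otimes> \<one> B)"
    using fB by (simp add: q inverse_arrows_def composite_monoid px_f)
  also have "\<dots> = inv_arrow C ?f \<otimes> \<one> B"
    using comp_cong_tail[OF qf, of "inv_arrow C ?f \<otimes> \<one> B"] fB
    by (simp add: q composite_monoid px_f inverse_arrows_def inv_arrow_type[OF assms])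
  finally have "invertible C ?q"
    using fB by (auto simp: invertible_def inverse_arrows_def Hom_def px_f intro!: exI[of _ "?f \<otimes> \<one> B"])
  then show ?thesis
    using composite_monoid MB inB_morphism source target span_A
    by (simp add: refl_graph_mon_obj_def refl_graph_of_monoids_def)
qed

end

context span_class
begin

lemma pre_crossedI: "pre_x_obj C S P \<Longrightarrow> pre_crossed C S P"
  by unfold_locales (simp_all add: pre_xD)

lemma pre_x_objI:
  assumes "pre_crossed C S P" "invertible C (px_f C S P)"
  shows "pre_x_obj C S P"
proof -
  interpret pre_crossed C S P by (rule assms)
  show ?thesis
    using MB MY law counit boundary span_Y span_B counit_law boundary_law assms(2)
    by (simp add: pre_x_obj_def Let_def)
qed

definition graph_mor :: "(('o, 'a) pre_x, 'a) pair_mor \<Rightarrow> (('o, 'a) refl_graph, 'a) pair_mor" where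
  "graph_mor \<phi> = \<lparr>src = pre_crossed.graph C (src \<phi>), tgt = pre_crossed.graph C (tgt \<phi>),
     base = base \<phi>, top = top \<phi> \<otimes> base \<phi>\<rparr>"

end

locale two_pre_crossed = P: pre_crossed C S P + P': pre_crossed C S P'
  for C :: "('o, 'a) mcat" (structure) and S and P P' :: "('o, 'a) pre_x"
begin

lemma ten_eq_star:
  assumes "y \<in> Ar C" "Cod C y = P'.Y" "b \<in> Ar C" "Cod C b = P'.B"
  shows "y \<otimes> b = (P'.inY \<cdot> y) \<star>\<^bsub>P'.composite\<^esub> (P'.inB \<cdot> b)"
  using P.star_comp[OF P'.composite_monoid, of P'.inY P'.inB y b] assms by (simp add: P'.inY_star_inB)

lemma
  assumes b: "is_monoid_morphism C P.MB P'.MB b" and y: "is_monoid_morphism C P.MY P'.MY y"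
    and e: "P'.e \<cdot> y = P.e" and k: "P'.k \<cdot> y = b \<cdot> P.k" and x: "P'.x \<cdot> (b \<otimes> y) = (y \<otimes> b) \<cdot> P.x"
  shows ten_morphism: "is_monoid_morphism C P.composite P'.composite (y \<otimes> b)"
    and ten_inY: "(y \<otimes> b) \<cdot> P.inY = P'.inY \<cdot> y"
    and ten_inB: "(y \<otimes> b) \<cdot> P.inB = P'.inB \<cdot> b"
    and ten_source: "P'.e1 \<cdot> (y \<otimes> b) = b \<cdot> P.e1"
    and ten_target: "P'.target \<cdot> (y \<otimes> b) = b \<cdot> P.target"
proof -
  note [simp] = P.monoid_morphism_type[OF b] P.monoid_morphism_type[OF y]
  have g: "is_monoid_morphism C P.MY P'.composite (P'.inY \<cdot> y)"
    by (rule P.monoid_morphism_comp[OF P.MY P'.MY P'.composite_monoid y P'.inY_morphism])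
  have h: "is_monoid_morphism C P.MB P'.composite (P'.inB \<cdot> b)"
    by (rule P.monoid_morphism_comp[OF P.MB P'.MB P'.composite_monoid b P'.inB_morphism])
  have yb: "y \<otimes> b = (P'.inY \<cdot> y) \<star>\<^bsub>P'.composite\<^esub> (P'.inB \<cdot> b)"
    by (rule ten_eq_star) simp_all
  have "((P'.inY \<cdot> y) \<star>\<^bsub>P'.composite\<^esub> (P'.inB \<cdot> b)) \<cdot> P.x = (P'.inB \<star>\<^bsub>P'.composite\<^esub> P'.inY) \<cdot> (b \<otimes> y)"
    by (simp add: x P'.inB_star_inY flip: yb)
  also have "\<dots> = (P'.inB \<cdot> b) \<star>\<^bsub>P'.composite\<^esub> (P'.inY \<cdot> y)"
    by (rule P.star_comp[OF P'.composite_monoid]) simp_all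
  finally have law: "((P'.inY \<cdot> y) \<star>\<^bsub>P'.composite\<^esub> (P'.inB \<cdot> b)) \<cdot> P.x = (P'.inB \<cdot> b) \<star>\<^bsub>P'.composite\<^esub> (P'.inY \<cdot> y)" .
  show "is_monoid_morphism C P.composite P'.composite (y \<otimes> b)" "(y \<otimes> b) \<cdot> P.inY = P'.inY \<cdot> y"
    "(y \<otimes> b) \<cdot> P.inB = P'.inB \<cdot> b"
    using P.copairing[OF P'.composite_monoid g h law] by (simp_all flip: yb)
  have eb: "P.e \<otimes> b = (\<one> P.I \<otimes> b) \<cdot> (P.e \<otimes> \<one> P.B)"
    by (simp add: P.interchange)
  have "P'.e1 \<cdot> (y \<otimes> b) = \<l> P'.B \<cdot> (P.e \<otimes> b)"
    by (simp add: px_e1_def P.interchange e)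
  also have "\<dots> = (\<l> P'.B \<cdot> (\<one> P.I \<otimes> b)) \<cdot> (P.e \<otimes> \<one> P.B)"
    by (simp add: eb)
  also have "\<dots> = b \<cdot> P.e1"
    by (simp add: px_e1_def P.unit_nat)
  finally show "P'.e1 \<cdot> (y \<otimes> b) = b \<cdot> P.e1" .
  show "P'.target \<cdot> (y \<otimes> b) = b \<cdot> P.target"
    by (simp add: P.target_eq_star P'.target_eq_star P.star_comp[OF P'.MB]
        P.monoid_morphism_star[OF b P.MB P'.MB] k)
qed

text \<open>
  The component \<open>y\<close> is the restriction of \<open>a\<close> to the kernel of the source morphism: \<open>a \<circ> inY\<close> factors
  through the pullback since \<open>a\<close> commutes with the sources.  Then \<open>a\<close> and \<open>y \<otimes> b\<close> agree because they
  agree on the two factors of the composite monoid.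
\<close>

lemma graph_full:
  assumes inv: "invertible C (px_f C S P')"
    and b: "is_monoid_morphism C P.MB P'.MB b" and a: "is_monoid_morphism C P.composite P'.composite a"
    and s: "P'.e1 \<cdot> a = b \<cdot> P.e1" and t: "P'.target \<cdot> a = b \<cdot> P.target" and i: "P'.inB \<cdot> b = a \<cdot> P.inB"
  obtains y where "is_monoid_morphism C P.MY P'.MY y" "P'.e \<cdot> y = P.e" "P'.k \<cdot> y = b \<cdot> P.k"
    "P'.x \<cdot> (b \<otimes> y) = (y \<otimes> b) \<cdot> P.x" "a = y \<otimes> b"
proof -
  note [simp] = P.monoid_morphism_type[OF b] P.monoid_morphism_type[OF a, simplified]
  have "(a \<cdot> P.inY, P.e) \<in> S"
    by (rule P.span_post_ident[OF P.span_Y]) simp_all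
  moreover have "P'.e1 \<cdot> a \<cdot> P.inY = unit P'.MB \<cdot> P.e"
  proof -
    have "P'.e1 \<cdot> a \<cdot> P.inY = b \<cdot> P.e1 \<cdot> P.inY"
      using P.comp_cong_tail[OF s, of P.inY] by simp
    also have "\<dots> = unit P'.MB \<cdot> P.e"
      using P.comp_cong_tail[OF P.monoid_morphism_unit[OF b], of P.e] by (simp add: P.source)
    finally show ?thesis .
  qed
  ultimately obtain h where h: "h \<in> Ar C" "Dom C h = P.Y" "Cod C h = Dom C P'.p"
      "P'.p \<cdot> h = a \<cdot> P.inY" "P'.p' \<cdot> h = P.e"
    using P.rel_pullback_lift[OF P'.pullback P.S_spans, of "a \<cdot> P.inY" P.e] by auto
  note f = P'.px_f
  note [simp] = h(1-3) f(1-3) P.inv_arrow_type[OF inv]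
  define y where "y = inv_arrow C (px_f C S P') \<cdot> h"
  have y_type [simp]: "y \<in> Ar C" "Dom C y = P.Y" "Cod C y = P'.Y"
    by (simp_all add: y_def)
  have fy: "px_f C S P' \<cdot> y = h"
    by (simp add: y_def P.inv_arrow_comp_assoc[OF inv])
  have inY: "P'.inY \<cdot> y = a \<cdot> P.inY"
    using P.comp_cong_tail[OF f(4), of y] by (simp add: fy h)
  have e: "P'.e \<cdot> y = P.e"
    using P.comp_cong_tail[OF f(5), of y] by (simp add: fy h)
  have y: "is_monoid_morphism C P.MY P'.MY y"
  proof (rule P.monoid_morphismI)
    have m1: "P'.inY \<cdot> y \<cdot> mult P.MY = P'.inY \<cdot> (y \<star>\<^bsub>P'.MY\<^esub> y)"
    proof -
      have "P'.inY \<cdot> y \<cdot> mult P.MY = a \<cdot> P.inY \<cdot> mult P.MY"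
        using P.comp_cong_tail[OF inY, of "mult P.MY"] by simp
      also have "\<dots> = (a \<cdot> P.inY) \<star>\<^bsub>P'.composite\<^esub> (a \<cdot> P.inY)"
        by (simp add: P.monoid_morphism_mult[OF P.inY_morphism] P.monoid_morphism_star[OF a P.composite_monoid P'.composite_monoid])
      also have "\<dots> = P'.inY \<cdot> (y \<star>\<^bsub>P'.MY\<^esub> y)"
        by (simp add: P.monoid_morphism_star[OF P'.inY_morphism P'.MY P'.composite_monoid] flip: inY)
      finally show ?thesis .
    qed
    have m2: "P'.e \<cdot> y \<cdot> mult P.MY = P'.e \<cdot> (y \<star>\<^bsub>P'.MY\<^esub> y)"
      using P.comp_cong_tail[OF e, of "mult P.MY"]
      by (simp add: P.monoid_morphism_mult[OF P.counit] P.monoid_morphism_star[OF P'.counit P'.MY P.trivial_monoid] e)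
    show "y \<cdot> mult P.MY = y \<star>\<^bsub>P'.MY\<^esub> y"
      by (rule P'.inY_jointly_monic[OF inv]) (simp_all add: m1 m2 P'.MY)
    have u1: "P'.inY \<cdot> y \<cdot> unit P.MY = P'.inY \<cdot> unit P'.MY"
      using P.comp_cong_tail[OF inY, of "unit P.MY"] P.monoid_morphism_unit[OF a] by simp
    have u2: "P'.e \<cdot> y \<cdot> unit P.MY = P'.e \<cdot> unit P'.MY"
      using P.comp_cong_tail[OF e, of "unit P.MY"] P.monoid_morphism_unit[OF P.counit]
        P.monoid_morphism_unit[OF P'.counit] by simp
    show "y \<cdot> unit P.MY = unit P'.MY"
      by (rule P'.inY_jointly_monic[OF inv]) (simp_all add: u1 u2)
  qed simp_all
  have k: "P'.k \<cdot> y = b \<cdot> P.k"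
  proof -
    have "P'.k \<cdot> y = P'.target \<cdot> a \<cdot> P.inY"
      using P.comp_cong_tail[OF P'.target(2), of y] P.monoid_morphism_type[OF P'.target(1)] by (simp add: inY)
    also have "\<dots> = b \<cdot> P.k"
      using P.comp_cong_tail[OF t, of P.inY] P.monoid_morphism_type[OF P'.target(1)]
        P.monoid_morphism_type[OF P.target(1)] by (simp add: P.target(2))
    finally show ?thesis .
  qed
  have a_eq: "a = y \<otimes> b"
    using P.morphism_eq_star[OF P'.composite_monoid a] ten_eq_star[of y b] by (simp add: inY i)
  have "P'.x \<cdot> (b \<otimes> y) = (P'.inB \<cdot> b) \<star>\<^bsub>P'.composite\<^esub> (P'.inY \<cdot> y)"
    using P.star_comp[OF P'.composite_monoid, of P'.inB P'.inY b y] by (simp add: P'.inB_star_inY)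
  also have "\<dots> = a \<cdot> P.x"
    using P.monoid_morphism_star[OF a P.composite_monoid P'.composite_monoid, of P.inB P.inY] by (simp add: i inY P.inB_star_inY)
  finally show thesis
    using that[OF y e k] a_eq by simp
qed

end

section \<open>The equivalence\<close>

context span_class
begin

lemma graph_mor_in:
  assumes "pre_x_mor C S \<phi>"
  shows "refl_graph_mon_mor C S (graph_mor \<phi>)"
proof -
  note \<phi> = pre_x_morD[OF assms]
  interpret two_pre_crossed C S "src \<phi>" "tgt \<phi>"
    by (intro two_pre_crossed.intro pre_crossedI \<phi>)
  show ?thesis
    using P.graph_obj[OF pre_xD(10)[OF \<phi>(1)]] P'.graph_obj[OF pre_xD(10)[OF \<phi>(2)]]
      \<phi>(3) ten_morphism[OF \<phi>(3-7)] ten_source[OF \<phi>(3-7)] ten_target[OF \<phi>(3-7)] ten_inB[OF \<phi>(3-7)]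
    by (simp add: refl_graph_mon_mor_def graph_mor_def)
qed

lemma graph_functor: "cat_functor (PreX C S) (ReflGraphMon C S) (pre_crossed.graph C) graph_mor"
proof (intro cat_functor.intro cat_functor_axioms.intro category_PreX category_ReflGraphMon)
  fix P assume "P \<in> Ob (PreX C S)"
  then have P: "pre_x_obj C S P" by (simp add: PreX_def)
  interpret pre_crossed C S P by (rule pre_crossedI[OF P])
  show "graph \<in> Ob (ReflGraphMon C S)"
    using graph_obj[OF pre_xD(10)[OF P]] by (simp add: ReflGraphMon_def)
  show "graph_mor (Idt (PreX C S) P) = Idt (ReflGraphMon C S) graph"
    by (simp add: graph_mor_def PreX_def ReflGraphMon_def)
next
  fix \<phi> P P' assume "\<phi> \<in> Hom (PreX C S) P P'"
  then show "graph_mor \<phi> \<in> Hom (ReflGraphMon C S) (pre_crossed.graph C P) (pre_crossed.graph C P')"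
    using graph_mor_in[of \<phi>] by (auto simp: PreX_def ReflGraphMon_def Hom_def graph_mor_def)
next
  fix \<phi> P P' \<psi> P''
  assume "\<phi> \<in> Hom (PreX C S) P P'" "\<psi> \<in> Hom (PreX C S) P' P''"
  then have mor: "pre_x_mor C S \<phi>" "pre_x_mor C S \<psi>" and [simp]: "tgt \<phi> = P'" "src \<psi> = P'"
    by (auto simp: PreX_def Hom_def)
  note \<phi> = pre_x_morD[OF mor(1), simplified] and \<psi> = pre_x_morD[OF mor(2), simplified]
  show "graph_mor (Cmp (PreX C S) \<psi> \<phi>) = Cmp (ReflGraphMon C S) (graph_mor \<psi>) (graph_mor \<phi>)"
    using monoid_morphism_type[OF \<phi>(3)] monoid_morphism_type[OF \<phi>(4)]
      monoid_morphism_type[OF \<psi>(3)] monoid_morphism_type[OF \<psi>(4)]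
    by (simp add: PreX_def ReflGraphMon_def pair_comp_def graph_mor_def interchange)
qed

lemma graph_functor_full:
  assumes P: "pre_x_obj C S P" and P': "pre_x_obj C S P'"
    and \<psi>: "\<psi> \<in> Hom (ReflGraphMon C S) (pre_crossed.graph C P) (pre_crossed.graph C P')"
  shows "\<exists>\<phi> \<in> Hom (PreX C S) P P'. graph_mor \<phi> = \<psi>"
proof -
  interpret two_pre_crossed C S P P'
    by (intro two_pre_crossed.intro pre_crossedI P P')
  have mor: "refl_graph_mon_mor C S \<psi>" and [simp]: "src \<psi> = P.graph" "tgt \<psi> = P'.graph"
    using \<psi> by (auto simp: ReflGraphMon_def Hom_def)
  note D = refl_graph_morD[OF mor, simplified]
  obtain y where y: "is_monoid_morphism C P.MY P'.MY y" "P'.e \<cdot> y = P.e" "P'.k \<cdot> y = base \<psi> \<cdot> P.k"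
    "P'.x \<cdot> (base \<psi> \<otimes> y) = (y \<otimes> base \<psi>) \<cdot> P.x" "top \<psi> = y \<otimes> base \<psi>"
    using graph_full[OF pre_xD(10)[OF P'] D(3-7)] by blast
  let ?\<phi> = "\<lparr>src = P, tgt = P', base = base \<psi>, top = y\<rparr>"
  have "?\<phi> \<in> Hom (PreX C S) P P'"
    using P P' D(3) y(1-4) by (simp add: PreX_def Hom_def pre_x_mor_def)
  moreover have "graph_mor ?\<phi> = \<psi>"
    using y(5) by (simp add: graph_mor_def)
  ultimately show ?thesis by blast
qed

lemma graph_functor_faithful:
  assumes "\<phi> \<in> Hom (PreX C S) P P'" "\<psi> \<in> Hom (PreX C S) P P'" and eq: "graph_mor \<phi> = graph_mor \<psi>"
  shows "\<phi> = \<psi>"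
proof -
  have mor: "pre_x_mor C S \<phi>" "pre_x_mor C S \<psi>"
    and st [simp]: "src \<phi> = P" "tgt \<phi> = P'" "src \<psi> = P" "tgt \<psi> = P'"
    using assms by (auto simp: PreX_def Hom_def)
  note \<phi> = pre_x_morD[OF mor(1), simplified] and \<psi> = pre_x_morD[OF mor(2), simplified]
  interpret two_pre_crossed C S P P'
    by (intro two_pre_crossed.intro pre_crossedI \<phi>)
  have base: "base \<phi> = base \<psi>" and "top \<phi> \<otimes> base \<phi> = top \<psi> \<otimes> base \<psi>"
    using arg_cong[OF eq, of base] arg_cong[OF eq, of pair_mor.top] by (simp_all add: graph_mor_def)
  then have "P'.inY \<cdot> top \<phi> = P'.inY \<cdot> top \<psi>"
    using ten_inY[OF \<phi>(3-7)] ten_inY[OF \<psi>(3-7)] by metis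
  moreover have "P'.e \<cdot> top \<phi> = P'.e \<cdot> top \<psi>"
    using \<phi>(5) \<psi>(5) by simp
  ultimately have "top \<phi> = top \<psi>"
    using P'.inY_jointly_monic[OF pre_xD(10)[OF \<phi>(2)], of "top \<phi>" "top \<psi>"]
      monoid_morphism_type[OF \<phi>(4)] monoid_morphism_type[OF \<psi>(4)] by metis
  with base st show ?thesis by (intro pair_mor.equality) simp_all
qed

text \<open>
  Given a graph, put \<open>Y = A \<box>\<^sub>B I\<close> with \<open>e\<close> its second projection, \<open>k = t \<circ> p\<close>, and
  \<open>x = q\<^sup>-\<^sup>1 \<circ> (i \<star> p)\<close>.  The isomorphism \<open>q = p \<star> i\<close> is then a copairing \<open>Y \<otimes> B \<rightarrow> A\<close>, hence a
  monoid morphism, and \<open>s \<circ> q = e \<otimes> 1\<close>.  As \<open>q\<close> is an isomorphism over \<open>B\<close>, it identifies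
  \<open>(Y \<otimes> B) \<box>\<^sub>B I\<close> with \<open>A \<box>\<^sub>B I = Y\<close>, which inverts the comparison \<open>f\<close>.
\<close>

lemma graph_functor_essentially_surjective:
  assumes G: "refl_graph_mon_obj C S G"
  shows "\<exists>P. pre_x_obj C S P \<and>
    (\<exists>\<phi> \<in> Hom (ReflGraphMon C S) (pre_crossed.graph C P) G. invertible (ReflGraphMon C S) \<phi>)"
proof -
  define MA MB i s t where "MA = rgA G" "MB = rgB G" "i = rgi G" "s = rgs G" "t = rgt G"
  note defs = this
  note D = refl_graphD[OF G, folded defs]
  note A = D(1) and B = D(2)
  define p e q where "p = proj_left C S s (unit MB)" "e = proj_right C S s (unit MB)" "q = rg_q C S G"
  note defs' = this
  note [simp] = monoid_type[OF A] monoid_type[OF B] monoid_morphism_type[OF D(3)]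
    monoid_morphism_type[OF D(4)] monoid_morphism_type[OF D(5)] A B
  have pb: "is_rel_pullback C S s (unit MB) p e"
    unfolding defs' using D(8) by (intro rel_pullback_along_unit) simp_all
  note cone = rel_pullback_cone[OF pb S_spans]
  note [simp] = cone(2-6)
  obtain MY where Y: "is_monoid C MY" and Y_carr: "carr MY = Dom C p"
    and p: "is_monoid_morphism C MY MA p" and e: "is_monoid_morphism C MY (trivial_monoid C) e"
    by (rule pullback_monoid[OF A B D(4) pb])
  note [simp] = Y monoid_type[OF Y]
  have [simp]: "Dom C p = carr MY" by (simp add: Y_carr)
  have q_def': "q = p \<star>\<^bsub>MA\<^esub> i"
    by (simp add: rg_q_def star_def defs defs')
  have q: "invertible C q" using D(9) by (simp add: defs')
  note [simp] = inv_arrow_type[OF q]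
  have q_type [simp]: "q \<in> Ar C" "Dom C q = carr MY \<odot> carr MB" "Cod C q = carr MA"
    by (simp_all add: q_def')
  define x where "x = inv_arrow C q \<cdot> (i \<star>\<^bsub>MA\<^esub> p)"
  have x_type: "x \<in> Ar C" "Dom C x = carr MB \<odot> carr MY" "Cod C x = carr MY \<odot> carr MB"
    by (simp_all add: x_def)
  note [simp] = x_type
  have qx: "q \<cdot> x = i \<star>\<^bsub>MA\<^esub> p"
    by (simp add: x_def inv_arrow_comp_assoc[OF q])
  have law: "distributive_law C MB MY x"
    by (rule distributive_law_of_factorization[OF A B Y D(3) p])
      (use q qx in \<open>simp_all add: q_def'\<close>)
  define P where "P = \<lparr>pxB = MB, pxY = MY, pxe = e, pxk = t \<cdot> p, pxx = x\<rparr>"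
  have P [simp]: "pxB P = MB" "pxY P = MY" "pxe P = e" "pxk P = t \<cdot> p" "pxx P = x"
    by (simp_all add: P_def)
  have sq: "s \<cdot> q = px_e1 C P"
  proof -
    have "s \<cdot> q = (unit MB \<star>\<^bsub>MB\<^esub> \<one> (carr MB)) \<cdot> (e \<otimes> \<one> (carr MB))"
      by (simp add: q_def' monoid_morphism_star[OF D(4) A B] cone(7) D(6) star_comp)
    then show ?thesis by (simp add: star_unit px_e1_def)
  qed
  have tq: "t \<cdot> q = (t \<cdot> p) \<star>\<^bsub>MB\<^esub> \<one> (carr MB)"
    by (simp add: q_def' monoid_morphism_star[OF D(5) A B] D(7))
  have "pre_crossed C S P"
  proof (unfold_locales, unfold P)
    show "is_monoid C MB" "is_monoid C MY" "distributive_law C MB MY x"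
      "is_monoid_morphism C MY (trivial_monoid C) e"
      by (rule B Y law e)+
    show "is_monoid_morphism C MY MB (t \<cdot> p)"
      by (rule monoid_morphism_comp[OF Y A B p D(5)])
    \<comment> \<open>reflection, applied to the identity of \<open>Y\<close>\<close>
    have "(p \<cdot> \<one> (carr MY), e) \<in> S" "(e \<cdot> \<one> (carr MY), e) \<in> S"
      using cone(1) span_over_unit[of e] by simp_all
    then show "(\<one> (carr MY), e) \<in> S"
      using pb unfolding is_rel_pullback_def by (metis ident_type cone(3,4) monoid_type(1)[OF Y] Y_carr)
    \<comment> \<open>precompose \<open>(1, s)\<close> with the splitting \<open>i\<close> of \<open>s\<close>, then postcompose with \<open>s\<close>\<close>
    have "(i, \<one> (carr MB)) \<in> S"
      using span_pre[OF D(8), of i] by (simp add: D(6))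
    then show "(\<one> (carr MB), \<one> (carr MB)) \<in> S"
      using span_post[of i "\<one> (carr MB)" s "\<one> (carr MB)"] by (simp add: D(6))
    have "px_e1 C P \<cdot> x = s \<cdot> q \<cdot> x"
      by (simp flip: sq)
    also have "\<dots> = (\<one> (carr MB) \<star>\<^bsub>MB\<^esub> unit MB) \<cdot> (\<one> (carr MB) \<otimes> e)"
      by (simp add: qx monoid_morphism_star[OF D(4) A B] cone(7) D(6) star_comp)
    finally show "px_e1 C P \<cdot> x = \<r> (carr MB) \<cdot> (\<one> (carr MB) \<otimes> e)"
      by (simp add: star_unit)
    have "mult MB \<cdot> ((t \<cdot> p) \<otimes> \<one> (carr MB)) \<cdot> x = (t \<cdot> q) \<cdot> x"
      by (simp add: tq star_def)
    also have "\<dots> = \<one> (carr MB) \<star>\<^bsub>MB\<^esub> (t \<cdot> p)"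
      by (simp add: qx monoid_morphism_star[OF D(5) A B] D(7))
    finally show "mult MB \<cdot> ((t \<cdot> p) \<otimes> \<one> (carr MB)) \<cdot> x = mult MB \<cdot> (\<one> (carr MB) \<otimes> (t \<cdot> p))"
      by (simp add: star_def)
  qed
  then interpret P: pre_crossed C S P .
  have q_mor: "is_monoid_morphism C P.composite MA q" and q_inY: "q \<cdot> P.inY = p" and q_inB: "q \<cdot> P.inB = i"
    using P.copairing[of MA p i] A p D(3) qx by (simp_all add: q_def')
  let ?f = "px_f C S P"
  note f = P.px_f[unfolded P]
  have inv_f: "invertible C ?f"
  proof -
    have "(q \<cdot> P.p, P.p') \<in> S"
      using span_post[OF rel_pullback_cone(1)[OF P.pullback S_spans], of q "\<one> I"] P.pullback_type by simp
    moreover have "s \<cdot> q \<cdot> P.p = unit MB \<cdot> P.p'"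
      using comp_cong_tail[OF sq, of P.p] rel_pullback_cone(7)[OF P.pullback S_spans] P.pullback_type
      by simp
    ultimately obtain h where h: "h \<in> Ar C" "Dom C h = Dom C P.p" "Cod C h = carr MY"
        and ph: "p \<cdot> h = q \<cdot> P.p" and eh: "e \<cdot> h = P.p'"
      using rel_pullback_lift[OF pb S_spans, of "q \<cdot> P.p" P.p'] P.pullback_type by auto
    note [simp] = h f(1-3)
    have "h \<cdot> ?f = \<one> (carr MY)"
    proof (rule rel_pullback_jointly_monic[OF pb admissible])
      show "p \<cdot> h \<cdot> ?f = p \<cdot> \<one> (carr MY)"
        using comp_cong_tail[OF ph, of ?f] P.pullback_type by (simp add: f(4) q_inY[unfolded P])
      show "e \<cdot> h \<cdot> ?f = e \<cdot> \<one> (carr MY)"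
        using comp_cong_tail[OF eh, of ?f] P.pullback_type by (simp add: f(5))
    qed simp_all
    moreover have "?f \<cdot> h = \<one> (Dom C P.p)"
    proof (rule P.monic)
      have qpfh: "q \<cdot> P.p \<cdot> ?f \<cdot> h = q \<cdot> P.p"
        using comp_cong_tail[OF f(4), of h] comp_cong_tail[OF q_inY, of h] P.in_type P.pullback_type
        by (simp add: ph)
      have "P.p \<cdot> ?f \<cdot> h = P.p"
        by (rule cancel_left_iso[OF q]) (use qpfh P.pullback_type in simp_all)
      then show "P.p \<cdot> ?f \<cdot> h = P.p \<cdot> \<one> (Dom C P.p)"
        using P.pullback_type by simp
      show "P.p' \<cdot> ?f \<cdot> h = P.p' \<cdot> \<one> (Dom C P.p)"
        using comp_cong_tail[OF f(5), of h] P.pullback_type by (simp add: eh)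
    qed (use P.pullback_type in simp_all)
    ultimately show ?thesis
      by (intro invertibleI[of ?f "carr MY" "Dom C P.p" h]) (simp_all add: Hom_def)
  qed
  let ?\<phi> = "\<lparr>src = P.graph, tgt = G, base = \<one> (carr MB), top = q\<rparr>"
  have mor: "refl_graph_mon_mor C S ?\<phi>"
    using P.graph_obj[OF inv_f] G monoid_morphism_ident[OF B] q_mor
    by (simp add: refl_graph_mon_mor_def sq tq q_inB[unfolded P] P.target_eq_star flip: defs)
  then have "invertible (ReflGraphMon C S) ?\<phi>"
    by (rule invertible_ReflGraphMon) (simp_all add: q invertible_ident)
  moreover have "?\<phi> \<in> Hom (ReflGraphMon C S) P.graph G"
    using mor by (simp add: ReflGraphMon_def Hom_def)
  ultimately show ?thesis
    using pre_x_objI[OF P.pre_crossed_axioms inv_f] by blast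
qed

end

theorem theorem2p1:
  fixes C :: "('o, 'a) mcat" and S :: "('a \<times> 'a) set"
  assumes "monoidal_category C"
    and "admissible C S"
    and "monoidal_class C S"
    and "\<And>f g. is_cospan C f g \<Longrightarrow> legs_in C S f g \<Longrightarrow> \<exists>pA pD. is_rel_pullback C S f g pA pD"
  shows "equivalent_categories (ReflGraphMon C S) (PreX C S)"
proof -
  interpret span_class C S
    using assms by (intro span_class.intro span_class_axioms.intro)
  show ?thesis
  proof (rule equivalent_categories_if_fully_faithful[OF graph_functor])
    show "\<exists>\<phi> \<in> Hom (PreX C S) P P'. graph_mor \<phi> = \<psi>"
      if "P \<in> Ob (PreX C S)" "P' \<in> Ob (PreX C S)"
        "\<psi> \<in> Hom (ReflGraphMon C S) (pre_crossed.graph C P) (pre_crossed.graph C P')" for P P' \<psi>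
      using graph_functor_full that by (simp add: PreX_def)
    show "\<phi> = \<psi>" if "\<phi> \<in> Hom (PreX C S) P P'" "\<psi> \<in> Hom (PreX C S) P P'" "graph_mor \<phi> = graph_mor \<psi>"
      for P P' \<phi> \<psi>
      using that by (rule graph_functor_faithful)
    show "\<exists>P \<in> Ob (PreX C S). \<exists>\<phi> \<in> Hom (ReflGraphMon C S) (pre_crossed.graph C P) G.
        invertible (ReflGraphMon C S) \<phi>" if "G \<in> Ob (ReflGraphMon C S)" for G
      using graph_functor_essentially_surjective[of G] that by (auto simp: PreX_def ReflGraphMon_def)
  qed
qed

end
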